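(* Let $\mathfrak q\in\mathbb C^\times$, $m=\mathfrak q+\mathfrak q^{-1}$, and let $M_1,M_2,M_3$ be three modules over the affine Temperley–Lieb algebras $\mathsf T^a_{N_1}(m)$, $\mathsf T^a_{N_2}(m)$ and $\mathsf T^a_{N_3}(m)$, respectively. The tensor product $\widehat\times_f$ is equipped with an associator, i.e. there is a family of natural isomorphisms of $\mathsf T^a_{N_1+N_2+N_3}(m)$-modules $$\alpha_{M_1,M_2,M_3}:(M_1\,\widehat\times_f\,M_2)\,\widehat\times_f\,M_3\xrightarrow{\ \cong\ }M_1\,\widehat\times_f\,(M_2\,\widehat\times_f\,M_3)$$ given explicitly, for $m_i\in M_i$, $a\in\mathsf T^a_{N_1+N_2+N_3}(m)$, $b\in\mathsf T^a_{N_1+N_2}(m)$, by $$a\otimes(b\otimes m_1\otimes m_2)\otimes m_3\mapsto a\cdot b\otimes\bigl(m_1\otimes(\mathbf1_{2+3}\otimes m_2\otimes m_3)\bigr),$$ where $\mathbf1_{2+3}$ is the identity of $\mathsf T^a_{N_2+N_3}$ and $a\cdot b$ is the product of $a$ with the image of $b$ under $\varepsilon_{N_1+N_2,N_3}$. The isomorphisms $\alpha_{M_1,M_2,M_3}$ satisfy the pentagon identity.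
   Context: For $N\ge1$, $\mathsf T^a_N=\mathsf T^a_N(m)$ is the $\mathbb C$-algebra spanned by affine diagrams: isotopy classes (boundary points fixed) of non-crossing pairings, drawn in an annulus, of $N$ points on the inner and $N$ on the outer boundary, possibly with non-contractible loops when there are no through-lines. The product $ab$ joins the inner boundary of $a$ to the outer boundary of $b$; contractible loops are replaced by $m$. Generators: $e_j$, $j\in\mathbb Z/N\mathbb Z$ (joining neighbours $j,j+1$ on each boundary, other points going straight; $e_0=e_N$), and the translation $u^{\pm1}$ ($u$ joins outer point $i+1$ to inner point $i$ for all $i$ mod $N$). For $N=1$, $\mathsf T^a_1=\mathbb C[u,u^{-1}]$. Fix $\mathfrak q^{1/2}$; $g_i^{\pm1}=\pm\mathrm i(\mathfrak q^{\pm1/2}\mathbf 1-\mathfrak q^{\mp1/2}e_i)$. With $N=N_1+N_2$, $\varepsilon_{N_1,N_2}:\mathsf T^a_{N_1}\otimes\mathsf T^a_{N_2}\to\mathsf T^a_N$ is the algebra map sending $e^{(1)}_j\mapsto e_j$ ($1\le j\le N_1-1$), $e^{(2)}_k\mapsto e_{N_1+k}$ ($1\le k\le N_2-1$), $u^{(1)}\mapsto u\,g_{N-1}^{-1}\cdots g_{N_1}^{-1}$, $u^{(2)}\mapsto g_{N_1}\cdots g_1u$, $e_0^{(1)}\mapsto g_{N_1}\cdots g_{N-1}e_0g_{N-1}^{-1}\cdots g_{N_1}^{-1}$, $e_0^{(2)}\mapsto g_0^{-1}\cdots g_{N_1-1}^{-1}e_{N_1}g_{N_1-1}\cdots g_0$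 (superscripts label the tensor factor). The image of $b\in\mathsf T^a_{N_1}$ under $\varepsilon_{N_1,N_2}$ means $\varepsilon_{N_1,N_2}(b\otimes\mathbf1)$. For $M_i$ a module over $\mathsf T^a_{N_i}$, $M_1\,\widehat\times_f\,M_2=\mathsf T^a_{N_1+N_2}\otimes_{\mathsf T^a_{N_1}\otimes\mathsf T^a_{N_2}}(M_1\otimes M_2)$, via $\varepsilon_{N_1,N_2}$; on morphisms $f\,\widehat\times_f\,g=\mathrm{id}\otimes f\otimes g$. Pentagon identity: $\alpha_{M_1,M_2,M_3\widehat\times_fM_4}\circ\alpha_{M_1\widehat\times_fM_2,M_3,M_4}=(\mathrm{id}_{M_1}\widehat\times_f\alpha_{M_2,M_3,M_4})\circ\alpha_{M_1,M_2\widehat\times_fM_3,M_4}\circ(\alpha_{M_1,M_2,M_3}\widehat\times_f\mathrm{id}_{M_4})$. *)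

theory Defs
  imports Complex_Main "HOL-Algebra.RingHom" "HOL-Algebra.Module" "HOL-Library.Poly_Mapping"
begin

text \<open>The vector space with basis \<open>'b\<close> is the type \<open>'b \<Rightarrow>\<^sub>0 complex\<close> of finitely supported functions.\<close>

definition pm_scale :: "complex \<Rightarrow> ('b \<Rightarrow>\<^sub>0 complex) \<Rightarrow> ('b \<Rightarrow>\<^sub>0 complex)" where
  "pm_scale c v = Poly_Mapping.map ((*) c) v"

lemma lookup_pm_scale: "Poly_Mapping.lookup (pm_scale c v) b = c * Poly_Mapping.lookup v b"
  by (simp add: pm_scale_def Poly_Mapping.map.rep_eq when_def)

interpretation pm: vector_space pm_scale
  by unfold_locales
    (simp_all add: poly_mapping_eq_iff fun_eq_iff lookup_pm_scale lookup_add algebra_simps)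

abbreviation basis :: "'b \<Rightarrow> ('b \<Rightarrow>\<^sub>0 complex)" where
  "basis b \<equiv> Poly_Mapping.single b 1"

definition pm_extend :: "('b \<Rightarrow> ('d \<Rightarrow>\<^sub>0 complex)) \<Rightarrow> ('b \<Rightarrow>\<^sub>0 complex) \<Rightarrow> ('d \<Rightarrow>\<^sub>0 complex)" where
  "pm_extend \<phi> v = (\<Sum>b\<in>Poly_Mapping.keys v. pm_scale (Poly_Mapping.lookup v b) (\<phi> b))"

definition pm_tensor ::
    "('b \<Rightarrow>\<^sub>0 complex) \<Rightarrow> ('d \<Rightarrow>\<^sub>0 complex) \<Rightarrow> ('b \<times> 'd \<Rightarrow>\<^sub>0 complex)" where
  "pm_tensor x y = pm_extend (\<lambda>a. pm_extend (\<lambda>b. basis (a, b)) y) x"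

definition basis_algebra ::
    "'b set \<Rightarrow> ('b \<Rightarrow> 'b \<Rightarrow> ('b \<Rightarrow>\<^sub>0 complex)) \<Rightarrow> 'b \<Rightarrow> ('b \<Rightarrow>\<^sub>0 complex) ring" where
  "basis_algebra B p e =
     \<lparr>carrier = {v. Poly_Mapping.keys v \<subseteq> B},
      monoid.mult = (\<lambda>x y. pm_extend (\<lambda>a. pm_extend (p a) y) x),
      monoid.one = basis e, ring.zero = 0, ring.add = (+)\<rparr>"


section \<open>Affine diagrams\<close>

text \<open>
  The annulus is cut open: its universal cover is the strip \<open>\<real> \<times> [0,1]\<close>, whose two boundary lines
  carry the points \<open>(Outer, i)\<close> and \<open>(Inner, i)\<close>, \<open>i :: int\<close>; the point \<open>i\<close> on a circle lifts to
  \<open>i + k N\<close>, and both circles are run through in the same direction. Since the boundary points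
  are fixed under isotopy, a diagram without its closed loops is the same as an \<open>N\<close>-periodic
  non-crossing pairing of these points, given by the involution exchanging partners. (It thus
  records how through-lines wind around the annulus.) The second component of a diagram is its
  number of non-contractible loops; the product removes the contractible ones.
\<close>

datatype side = Outer | Inner

type_synonym point = "side \<times> int"
type_synonym affdiag = "(point \<Rightarrow> point) \<times> nat"

fun opposite :: "side \<Rightarrow> side" where
  "opposite Outer = Inner"
| "opposite Inner = Outer"

text \<open>Order of the boundary points of the strip along its boundary: the outer line from left to
  right, then the inner line from right to left.\<close>

fun boundary_less :: "point \<Rightarrow> point \<Rightarrow> bool" (infix \<open>\<lless>\<close> 50) where
  "(Outer, i) \<lless> (Outer, j) \<longleftrightarrow> i < j"
| "(Outer, i) \<lless> (Inner, j) \<longleftrightarrow> True"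
| "(Inner, i) \<lless> (Outer, j) \<longleftrightarrow> False"
| "(Inner, i) \<lless> (Inner, j) \<longleftrightarrow> j < i"

definition affdiags :: "nat \<Rightarrow> affdiag set" where
  "affdiags N = {(\<sigma>, k).
     (\<forall>p. \<sigma> (\<sigma> p) = p \<and> \<sigma> p \<noteq> p) \<and>
     (\<forall>x i. \<sigma> (x, i + int N) = (fst (\<sigma> (x, i)), snd (\<sigma> (x, i)) + int N)) \<and>
     (\<forall>p r. \<not> (p \<lless> r \<and> r \<lless> \<sigma> p \<and> \<sigma> p \<lless> \<sigma> r)) \<and>
     (k = 0 \<or> (\<forall>p. fst (\<sigma> p) = fst p))}"

text \<open>
  In the product \<open>a b\<close> the inner boundary of \<open>a\<close> is glued to the outer boundary of \<open>b\<close>. The points of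
  the glued strip lie on three lines.
\<close>

datatype line = OuterLine | MiddleLine | InnerLine

fun in_upper :: "point \<Rightarrow> line \<times> int" where
  "in_upper (Outer, i) = (OuterLine, i)"
| "in_upper (Inner, i) = (MiddleLine, i)"

fun in_lower :: "point \<Rightarrow> line \<times> int" where
  "in_lower (Outer, i) = (MiddleLine, i)"
| "in_lower (Inner, i) = (InnerLine, i)"

fun in_glued :: "point \<Rightarrow> line \<times> int" where
  "in_glued (Outer, i) = (OuterLine, i)"
| "in_glued (Inner, i) = (InnerLine, i)"

definition connected_in :: "affdiag \<Rightarrow> affdiag \<Rightarrow> ((line \<times> int) \<times> (line \<times> int)) set" where
  "connected_in a b =
     ({(in_upper p, in_upper (fst a p)) | p. True} \<union>
      {(in_lower p, in_lower (fst b p)) | p. True})\<^sup>*"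

text \<open>
  Lifts to the strip of the closed loops created by gluing. A contractible loop lifts to bounded
  components, a non-contractible one to an unbounded component; lifts that are translates of each
  other by multiples of \<open>N\<close> belong to the same loop in the annulus.
\<close>

definition lifted_loops :: "affdiag \<Rightarrow> affdiag \<Rightarrow> (line \<times> int) set set" where
  "lifted_loops a b = {C \<in> UNIV // connected_in a b. C \<subseteq> {MiddleLine} \<times> UNIV}"

definition all_translates :: "nat \<Rightarrow> (line \<times> int) set \<Rightarrow> (line \<times> int) set" where
  "all_translates N C = {(l, i + k * int N) | l i k. (l, i) \<in> C}"

definition contractible_loops :: "nat \<Rightarrow> affdiag \<Rightarrow> affdiag \<Rightarrow> nat" where
  "contractible_loops N a b = card (all_translates N ` {C \<in> lifted_loops a b. finite C})"

definition noncontractible_loops :: "nat \<Rightarrow> affdiag \<Rightarrow> affdiag \<Rightarrow> nat" where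
  "noncontractible_loops N a b = card (all_translates N ` {C \<in> lifted_loops a b. infinite C})"

definition glue :: "nat \<Rightarrow> affdiag \<Rightarrow> affdiag \<Rightarrow> affdiag" where
  "glue N a b =
     (\<lambda>p. THE r. r \<noteq> p \<and> (in_glued p, in_glued r) \<in> connected_in a b,
      snd a + snd b + noncontractible_loops N a b)"

definition diag_one :: affdiag where
  "diag_one = (\<lambda>(x, i). (opposite x, i), 0)"

definition diag_u :: affdiag where
  "diag_u = (\<lambda>(x, i). case x of Outer \<Rightarrow> (Inner, i - 1) | Inner \<Rightarrow> (Outer, i + 1), 0)"

text \<open>Only meaningful for \<open>N \<ge> 2\<close>.\<close>

definition diag_e :: "nat \<Rightarrow> int \<Rightarrow> affdiag" where
  "diag_e N j =
     (\<lambda>(x, i). if int N dvd i - j then (x, i + 1)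
               else if int N dvd i - j - 1 then (x, i - 1)
               else (opposite x, i), 0)"


section \<open>Affine Temperley--Lieb algebras\<close>

definition diag_mult :: "complex \<Rightarrow> nat \<Rightarrow> affdiag \<Rightarrow> affdiag \<Rightarrow> (affdiag \<Rightarrow>\<^sub>0 complex)" where
  "diag_mult m N a b = Poly_Mapping.single (glue N a b) (m ^ contractible_loops N a b)"

definition aTL :: "complex \<Rightarrow> nat \<Rightarrow> (affdiag \<Rightarrow>\<^sub>0 complex) ring" where
  "aTL m N = basis_algebra (affdiags N) (diag_mult m N) diag_one"

definition aTL_tensor ::
    "complex \<Rightarrow> nat \<Rightarrow> nat \<Rightarrow> (affdiag \<times> affdiag \<Rightarrow>\<^sub>0 complex) ring" where
  "aTL_tensor m N1 N2 =
     basis_algebra (affdiags N1 \<times> affdiags N2)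
       (\<lambda>(a, b) (c, d). pm_tensor (diag_mult m N1 a c) (diag_mult m N2 b d))
       (diag_one, diag_one)"

abbreviation tl_one :: "affdiag \<Rightarrow>\<^sub>0 complex" where
  "tl_one \<equiv> basis diag_one"

abbreviation tl_u :: "affdiag \<Rightarrow>\<^sub>0 complex" where
  "tl_u \<equiv> basis diag_u"

abbreviation tl_e :: "nat \<Rightarrow> int \<Rightarrow> (affdiag \<Rightarrow>\<^sub>0 complex)" where
  "tl_e N j \<equiv> basis (diag_e N j)"

definition tl_prod ::
    "complex \<Rightarrow> nat \<Rightarrow> (affdiag \<Rightarrow>\<^sub>0 complex) list \<Rightarrow> (affdiag \<Rightarrow>\<^sub>0 complex)" where
  "tl_prod m N xs = foldr (\<otimes>\<^bsub>aTL m N\<^esub>) xs tl_one"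

text \<open>The braid generators; \<open>s\<close> stands for the chosen square root of \<open>q\<close>.\<close>

definition tl_g :: "complex \<Rightarrow> nat \<Rightarrow> int \<Rightarrow> (affdiag \<Rightarrow>\<^sub>0 complex)" where
  "tl_g s N j = pm_scale \<i> (pm_scale s tl_one - pm_scale (inverse s) (tl_e N j))"

definition tl_g_inv :: "complex \<Rightarrow> nat \<Rightarrow> int \<Rightarrow> (affdiag \<Rightarrow>\<^sub>0 complex)" where
  "tl_g_inv s N j = pm_scale (- \<i>) (pm_scale (inverse s) tl_one - pm_scale s (tl_e N j))"

definition fusion_embedding ::
    "complex \<Rightarrow> complex \<Rightarrow> nat \<Rightarrow> nat \<Rightarrow>
     ((affdiag \<times> affdiag \<Rightarrow>\<^sub>0 complex) \<Rightarrow> (affdiag \<Rightarrow>\<^sub>0 complex)) \<Rightarrow> bool" where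
  "fusion_embedding m s N1 N2 \<epsilon> \<longleftrightarrow>
     (let N = N1 + N2; n1 = int N1; n = int N; g = tl_g s N; g' = tl_g_inv s N in
      ring_hom_ring (aTL_tensor m N1 N2) (aTL m N) \<epsilon> \<and>
      (\<forall>c. \<forall>x\<in>carrier (aTL_tensor m N1 N2). \<epsilon> (pm_scale c x) = pm_scale c (\<epsilon> x)) \<and>
      (\<forall>j\<in>{1..n1 - 1}. \<epsilon> (pm_tensor (tl_e N1 j) tl_one) = tl_e N j) \<and>
      (\<forall>k\<in>{1..int N2 - 1}. \<epsilon> (pm_tensor tl_one (tl_e N2 k)) = tl_e N (n1 + k)) \<and>
      \<epsilon> (pm_tensor tl_u tl_one) = tl_prod m N (tl_u # map g' (rev [n1..n - 1])) \<and>
      \<epsilon> (pm_tensor tl_one tl_u) = tl_prod m N (map g (rev [1..n1]) @ [tl_u]) \<and>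
      (N1 \<ge> 2 \<longrightarrow> \<epsilon> (pm_tensor (tl_e N1 0) tl_one) =
         tl_prod m N (map g [n1..n - 1] @ [tl_e N 0] @ map g' (rev [n1..n - 1]))) \<and>
      (N2 \<ge> 2 \<longrightarrow> \<epsilon> (pm_tensor tl_one (tl_e N2 0)) =
         tl_prod m N (map g' [0..n1 - 1] @ [tl_e N n1] @ map g (rev [0..n1 - 1]))))"


section \<open>Modules\<close>

text \<open>As the library's locale \<open>module\<close>, but without commutativity of the ring.\<close>

locale left_module = R?: ring R + M?: abelian_group M for R (structure) and M (structure) +
  assumes lsmult_closed:
      "\<lbrakk>a \<in> carrier R; x \<in> carrier M\<rbrakk> \<Longrightarrow> a \<odot>\<^bsub>M\<^esub> x \<in> carrier M"
    and lsmult_l_distr: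
      "\<lbrakk>a \<in> carrier R; b \<in> carrier R; x \<in> carrier M\<rbrakk> \<Longrightarrow>
       (a \<oplus> b) \<odot>\<^bsub>M\<^esub> x = a \<odot>\<^bsub>M\<^esub> x \<oplus>\<^bsub>M\<^esub> b \<odot>\<^bsub>M\<^esub> x"
    and lsmult_r_distr:
      "\<lbrakk>a \<in> carrier R; x \<in> carrier M; y \<in> carrier M\<rbrakk> \<Longrightarrow>
       a \<odot>\<^bsub>M\<^esub> (x \<oplus>\<^bsub>M\<^esub> y) = a \<odot>\<^bsub>M\<^esub> x \<oplus>\<^bsub>M\<^esub> a \<odot>\<^bsub>M\<^esub> y"
    and lsmult_assoc:
      "\<lbrakk>a \<in> carrier R; b \<in> carrier R; x \<in> carrier M\<rbrakk> \<Longrightarrow>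
       (a \<otimes> b) \<odot>\<^bsub>M\<^esub> x = a \<odot>\<^bsub>M\<^esub> (b \<odot>\<^bsub>M\<^esub> x)"
    and lsmult_one:
      "x \<in> carrier M \<Longrightarrow> \<one> \<odot>\<^bsub>M\<^esub> x = x"

definition lmod_hom :: "'r ring \<Rightarrow> ('r, 'a) module \<Rightarrow> ('r, 'b) module \<Rightarrow> ('a \<Rightarrow> 'b) set" where
  "lmod_hom R M M' = {h \<in> carrier M \<rightarrow> carrier M'.
     (\<forall>x\<in>carrier M. \<forall>y\<in>carrier M. h (x \<oplus>\<^bsub>M\<^esub> y) = h x \<oplus>\<^bsub>M'\<^esub> h y) \<and>
     (\<forall>r\<in>carrier R. \<forall>x\<in>carrier M. h (r \<odot>\<^bsub>M\<^esub> x) = r \<odot>\<^bsub>M'\<^esub> h x)}"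

definition lmod_iso :: "'r ring \<Rightarrow> ('r, 'a) module \<Rightarrow> ('r, 'b) module \<Rightarrow> ('a \<Rightarrow> 'b) \<Rightarrow> bool" where
  "lmod_iso R M M' h \<longleftrightarrow>
     left_module R M \<and> left_module R M' \<and> h \<in> lmod_hom R M M' \<and> bij_betw h (carrier M) (carrier M')"

type_synonym 'a tlmod = "(affdiag \<Rightarrow>\<^sub>0 complex, 'a) module"

text \<open>Complex numbers act on a module as multiples of the unit of the algebra.\<close>

abbreviation cact :: "'a tlmod \<Rightarrow> complex \<Rightarrow> 'a \<Rightarrow> 'a" where
  "cact M c x \<equiv> pm_scale c tl_one \<odot>\<^bsub>M\<^esub> x"


section \<open>Fusion product\<close>

type_synonym embeddings =
  "nat \<Rightarrow> nat \<Rightarrow> (affdiag \<times> affdiag \<Rightarrow>\<^sub>0 complex) \<Rightarrow> (affdiag \<Rightarrow>\<^sub>0 complex)"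

type_synonym ('a, 'b) fus = "((affdiag \<Rightarrow>\<^sub>0 complex) \<times> 'a \<times> 'b \<Rightarrow>\<^sub>0 complex) set"

text \<open>
  With \<open>T\<close> the algebra on \<open>N1 + N2\<close> points and \<open>A\<close> the tensor product of those on \<open>N1\<close> and on \<open>N2\<close> points,
  the module \<open>T \<otimes>\<^sub>A (M1 \<otimes> M2)\<close> is the free vector space on the triples \<open>(a, x, y)\<close> modulo
  the subspace spanned by the relations making \<open>a \<otimes> x \<otimes> y\<close> trilinear and balanced over \<open>A\<close>. The
  latter are imposed for the spanning elements \<open>b \<otimes> c\<close> of \<open>A\<close>, which act on \<open>M1 \<otimes> M2\<close> factorwise.
  The multiplicative part of the records below is irrelevant, as usual for modules.
\<close>

definition fusion_free ::
    "complex \<Rightarrow> nat \<Rightarrow> nat \<Rightarrow> 'a tlmod \<Rightarrow> 'b tlmod \<Rightarrow>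
     ((affdiag \<Rightarrow>\<^sub>0 complex) \<times> 'a \<times> 'b \<Rightarrow>\<^sub>0 complex) ring" where
  "fusion_free m N1 N2 M1 M2 =
     \<lparr>carrier = {v. Poly_Mapping.keys v \<subseteq> carrier (aTL m (N1 + N2)) \<times> carrier M1 \<times> carrier M2},
      monoid.mult = undefined, monoid.one = undefined, ring.zero = 0, ring.add = (+)\<rparr>"

definition fusion_rels ::
    "complex \<Rightarrow> embeddings \<Rightarrow> nat \<Rightarrow> nat \<Rightarrow> 'a tlmod \<Rightarrow> 'b tlmod \<Rightarrow> ('a, 'b) fus" where
  "fusion_rels m eps N1 N2 M1 M2 = (let T = aTL m (N1 + N2) in pm.span (
     {basis (a \<oplus>\<^bsub>T\<^esub> a', x, y) - basis (a, x, y) - basis (a', x, y) | a a' x y.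
        a \<in> carrier T \<and> a' \<in> carrier T \<and> x \<in> carrier M1 \<and> y \<in> carrier M2} \<union>
     {basis (a, x \<oplus>\<^bsub>M1\<^esub> x', y) - basis (a, x, y) - basis (a, x', y) | a x x' y.
        a \<in> carrier T \<and> x \<in> carrier M1 \<and> x' \<in> carrier M1 \<and> y \<in> carrier M2} \<union>
     {basis (a, x, y \<oplus>\<^bsub>M2\<^esub> y') - basis (a, x, y) - basis (a, x, y') | a x y y'.
        a \<in> carrier T \<and> x \<in> carrier M1 \<and> y \<in> carrier M2 \<and> y' \<in> carrier M2} \<union>
     {basis (pm_scale c a, x, y) - pm_scale c (basis (a, x, y)) | c a x y.
        a \<in> carrier T \<and> x \<in> carrier M1 \<and> y \<in> carrier M2} \<union>
     {basis (a, cact M1 c x, y) - pm_scale c (basis (a, x, y)) | c a x y.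
        a \<in> carrier T \<and> x \<in> carrier M1 \<and> y \<in> carrier M2} \<union>
     {basis (a, x, cact M2 c y) - pm_scale c (basis (a, x, y)) | c a x y.
        a \<in> carrier T \<and> x \<in> carrier M1 \<and> y \<in> carrier M2} \<union>
     {basis (a \<otimes>\<^bsub>T\<^esub> eps N1 N2 (pm_tensor b c), x, y) - basis (a, b \<odot>\<^bsub>M1\<^esub> x, c \<odot>\<^bsub>M2\<^esub> y) | a b c x y.
        a \<in> carrier T \<and> b \<in> carrier (aTL m N1) \<and> c \<in> carrier (aTL m N2) \<and>
        x \<in> carrier M1 \<and> y \<in> carrier M2}))"

definition fusion_coset ::
    "complex \<Rightarrow> embeddings \<Rightarrow> nat \<Rightarrow> nat \<Rightarrow> 'a tlmod \<Rightarrow> 'b tlmod \<Rightarrow>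
     ((affdiag \<Rightarrow>\<^sub>0 complex) \<times> 'a \<times> 'b \<Rightarrow>\<^sub>0 complex) \<Rightarrow> ('a, 'b) fus" where
  "fusion_coset m eps N1 N2 M1 M2 v =
     fusion_rels m eps N1 N2 M1 M2 +>\<^bsub>fusion_free m N1 N2 M1 M2\<^esub> v"

definition fusion ::
    "complex \<Rightarrow> embeddings \<Rightarrow> nat \<Rightarrow> nat \<Rightarrow> 'a tlmod \<Rightarrow> 'b tlmod \<Rightarrow> ('a, 'b) fus tlmod" where
  "fusion m eps N1 N2 M1 M2 =
     \<lparr>carrier = a_rcosets\<^bsub>fusion_free m N1 N2 M1 M2\<^esub> (fusion_rels m eps N1 N2 M1 M2),
      monoid.mult = undefined, monoid.one = undefined,
      ring.zero = fusion_rels m eps N1 N2 M1 M2,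
      ring.add = set_add (fusion_free m N1 N2 M1 M2),
      smult = (\<lambda>t X. \<Union>v\<in>X. fusion_coset m eps N1 N2 M1 M2
                 (pm_extend (\<lambda>(a, x, y). basis (t \<otimes>\<^bsub>aTL m (N1 + N2)\<^esub> a, x, y)) v))\<rparr>"

definition fusion_elem ::
    "complex \<Rightarrow> embeddings \<Rightarrow> nat \<Rightarrow> nat \<Rightarrow> 'a tlmod \<Rightarrow> 'b tlmod \<Rightarrow>
     (affdiag \<Rightarrow>\<^sub>0 complex) \<Rightarrow> 'a \<Rightarrow> 'b \<Rightarrow> ('a, 'b) fus" where
  "fusion_elem m eps N1 N2 M1 M2 a x y = fusion_coset m eps N1 N2 M1 M2 (basis (a, x, y))"

text \<open>The morphism \<open>id \<otimes> f \<otimes> g\<close>; the modules named here are those of the codomain.\<close>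

definition fusion_map ::
    "complex \<Rightarrow> embeddings \<Rightarrow> nat \<Rightarrow> nat \<Rightarrow> 'c tlmod \<Rightarrow> 'd tlmod \<Rightarrow>
     ('a \<Rightarrow> 'c) \<Rightarrow> ('b \<Rightarrow> 'd) \<Rightarrow> ('a, 'b) fus \<Rightarrow> ('c, 'd) fus" where
  "fusion_map m eps N1 N2 M1' M2' f g X =
     (\<Union>v\<in>X. fusion_coset m eps N1 N2 M1' M2' (pm_extend (\<lambda>(a, x, y). basis (a, f x, g y)) v))"


section \<open>Associator\<close>

definition associator_formula ::
    "complex \<Rightarrow> embeddings \<Rightarrow> nat \<Rightarrow> nat \<Rightarrow> nat \<Rightarrow> 'a tlmod \<Rightarrow> 'b tlmod \<Rightarrow> 'c tlmod \<Rightarrow>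
     ((('a, 'b) fus, 'c) fus \<Rightarrow> ('a, ('b, 'c) fus) fus) \<Rightarrow> bool" where
  "associator_formula m eps N1 N2 N3 M1 M2 M3 \<alpha> \<longleftrightarrow>
     (\<forall>a\<in>carrier (aTL m (N1 + N2 + N3)). \<forall>b\<in>carrier (aTL m (N1 + N2)).
      \<forall>x\<in>carrier M1. \<forall>y\<in>carrier M2. \<forall>z\<in>carrier M3.
        \<alpha> (fusion_elem m eps (N1 + N2) N3 (fusion m eps N1 N2 M1 M2) M3
              a (fusion_elem m eps N1 N2 M1 M2 b x y) z) =
        fusion_elem m eps N1 (N2 + N3) M1 (fusion m eps N2 N3 M2 M3)
          (a \<otimes>\<^bsub>aTL m (N1 + N2 + N3)\<^esub> eps (N1 + N2) N3 (pm_tensor b tl_one))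
          x (fusion_elem m eps N2 N3 M2 M3 tl_one y z))"

text \<open>
  A homomorphism satisfying the formula is determined on its carrier, because the elements in the
  formula span the domain.
\<close>

definition associator ::
    "complex \<Rightarrow> embeddings \<Rightarrow> nat \<Rightarrow> nat \<Rightarrow> nat \<Rightarrow> 'a tlmod \<Rightarrow> 'b tlmod \<Rightarrow> 'c tlmod \<Rightarrow>
     (('a, 'b) fus, 'c) fus \<Rightarrow> ('a, ('b, 'c) fus) fus" where
  "associator m eps N1 N2 N3 M1 M2 M3 = (SOME \<alpha>.
     \<alpha> \<in> lmod_hom (aTL m (N1 + N2 + N3))
           (fusion m eps (N1 + N2) N3 (fusion m eps N1 N2 M1 M2) M3)
           (fusion m eps N1 (N2 + N3) M1 (fusion m eps N2 N3 M2 M3)) \<and>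
     associator_formula m eps N1 N2 N3 M1 M2 M3 \<alpha>)"

end

theory Submission
  imports Defs
begin

text \<open>
  The associator is well defined because the embeddings are associative:
  \<open>\<epsilon>(\<epsilon>(x \<otimes> y) \<otimes> z) = \<epsilon>(x \<otimes> \<epsilon>(y \<otimes> z))\<close>. Each side splits into a product of images of
  \<open>x \<otimes> 1 \<otimes> 1\<close>, \<open>1 \<otimes> y \<otimes> 1\<close> and \<open>1 \<otimes> 1 \<otimes> z\<close>, so it is enough to compare algebra homomorphisms on
  generators. On \<open>u\<close> and on \<open>e\<^sub>1, \<dots>, e_{N-1}\<close> both sides are literally the same words in the \<open>g\<^sub>j\<close>, up to
  bracketing. That \<open>u\<close> and the \<open>e\<^sub>j\<close> generate is shown by surgery: a diagram with an arc joining
  \<open>j\<close> and \<open>j + 1\<close> on the outer boundary is \<open>e\<^sub>j d'\<close>, where \<open>d'\<close> is obtained by reconnecting this arc with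
  another strand next to it (or with a non-contractible loop). Such steps move the arc along the
  outer boundary, then merge it with an arc of the inner boundary into two through-lines, until
  only a translation is left. Inverse, naturality and pentagon are then checked on elements
  \<open>a \<otimes> (b \<otimes> x \<otimes> y) \<otimes> z\<close>.
\<close>

section \<open>Gluing affine diagrams\<close>

text \<open>Since \<open>m = q + 1/q\<close> may be zero, a diagram cannot in general be recovered
  from a product that creates a contractible loop. Every surgery is therefore arranged so that
  gluing creates none, and the product in the algebra is then the basis vector of the glued diagram,
  with coefficient 1. As each \<open>e_j\<close> is a conjugate of \<open>e_1\<close> by a power of
  \<open>u\<close>, comparing two homomorphisms comes down to \<open>u\<close> and
  \<open>e_1\<close>; the inverse of \<open>u\<close> follows because inverses are unique. The ring
  laws of \<open>aTL m N\<close> are not derived from gluing: for \<open>N \<ge> 2\<close> they are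
  contained in the statement that an embedding into this algebra is a ring homomorphism, and on the
  given factors they are contained in the module hypotheses. Maps out of an iterated fusion product
  are constructed in two stages, a lift over the inner product for fixed outer entries and then a
  lift in these entries. The first stage rests on the associativity of the embeddings, the second
  one moreover on the fact that the images of \<open>b \<otimes> 1\<close> and
  \<open>1 \<otimes> c\<close> commute.\<close>

definition translate :: "int \<Rightarrow> point \<Rightarrow> point" where
  "translate t p = (fst p, snd p + t)"

lemma translate_simps [simp]:
  "translate t (x, i) = (x, i + t)" "fst (translate t p) = fst p" "snd (translate t p) = snd p + t"
  "translate 0 p = p" "translate t (translate t' p) = translate (t + t') p"
  by (simp_all add: translate_def)

lemma translate_inject [simp]: "translate t p = translate t r \<longleftrightarrow> p = r"
  by (cases p; cases r) simp

lemma translate_less [simp]: "translate t p \<lless> translate t r \<longleftrightarrow> p \<lless> r"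
  by (cases p; cases r; cases "fst p"; cases "fst r") simp_all

text \<open>Non-crossing is kept apart: gluing works with the involution and its periodicity, and a
  reconnected matching is shown to be periodic before it is shown to be non-crossing.\<close>

locale periodic_matching =
  fixes N :: nat and \<sigma> :: "point \<Rightarrow> point"
  assumes N_pos: "N \<ge> 1"
    and invol [simp]: "\<sigma> (\<sigma> p) = p"
    and no_fix [simp]: "\<sigma> p \<noteq> p"
    and shift_period: "\<sigma> (x, i + int N) = (fst (\<sigma> (x, i)), snd (\<sigma> (x, i)) + int N)"
begin

lemma inject [simp]: "\<sigma> p = \<sigma> r \<longleftrightarrow> p = r"
  by (metis invol)

lemma periodic: "int N dvd t \<Longrightarrow> \<sigma> (translate t p) = translate t (\<sigma> p)"
proof -
  have pos: "\<sigma> (translate (int (k * N)) p) = translate (int (k * N)) (\<sigma> p)" for k p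
  proof (induction k)
    case (Suc k)
    have "translate (int (Suc k * N)) p = (fst p, snd (translate (int (k * N)) p) + int N)" for p
      by (cases p) (simp add: algebra_simps)
    with Suc shift_period[of "fst p" "snd p + int (k * N)"] show ?case
      by (simp add: translate_def algebra_simps)
  qed simp
  assume "int N dvd t"
  then obtain k where k: "t = int N * k" by (auto simp: dvd_def)
  show ?thesis
  proof (cases "k \<ge> 0")
    case True
    then show ?thesis using pos[of "nat k" p] k by (simp add: mult.commute)
  next
    case False
    then have "t = - int (nat (- k) * N)" using k by simp
    moreover have "\<sigma> (translate (int (nat (- k) * N)) (translate t p)) =
        translate (int (nat (- k) * N)) (\<sigma> (translate t p))"
      by (rule pos)
    ultimately have "\<sigma> p = translate (- t) (\<sigma> (translate t p))"
      by (metis add.inverse_inverse add.left_inverse translate_simps(4,5))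
    then show ?thesis by simp
  qed
qed

lemma periodic_pair: "int N dvd t \<Longrightarrow> \<sigma> (x, i + t) = translate t (\<sigma> (x, i))"
  using periodic[of t "(x, i)"] by simp

text \<open>If \<open>p\<close> were joined to its translate by \<open>t\<close>, then applying
  \<open>\<sigma>\<close> twice would translate by \<open>2 t\<close>; an involution forces
  \<open>t = 0\<close>, hence a fixed point. In the annulus: no point is its own partner, however
  the strand winds.\<close>

lemma partner_not_translate: "int N dvd t \<Longrightarrow> \<sigma> p \<noteq> translate t p"
proof
  assume *: "int N dvd t" "\<sigma> p = translate t p"
  then have "p = translate t (translate t p)" using periodic[of t p] invol[of p] by metis
  then have "t = 0" by (cases p) simp
  with * show False by simp
qed

end

section \<open>Connectivity in the glued strip\<close>

lemma connected_refl: "(v, v) \<in> connected_in a b"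
  by (simp add: connected_in_def)

lemma connected_trans:
  "(u, v) \<in> connected_in a b \<Longrightarrow> (v, w) \<in> connected_in a b \<Longrightarrow> (u, w) \<in> connected_in a b"
  unfolding connected_in_def by (rule rtrancl_trans)

lemma connected_upper: "(in_upper p, in_upper (fst a p)) \<in> connected_in a b"
  unfolding connected_in_def by (rule r_into_rtrancl) blast

lemma connected_lower: "(in_lower p, in_lower (fst b p)) \<in> connected_in a b"
  unfolding connected_in_def by (rule r_into_rtrancl) blast

text \<open>Different components are always told apart by a labelling: a function that does not
  change along the strands of either factor is constant on components, so no paths have to be
  excluded.\<close>

lemma connected_invariant:
  assumes "\<And>p. c (in_upper (fst a p)) = c (in_upper p)"
    and "\<And>p. c (in_lower (fst b p)) = c (in_lower p)"
    and "(v, w) \<in> connected_in a b"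
  shows "c w = c v"
  using assms(3) unfolding connected_in_def
  by (induction rule: rtrancl_induct) (use assms(1,2) in auto)

text \<open>The components of the glued strip are told apart by their sets of ends.\<close>

lemma fst_glue_eqI:
  assumes "\<And>p. c (in_upper (fst a p)) = c (in_upper p)"
    and "\<And>p. c (in_lower (fst b p)) = c (in_lower p)"
    and ends: "\<And>p. c (in_glued p) = {p, \<sigma> p}"
    and nf: "\<And>p. \<sigma> p \<noteq> p"
    and conn: "\<And>p. (in_glued p, in_glued (\<sigma> p)) \<in> connected_in a b"
  shows "fst (glue N a b) = \<sigma>"
proof
  fix p
  have "(THE r. r \<noteq> p \<and> (in_glued p, in_glued r) \<in> connected_in a b) = \<sigma> p"
  proof (rule the_equality)
    show "\<sigma> p \<noteq> p \<and> (in_glued p, in_glued (\<sigma> p)) \<in> connected_in a b"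
      using nf conn by blast
    fix r assume r: "r \<noteq> p \<and> (in_glued p, in_glued r) \<in> connected_in a b"
    then have "c (in_glued r) = c (in_glued p)"
      using connected_invariant[where c = c, OF assms(1,2)] by blast
    with r show "r = \<sigma> p" unfolding ends by blast
  qed
  then show "fst (glue N a b) p = \<sigma> p" by (simp add: glue_def)
qed

text \<open>A closed loop would be a component inside the middle line, so it is enough to be able to
  leave that line from each of its points.\<close>

lemma lifted_loops_empty:
  assumes "\<And>i. \<exists>v. ((MiddleLine, i), v) \<in> connected_in a b \<and> fst v \<noteq> MiddleLine"
  shows "lifted_loops a b = {}"
proof -
  have False if C: "C \<in> UNIV // connected_in a b" "C \<subseteq> {MiddleLine} \<times> UNIV" for C
  proof -
    obtain v where v: "C = connected_in a b `` {v}" using C(1) by (blast elim: quotientE)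
    then have "v \<in> C" using connected_refl by blast
    with C(2) obtain i where "v = (MiddleLine, i)" by auto
    with assms[of i] v C(2) show False by auto
  qed
  then show ?thesis by (auto simp: lifted_loops_def)
qed

section \<open>Left multiplication by powers of the translation\<close>

definition diag_shift :: "int \<Rightarrow> affdiag" where
  "diag_shift s = (\<lambda>(x, i). case x of Outer \<Rightarrow> (Inner, i - s) | Inner \<Rightarrow> (Outer, i + s), 0)"

text \<open>Left multiplication by the \<open>s\<close>-th power of \<open>u\<close> only renumbers
  the outer points; on matchings it is conjugation by this map.\<close>

definition rotate_outer :: "int \<Rightarrow> point \<Rightarrow> point" where
  "rotate_outer s p = (case fst p of Outer \<Rightarrow> (Outer, snd p + s) | Inner \<Rightarrow> p)"

lemma rotate_outer_simps [simp]:
  "rotate_outer s (Outer, i) = (Outer, i + s)" "rotate_outer s (Inner, i) = (Inner, i)"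
  "rotate_outer s (rotate_outer t p) = rotate_outer (s + t) p" "rotate_outer 0 p = p"
  "fst (rotate_outer s p) = fst p"
  by (cases p; cases "fst p"; simp add: rotate_outer_def)+

lemma diag_shift_1: "diag_shift 1 = diag_u" and diag_shift_0: "diag_shift 0 = diag_one"
  by (auto simp: diag_shift_def diag_u_def diag_one_def fun_eq_iff split: side.splits)

lemma diag_shift_simps [simp]:
  "fst (diag_shift s) (Outer, i) = (Inner, i - s)" "fst (diag_shift s) (Inner, i) = (Outer, i + s)"
  "snd (diag_shift s) = 0"
  by (simp_all add: diag_shift_def)

text \<open>The middle point \<open>i\<close> continues straight to the outer point
  \<open>i + s\<close>, so it carries the label of that point, and no component stays on the middle
  line.\<close>

lemma glue_shift:
  assumes inv: "\<And>p. \<sigma> (\<sigma> p) = p" and nf: "\<And>p. \<sigma> p \<noteq> p"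
  shows "glue N (diag_shift s) (\<sigma>, k) = (\<lambda>p. rotate_outer s (\<sigma> (rotate_outer (- s) p)), k)"
    and "contractible_loops N (diag_shift s) (\<sigma>, k) = 0"
proof -
  let ?a = "diag_shift s" and ?b = "(\<sigma>, k)"
  let ?\<tau> = "\<lambda>p. rotate_outer s (\<sigma> (rotate_outer (- s) p))"
  define c where "c v = (case v of (OuterLine, i) \<Rightarrow> {(Outer, i), ?\<tau> (Outer, i)}
    | (MiddleLine, i) \<Rightarrow> {(Outer, i + s), ?\<tau> (Outer, i + s)}
    | (InnerLine, i) \<Rightarrow> {(Inner, i), ?\<tau> (Inner, i)})" for v
  have low: "c (in_lower p) = {rotate_outer s p, rotate_outer s (\<sigma> p)}" for p
    by (cases p; cases "fst p") (auto simp: c_def)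
  have up: "(in_lower p, in_glued (rotate_outer s p)) \<in> connected_in ?a ?b"
    "(in_glued (rotate_outer s p), in_lower p) \<in> connected_in ?a ?b" for p
    using connected_upper[of "(Inner, snd p)" ?a ?b] connected_upper[of "(Outer, snd p + s)" ?a ?b]
    by (cases p; cases "fst p"; simp add: connected_refl)+
  have "fst (glue N ?a ?b) = ?\<tau>"
  proof (rule fst_glue_eqI[where c = c])
    show "c (in_upper (fst ?a p)) = c (in_upper p)" for p
      by (cases p; cases "fst p") (auto simp: c_def)
    show "c (in_lower (fst ?b p)) = c (in_lower p)" for p
      by (simp only: low fst_conv inv) blast
    show "c (in_glued p) = {p, ?\<tau> p}" for p
      by (cases p; cases "fst p") (auto simp: c_def)
    show "?\<tau> p \<noteq> p" for p
    proof
      assume "?\<tau> p = p"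
      then have "rotate_outer (- s) (?\<tau> p) = rotate_outer (- s) p" by simp
      then show False using nf by simp
    qed
    show "(in_glued p, in_glued (?\<tau> p)) \<in> connected_in ?a ?b" for p
    proof -
      let ?r = "rotate_outer (- s) p"
      have "(in_lower ?r, in_lower (\<sigma> ?r)) \<in> connected_in ?a ?b"
        using connected_lower[of ?r ?b ?a] by (simp only: fst_conv)
      then have "(in_glued (rotate_outer s ?r), in_glued (?\<tau> p)) \<in> connected_in ?a ?b"
        using up by (meson connected_trans)
      then show ?thesis by simp
    qed
  qed
  moreover have loops: "lifted_loops ?a ?b = {}"
  proof (rule lifted_loops_empty)
    fix i
    show "\<exists>v. ((MiddleLine, i), v) \<in> connected_in ?a ?b \<and> fst v \<noteq> MiddleLine"
      using up(1)[of "(Outer, i)"] by (intro exI[of _ "(OuterLine, i + s)"]) simp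
  qed
  ultimately show "glue N ?a ?b = (?\<tau>, k)"
    by (simp add: prod_eq_iff) (simp add: glue_def noncontractible_loops_def)
  show "contractible_loops N ?a ?b = 0" using loops by (simp add: contractible_loops_def)
qed

section \<open>Left multiplication by \<open>e_j\<close>, and the surgery that it reverses\<close>

definition arc_ends :: "nat \<Rightarrow> int \<Rightarrow> point set" where
  "arc_ends N j = {(Outer, i) | i. int N dvd i - j \<or> int N dvd i - j - 1}"

lemma arc_ends_simps [simp]:
  "(Outer, i) \<in> arc_ends N j \<longleftrightarrow> int N dvd i - j \<or> int N dvd i - j - 1"
  "(Inner, i) \<notin> arc_ends N j"
  by (simp_all add: arc_ends_def)

lemma arc_ends_translate [simp]:
  assumes "int N dvd t" shows "translate t p \<in> arc_ends N j \<longleftrightarrow> p \<in> arc_ends N j"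
proof -
  have "int N dvd i + t - j \<longleftrightarrow> int N dvd i - j" "int N dvd i + t - j - 1 \<longleftrightarrow> int N dvd i - j - 1" for i
    using dvd_add_left_iff[OF assms, of "i - j"] dvd_add_left_iff[OF assms, of "i - j - 1"]
    by (simp_all add: algebra_simps)
  then show ?thesis by (cases p; cases "fst p") simp_all
qed

lemma not_both_dvd: "N \<ge> 2 \<Longrightarrow> \<not> (int N dvd i \<and> int N dvd i - 1)"
proof
  assume "N \<ge> 2" "int N dvd i \<and> int N dvd i - 1"
  then have "int N dvd i - (i - 1)" by (meson dvd_diff)
  with \<open>N \<ge> 2\<close> show False by simp
qed

lemma diag_e_simps:
  "int N dvd i - j \<Longrightarrow> fst (diag_e N j) (x, i) = (x, i + 1)"
  "N \<ge> 2 \<Longrightarrow> int N dvd i - j - 1 \<Longrightarrow> fst (diag_e N j) (x, i) = (x, i - 1)"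
  "\<not> int N dvd i - j \<Longrightarrow> \<not> int N dvd i - j - 1 \<Longrightarrow> fst (diag_e N j) (x, i) = (opposite x, i)"
  "snd (diag_e N j) = 0"
  using not_both_dvd[of N "i - j"] by (auto simp: diag_e_def)

lemma connected_e_straight:
  assumes "p \<notin> arc_ends N j"
  shows "(in_glued p, in_lower p) \<in> connected_in (diag_e N j) b"
    "(in_lower p, in_glued p) \<in> connected_in (diag_e N j) b"
  using assms connected_upper[of "(Outer, snd p)" "diag_e N j" b]
    connected_upper[of "(Inner, snd p)" "diag_e N j" b]
  by (cases p; cases "fst p"; simp add: connected_refl diag_e_simps)+

lemma connected_e_arc:
  assumes "N \<ge> 2" "int N dvd i - j"
  shows "((OuterLine, i), (OuterLine, i + 1)) \<in> connected_in (diag_e N j) b"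
    "((OuterLine, i + 1), (OuterLine, i)) \<in> connected_in (diag_e N j) b"
    "((MiddleLine, i), (MiddleLine, i + 1)) \<in> connected_in (diag_e N j) b"
    "((MiddleLine, i + 1), (MiddleLine, i)) \<in> connected_in (diag_e N j) b"
  using assms connected_upper[of "(Outer, i)" "diag_e N j" b] connected_upper[of "(Outer, i + 1)" "diag_e N j" b]
    connected_upper[of "(Inner, i)" "diag_e N j" b] connected_upper[of "(Inner, i + 1)" "diag_e N j" b]
  by (simp_all add: diag_e_simps)

lemma arc_ends_cases:
  assumes "p \<in> arc_ends N j"
  obtains i where "int N dvd i - j" "p = (Outer, i) \<or> p = (Outer, i + 1)"
proof -
  obtain i where "p = (Outer, i)" "int N dvd i - j \<or> int N dvd i - j - 1"
    using assms by (auto simp: arc_ends_def)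
  then show thesis using that[of i] that[of "i - 1"] by (auto simp: algebra_simps)
qed

text \<open>\<open>\<sigma>'\<close> is the second factor and \<open>\<sigma>\<close> the expected
  product of \<open>e_j\<close> with it. Such a product inherits the outer arc of
  \<open>e_j\<close>, whence the assumption \<open>arc\<close>.\<close>

locale e_product = old: periodic_matching N \<sigma> + new: periodic_matching N \<sigma>'
  for N \<sigma> \<sigma>' +
  fixes j :: int and k :: nat
  assumes N2: "N \<ge> 2" and arc: "\<sigma> (Outer, j) = (Outer, j + 1)"
begin

abbreviation "a \<equiv> diag_e N j"
abbreviation "b \<equiv> (\<sigma>', k)"
abbreviation "J \<equiv> arc_ends N j"

lemma arc_translates:
  assumes i: "int N dvd i - j"
  shows "\<sigma> (Outer, i) = (Outer, i + 1)" "\<sigma> (Outer, i + 1) = (Outer, i)"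
proof -
  show 1: "\<sigma> (Outer, i) = (Outer, i + 1)"
    using old.periodic[OF i, of "(Outer, j)"] arc by simp
  show "\<sigma> (Outer, i + 1) = (Outer, i)" using 1 by (metis old.invol)
qed

lemma lower: "(in_lower r, in_lower (\<sigma>' r)) \<in> connected_in a b"
  using connected_lower[of r b a] by simp

text \<open>At the ends of the inner arcs of \<open>e_j\<close> the labels are left free except for
  \<open>arcs\<close>, because they depend on what the second factor does there. Elsewhere
  \<open>e_j\<close> is straight and the outer line forces the label.\<close>

lemma label_upper:
  assumes out: "\<And>i. c (OuterLine, i) = {(Outer, i), \<sigma> (Outer, i)}"
    and inn: "\<And>i. c (InnerLine, i) = {(Inner, i), \<sigma> (Inner, i)}"
    and mid: "\<And>i. (Outer, i) \<notin> J \<Longrightarrow> c (MiddleLine, i) = {(Outer, i), \<sigma> (Outer, i)}"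
    and arcs: "\<And>i. int N dvd i - j \<Longrightarrow> c (MiddleLine, i + 1) = c (MiddleLine, i)"
  shows "c (in_upper (fst a r)) = c (in_upper r)"
proof (cases "(Outer, snd r) \<in> J")
  case True
  then show ?thesis
  proof (rule arc_ends_cases)
    fix i assume i: "int N dvd i - j" "(Outer, snd r) = (Outer, i) \<or> (Outer, snd r) = (Outer, i + 1)"
    have e: "fst a (x, i) = (x, i + 1)" "fst a (x, i + 1) = (x, i)" for x
      using i(1) N2 diag_e_simps(1)[of N i j x] diag_e_simps(2)[of N "i + 1" j x]
      by (simp_all add: algebra_simps)
    have "c (OuterLine, i + 1) = c (OuterLine, i)" unfolding out arc_translates[OF i(1)] by blast
    then show ?thesis using i(2) e arcs[OF i(1)] by (cases r; cases "fst r") auto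
  qed
next
  case False
  then show ?thesis using mid[of "snd r"] out[of "snd r"]
    by (cases r; cases "fst r") (auto simp: diag_e_simps)
qed

lemma connected_arc_ends: "r \<in> J \<Longrightarrow> (in_glued r, in_glued (\<sigma> r)) \<in> connected_in a b"
  by (erule arc_ends_cases) (use arc_translates connected_e_arc[OF N2] in auto)

lemma connected_straight:
  assumes "r \<notin> J" "\<sigma>' r \<notin> J"
  shows "(in_glued r, in_glued (\<sigma>' r)) \<in> connected_in a b"
  using connected_e_straight(1)[OF assms(1), of b] lower[of r] connected_e_straight(2)[OF assms(2), of b]
  by (meson connected_trans)

lemma label_glued:
  assumes "\<And>i. c (OuterLine, i) = {(Outer, i), \<sigma> (Outer, i)}" "\<And>i. c (InnerLine, i) = {(Inner, i), \<sigma> (Inner, i)}"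
  shows "c (in_glued r) = {r, \<sigma> r}"
  using assms by (cases r; cases "fst r") auto

end

lemma e_productI:
  "\<lbrakk>periodic_matching N \<sigma>; periodic_matching N \<sigma>'; N \<ge> 2; \<sigma> (Outer, j) = (Outer, j + 1)\<rbrakk> \<Longrightarrow>
    e_product N \<sigma> \<sigma>' j"
  by (simp add: e_product_def e_product_axioms_def)

text \<open>Left multiplication by \<open>e\<^sub>j\<close> undoes a surgery that cuts the strand joining \<open>p\<close> and \<open>q\<close> and the arc
  joining \<open>j\<close> and \<open>j + 1\<close>, and reconnects the four ends as \<open>p\<close> with \<open>j\<close> and \<open>q\<close> with \<open>j + 1\<close>.\<close>

lemma (in e_product) glue_e:
  assumes same: "\<And>r. r \<notin> J \<Longrightarrow> \<sigma>' r \<notin> J \<Longrightarrow> \<sigma>' r = \<sigma> r"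
    and p: "\<sigma>' (Outer, j) \<notin> J"
    and q: "\<sigma>' (Outer, j + 1) \<notin> J" "\<sigma>' (Outer, j + 1) = \<sigma> (\<sigma>' (Outer, j))"
  shows "glue N a b = (\<sigma>, k)"
    and "contractible_loops N a b = 0"
proof -
  \<comment> \<open>The hypotheses speak of one lift of the arc; periodicity carries them to every
    \<open>i\<close> congruent to \<open>j\<close>.\<close>
  have tr: "\<sigma>' (Outer, i) \<notin> J" "\<sigma>' (Outer, i + 1) \<notin> J" "\<sigma> (\<sigma>' (Outer, i)) = \<sigma>' (Outer, i + 1)"
    "\<sigma> (\<sigma>' (Outer, i + 1)) = \<sigma>' (Outer, i)"
    if i: "int N dvd i - j" for i
  proof -
    have eq: "(Outer, i) = translate (i - j) (Outer, j)" "(Outer, i + 1) = translate (i - j) (Outer, j + 1)"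
      by simp_all
    show "\<sigma>' (Outer, i) \<notin> J" "\<sigma>' (Outer, i + 1) \<notin> J"
      unfolding eq using i p q by (simp_all only: new.periodic arc_ends_translate not_False_eq_True)
    show 2: "\<sigma> (\<sigma>' (Outer, i)) = \<sigma>' (Outer, i + 1)"
      unfolding eq using i q by (simp only: new.periodic old.periodic)
    show "\<sigma> (\<sigma>' (Outer, i + 1)) = \<sigma>' (Outer, i)"
      unfolding 2[symmetric] by simp
  qed
  have J_partner: "\<sigma>' r \<notin> J" if "r \<in> J" for r
    using that by (rule arc_ends_cases) (use tr in auto)
  \<comment> \<open>A middle point in \<open>J\<close> lies on the strand that the surgery had cut.
    Its label is the pair of ends of that strand in \<open>\<sigma>\<close>, read off from its
    \<open>\<sigma>'\<close>-partner, which lies outside \<open>J\<close>.\<close>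
  define c where "c v = (case v of (OuterLine, i) \<Rightarrow> {(Outer, i), \<sigma> (Outer, i)}
    | (MiddleLine, i) \<Rightarrow> (if (Outer, i) \<in> J then {\<sigma>' (Outer, i), \<sigma> (\<sigma>' (Outer, i))}
                         else {(Outer, i), \<sigma> (Outer, i)})
    | (InnerLine, i) \<Rightarrow> {(Inner, i), \<sigma> (Inner, i)})" for v
  have c_lower: "c (in_lower r) = (if r \<in> J then {\<sigma>' r, \<sigma> (\<sigma>' r)} else {r, \<sigma> r})" for r
    by (cases r; cases "fst r") (auto simp: c_def)
  have conn: "(in_glued r, in_glued (\<sigma> r)) \<in> connected_in a b" for r
  proof (cases "r \<in> J")
    case True
    then show ?thesis by (rule connected_arc_ends)
  next
    case r: False
    show ?thesis
    proof (cases "\<sigma>' r \<in> J")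
      case False
      then show ?thesis using connected_straight[OF r False] same[OF r False] by simp
    next
      case True
      then obtain i where i: "int N dvd i - j" "\<sigma>' r = (Outer, i) \<or> \<sigma>' r = (Outer, i + 1)"
        by (rule arc_ends_cases)
      have start: "(in_glued r, in_lower (\<sigma>' r)) \<in> connected_in a b"
        using connected_e_straight(1)[OF r, of b] lower[of r] by (meson connected_trans)
      have stop: "(in_lower s, in_glued (\<sigma>' s)) \<in> connected_in a b" if "s \<in> J" for s
        using lower[of s] connected_e_straight(2)[OF J_partner[OF that], of b]
        by (meson connected_trans)
      \<comment> \<open>The path from \<open>r\<close> enters the middle line at one end of an inner
        arc of \<open>e_j\<close>, runs along that arc and leaves on the
        \<open>\<sigma>'\<close>-strand at its other end.\<close>
      from i(2) show ?thesis
      proof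
        assume *: "\<sigma>' r = (Outer, i)"
        then have "r = \<sigma>' (Outer, i)" by (metis new.invol)
        then have "\<sigma> r = \<sigma>' (Outer, i + 1)" using tr[OF i(1)] by simp
        moreover have "(in_glued r, (MiddleLine, i + 1)) \<in> connected_in a b"
          using start[unfolded *] connected_e_arc(3)[OF N2 i(1), of b] unfolding in_lower.simps by (meson connected_trans)
        ultimately show ?thesis using connected_trans stop[of "(Outer, i + 1)"] i(1) by simp
      next
        assume *: "\<sigma>' r = (Outer, i + 1)"
        then have "r = \<sigma>' (Outer, i + 1)" by (metis new.invol)
        then have "\<sigma> r = \<sigma>' (Outer, i)" using tr[OF i(1)] by simp
        moreover have "(in_glued r, (MiddleLine, i)) \<in> connected_in a b"
          using start[unfolded *] connected_e_arc(4)[OF N2 i(1), of b] unfolding in_lower.simps by (meson connected_trans)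
        ultimately show ?thesis using connected_trans stop[of "(Outer, i)"] i(1) by simp
      qed
    qed
  qed
  have "fst (glue N a b) = \<sigma>"
  proof (rule fst_glue_eqI[where c = c])
    show "c (in_upper (fst a r)) = c (in_upper r)" for r
    proof (rule label_upper)
      fix i assume i: "int N dvd i - j"
      then have "(Outer, i) \<in> J" "(Outer, i + 1) \<in> J" by simp_all
      then show "c (MiddleLine, i + 1) = c (MiddleLine, i)" using tr[OF i] by (auto simp: c_def simp del: arc_ends_simps)
    qed (simp_all add: c_def)
    show "c (in_lower (fst b r)) = c (in_lower r)" for r
      using J_partner[of r] J_partner[of "\<sigma>' r"] same[of r] by (auto simp: c_lower)
    show "c (in_glued r) = {r, \<sigma> r}" for r
      by (rule label_glued) (simp_all add: c_def)
  qed (use conn in auto)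
  moreover have loops: "lifted_loops a b = {}"
  proof (rule lifted_loops_empty)
    fix i
    show "\<exists>v. ((MiddleLine, i), v) \<in> connected_in a b \<and> fst v \<noteq> MiddleLine"
    proof (cases "(Outer, i) \<in> J")
      case True
      have "((MiddleLine, i), in_glued (\<sigma>' (Outer, i))) \<in> connected_in a b"
        using lower[of "(Outer, i)"] connected_e_straight(2)[OF J_partner[OF True], of b]
        unfolding in_lower.simps by (rule connected_trans)
      moreover have "fst (in_glued r) \<noteq> MiddleLine" for r by (cases r; cases "fst r") auto
      ultimately show ?thesis by blast
    next
      case False
      then show ?thesis using connected_e_straight(2)[OF False, of b] by fastforce
    qed
  qed
  ultimately show "glue N a b = (\<sigma>, k)"
    by (simp add: prod_eq_iff) (simp add: glue_def noncontractible_loops_def diag_e_simps)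
  show "contractible_loops N a b = 0" using loops by (simp add: contractible_loops_def)
qed


text \<open>Here the second factor joins \<open>j + 1\<close> to the next lift \<open>j + N\<close>
  of \<open>j\<close>. Alternating with the inner arcs of \<open>e_j\<close>, these strands form one
  unbounded line in the cover, which is one loop around the annulus; the other strands are
  unchanged.\<close>

lemma (in e_product) glue_e_loop:
  assumes arc': "\<sigma>' (Outer, j + 1) = (Outer, j + int N)"
    and same: "\<And>r. r \<notin> J \<Longrightarrow> \<sigma>' r = \<sigma> r"
  shows "glue N a b = (\<sigma>, Suc k)"
    and "contractible_loops N a b = 0"
proof -
  have tr: "\<sigma>' (Outer, i + 1) = (Outer, i + int N)" "\<sigma>' (Outer, i) = (Outer, i + 1 - int N)"
    if i: "int N dvd i - j" for i
  proof -
    show 2: "\<sigma>' (Outer, i + 1) = (Outer, i + int N)"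
      using new.periodic[OF i, of "(Outer, j + 1)"] arc' by (simp add: add.commute)
    have "\<sigma>' (Outer, i + 1) = translate (int N) (Outer, i)" using 2 by simp
    then have "(Outer, i + 1) = translate (int N) (\<sigma>' (Outer, i))"
      by (metis new.invol new.periodic dvd_refl)
    then show "\<sigma>' (Outer, i) = (Outer, i + 1 - int N)" by (cases "\<sigma>' (Outer, i)") simp
  qed
  have J_mem: "(Outer, i) \<in> J" "(Outer, i + 1) \<in> J" "(Outer, i + int N) \<in> J" "(Outer, i + 1 - int N) \<in> J"
    if "int N dvd i - j" for i
    using that arc_ends_translate[of N "int N" "(Outer, i)" j]
      arc_ends_translate[of N "- int N" "(Outer, i + 1)" j] by (simp_all del: arc_ends_translate)
  have J_partner: "\<sigma>' r \<in> J" if "r \<in> J" for r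
    using that by (rule arc_ends_cases) (use tr J_mem in \<open>auto simp del: arc_ends_simps\<close>)
  have J_partner': "\<sigma>' r \<in> J \<longleftrightarrow> r \<in> J" for r
    using J_partner[of r] J_partner[of "\<sigma>' r"] by auto
  \<comment> \<open>The empty label marks the new loop, which has no ends; every other component
    carries the two ends of a strand.\<close>
  define c where "c v = (case v of (OuterLine, i) \<Rightarrow> {(Outer, i), \<sigma> (Outer, i)}
    | (MiddleLine, i) \<Rightarrow> (if (Outer, i) \<in> J then {} else {(Outer, i), \<sigma> (Outer, i)})
    | (InnerLine, i) \<Rightarrow> {(Inner, i), \<sigma> (Inner, i)})" for v
  have c_lower: "c (in_lower r) = (if r \<in> J then {} else {r, \<sigma> r})" for r
    by (cases r; cases "fst r") (auto simp: c_def)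
  have c_upper_edge: "c (in_upper (fst a r)) = c (in_upper r)" for r
    by (rule label_upper) (use J_mem in \<open>simp_all add: c_def del: arc_ends_simps\<close>)
  have c_lower_edge: "c (in_lower (fst b r)) = c (in_lower r)" for r
    using J_partner'[of r] same[of r] by (auto simp: c_lower)
  have conn: "(in_glued r, in_glued (\<sigma> r)) \<in> connected_in a b" for r
    using connected_arc_ends[of r] connected_straight[of r] J_partner'[of r] same[of r] by (cases "r \<in> J") simp_all
  have eq: "fst (glue N a b) = \<sigma>"
  proof (rule fst_glue_eqI[where c = c])
    show "c (in_glued r) = {r, \<sigma> r}" for r
      by (rule label_glued) (simp_all add: c_def)
  qed (use c_upper_edge c_lower_edge conn in auto)
  define L where "L = {(MiddleLine, i) | i. (Outer, i) \<in> J}"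
  have step: "((MiddleLine, i), (MiddleLine, i + int N)) \<in> connected_in a b"
    "((MiddleLine, i + int N), (MiddleLine, i)) \<in> connected_in a b" if i: "int N dvd i - j" for i
  proof -
    have "((MiddleLine, i + 1), (MiddleLine, i + int N)) \<in> connected_in a b"
      "((MiddleLine, i + int N), (MiddleLine, i + 1)) \<in> connected_in a b"
      using lower[of "(Outer, i + 1)"] lower[of "(Outer, i + int N)"] tr(1)[OF i] new.invol[of "(Outer, i + 1)"]
      by simp_all
    then show "((MiddleLine, i), (MiddleLine, i + int N)) \<in> connected_in a b"
      "((MiddleLine, i + int N), (MiddleLine, i)) \<in> connected_in a b"
      using connected_e_arc(3,4)[OF N2 i, of b] by (meson connected_trans)+
  qed
  \<comment> \<open>Both directions are carried along, as \<open>connected_in\<close> is a reflexive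
    transitive closure whose symmetry is not established separately.\<close>
  have line: "((MiddleLine, j), (MiddleLine, j + int N * t)) \<in> connected_in a b \<and>
    ((MiddleLine, j + int N * t), (MiddleLine, j)) \<in> connected_in a b" for t
  proof (induction t rule: int_induct[where k = 0])
    case base
    then show ?case by (simp add: connected_refl)
  next
    case (step1 t)
    have "j + int N * (t + 1) = j + int N * t + int N" by (simp add: algebra_simps)
    then show ?case using step1(2) step[of "j + int N * t"] connected_trans by (metis add_diff_cancel_left' dvd_triv_left)
  next
    case (step2 t)
    have "j + int N * t = j + int N * (t - 1) + int N" by (simp add: algebra_simps)
    then show ?case using step2(2) step[of "j + int N * (t - 1)"] connected_trans by (metis add_diff_cancel_left' dvd_triv_left)
  qed
  have L_conn: "((MiddleLine, j), v) \<in> connected_in a b \<and> (v, (MiddleLine, j)) \<in> connected_in a b"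
    if v: "v \<in> L" for v
  proof -
    obtain l where l: "v = (MiddleLine, l)" "(Outer, l) \<in> J" using v by (auto simp: L_def)
    from l(2) obtain i where i: "int N dvd i - j" "(Outer, l) = (Outer, i) \<or> (Outer, l) = (Outer, i + 1)"
      by (rule arc_ends_cases)
    from i(1) obtain t where "i = j + int N * t" by (auto simp: dvd_def algebra_simps)
    with line[of t] have "((MiddleLine, j), (MiddleLine, i)) \<in> connected_in a b"
      "((MiddleLine, i), (MiddleLine, j)) \<in> connected_in a b" by simp_all
    then have "((MiddleLine, j), (MiddleLine, i + 1)) \<in> connected_in a b"
      "((MiddleLine, i + 1), (MiddleLine, j)) \<in> connected_in a b"
      "((MiddleLine, j), (MiddleLine, i)) \<in> connected_in a b"
      "((MiddleLine, i), (MiddleLine, j)) \<in> connected_in a b"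
      using connected_e_arc(3,4)[OF N2 i(1), of b] by (blast intro: connected_trans)+
    then show ?thesis using i(2) unfolding l(1) by blast
  qed
  have j_L: "(MiddleLine, j) \<in> L" by (simp add: L_def)
  have L_inv: "w \<in> L \<longleftrightarrow> v \<in> L" if "(v, w) \<in> connected_in a b" for v w
  proof -
    have "c v = {} \<longleftrightarrow> v \<in> L" for v
      by (cases v; cases "fst v") (auto simp: c_def L_def)
    then show ?thesis using connected_invariant[where c = c, OF c_upper_edge c_lower_edge that] by metis
  qed
  have L_class: "connected_in a b `` {v} = L" if "v \<in> L" for v
  proof (intro subset_antisym subsetI)
    fix w assume "w \<in> connected_in a b `` {v}"
    then show "w \<in> L" using L_inv that by blast
  next
    fix w assume "w \<in> L"
    then have "(v, w) \<in> connected_in a b"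
      using L_conn[OF that] L_conn[of w] by (meson connected_trans)
    then show "w \<in> connected_in a b `` {v}" by blast
  qed
  have loops: "lifted_loops a b = {L}"
  proof (intro subset_antisym subsetI)
    fix C assume "C \<in> lifted_loops a b"
    then have C: "C \<in> UNIV // connected_in a b" "C \<subseteq> {MiddleLine} \<times> UNIV"
      by (auto simp: lifted_loops_def)
    obtain v where v: "C = connected_in a b `` {v}" using C(1) by (blast elim: quotientE)
    then have "v \<in> C" using connected_refl by blast
    with C(2) obtain i where i: "v = (MiddleLine, i)" by auto
    have "(Outer, i) \<in> J"
    proof (rule ccontr)
      assume "(Outer, i) \<notin> J"
      from connected_e_straight(2)[OF this, of b] v i have "(OuterLine, i) \<in> C" by simp
      with C(2) show False by auto
    qed
    then have "v \<in> L" using i by (simp add: L_def)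
    then show "C \<in> {L}" using L_class v by simp
  next
    fix C assume "C \<in> {L}"
    then have "C = connected_in a b `` {(MiddleLine, j)}" using L_class[OF j_L] by simp
    then have "C \<in> UNIV // connected_in a b" by (simp add: quotient_def) blast
    with \<open>C \<in> {L}\<close> show "C \<in> lifted_loops a b" by (auto simp: lifted_loops_def L_def)
  qed
  \<comment> \<open>\<open>L\<close> contains all lifts of \<open>j\<close>, so it counts as
    non-contractible; being the only closed component, it raises the number of loops by exactly
    one.\<close>
  have "infinite L"
  proof
    assume "finite L"
    moreover have "range (\<lambda>t. (MiddleLine, j + int N * t)) \<subseteq> L" by (auto simp: L_def)
    ultimately have "finite (range (\<lambda>t. (MiddleLine, j + int N * t)))" by (rule finite_subset[rotated])
    moreover have "inj (\<lambda>t. (MiddleLine, j + int N * t))" using N2 by (auto simp: inj_on_def)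
    ultimately have "finite (UNIV :: int set)" by (rule finite_imageD)
    then show False by simp
  qed
  then have "{C \<in> lifted_loops a b. infinite C} = {L}" "{C \<in> lifted_loops a b. finite C} = {}"
    using loops by auto
  note parts = this
  show "contractible_loops N a b = 0" unfolding contractible_loops_def parts(2) by simp
  have "snd (glue N a b) = Suc k"
    by (simp add: glue_def noncontractible_loops_def parts(1) diag_e_simps)
  then show "glue N a b = (\<sigma>, Suc k)" using eq by (simp add: prod_eq_iff)
qed

section \<open>Non-crossing matchings\<close>

lemma boundary_less_irrefl [simp]: "\<not> p \<lless> p"
  by (cases p; cases "fst p") auto

lemma boundary_less_linear: "p \<lless> r \<or> p = r \<or> r \<lless> p"
  by (cases p; cases r; cases "fst p"; cases "fst r") auto

lemma boundary_less_Outer: "r \<lless> (Outer, i) \<longleftrightarrow> fst r = Outer \<and> snd r < i"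
  "(Outer, i) \<lless> r \<longleftrightarrow> (fst r = Outer \<longrightarrow> i < snd r)"
  by (cases r; cases "fst r"; simp)+

lemma boundary_less_Inner: "r \<lless> (Inner, i) \<longleftrightarrow> (fst r = Inner \<longrightarrow> i < snd r)"
  "(Inner, i) \<lless> r \<longleftrightarrow> fst r = Inner \<and> snd r < i"
  by (cases r; cases "fst r"; simp)+

locale affine_matching = periodic_matching +
  assumes noncrossing: "\<not> (p \<lless> r \<and> r \<lless> \<sigma> p \<and> \<sigma> p \<lless> \<sigma> r)"

lemma affdiags_iff:
  assumes "N \<ge> 1"
  shows "(\<sigma>, k) \<in> affdiags N \<longleftrightarrow> affine_matching N \<sigma> \<and> (k = 0 \<or> (\<forall>p. fst (\<sigma> p) = fst p))"
  using assms unfolding affdiags_def affine_matching_def affine_matching_axioms_def periodic_matching_def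
  by auto

section \<open>Arcs, through-lines and cuts\<close>

definition left_of :: "int \<Rightarrow> int \<Rightarrow> point \<Rightarrow> bool" where
  "left_of g h p \<longleftrightarrow> snd p \<le> (case fst p of Outer \<Rightarrow> g | Inner \<Rightarrow> h)"

lemma left_of_simps [simp]:
  "left_of g h (Outer, i) \<longleftrightarrow> i \<le> g" "left_of g h (Inner, i) \<longleftrightarrow> i \<le> h"
  by (simp_all add: left_of_def)

text \<open>A cut \<open>(g, h)\<close> runs across the strip from the gap right of \<open>(Outer, g)\<close> to the gap right of
  \<open>(Inner, h)\<close>, without meeting any strand.\<close>

definition is_cut :: "(point \<Rightarrow> point) \<Rightarrow> int \<Rightarrow> int \<Rightarrow> bool" where
  "is_cut \<sigma> g h \<longleftrightarrow> (\<forall>p. left_of g h (\<sigma> p) \<longleftrightarrow> left_of g h p)"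

context affine_matching
begin

text \<open>\<open>noncrossing\<close> forbids one order of the four points. Applied to
  \<open>p\<close> and \<open>r\<close> it bounds \<open>\<sigma> r\<close> on one side, applied to
  \<open>\<sigma> r\<close> and \<open>p\<close> on the other.\<close>

lemma inside: "p \<lless> r \<Longrightarrow> r \<lless> \<sigma> p \<Longrightarrow> p \<lless> \<sigma> r \<and> \<sigma> r \<lless> \<sigma> p"
proof -
  assume *: "p \<lless> r" "r \<lless> \<sigma> p"
  have "\<sigma> r \<noteq> p" "\<sigma> r \<noteq> \<sigma> p" using * by auto
  moreover have "\<not> \<sigma> p \<lless> \<sigma> r" using * noncrossing by blast
  moreover have "\<not> \<sigma> r \<lless> p" using * noncrossing[of "\<sigma> r" p] by simp
  ultimately show ?thesis using boundary_less_linear by metis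
qed

text \<open>The boundary order runs from right to left on the inner line, so there the arc is read
  from its right end \<open>k\<close>.\<close>

lemma arc_inside:
  assumes "\<sigma> (x, i) = (x, k)" "i < r" "r < k"
  shows "\<exists>r'. \<sigma> (x, r) = (x, r') \<and> i < r' \<and> r' < k"
proof (cases x)
  case Outer
  then show ?thesis using inside[of "(Outer, i)" "(Outer, r)"] assms
    by (cases "\<sigma> (Outer, r)") (auto simp: boundary_less_Outer)
next
  case Inner
  moreover have "\<sigma> (x, k) = (x, i)" using assms(1) invol by metis
  ultimately show ?thesis using inside[of "(Inner, k)" "(Inner, r)"] assms(2,3)
    by (cases "\<sigma> (Inner, r)") (auto simp: boundary_less_Inner)
qed

text \<open>A longer arc would contain the left end of its own translate by \<open>N\<close>, hence
  also the right end \<open>k + N\<close>, which lies beyond \<open>k\<close>. The borderline case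
  would join a point to its own translate.\<close>

lemma arc_short:
  assumes "\<sigma> (x, i) = (x, k)" "i < k"
  shows "k < i + int N"
proof (rule ccontr)
  assume *: "\<not> k < i + int N"
  have "\<sigma> (x, i + int N) = (x, k + int N)" using periodic_pair[of "int N" x i] assms(1) by simp
  moreover have "i < i + int N" using N_pos by simp
  moreover have "k \<noteq> i + int N" using partner_not_translate[of "int N" "(x, i)"] assms by auto
  ultimately show False using arc_inside[OF assms(1), of "i + int N"] * N_pos by auto
qed

text \<open>Descent on the length: inside an arc, the point next to its left end has its partner
  inside as well, and that arc is shorter.\<close>

lemma exists_small_arc:
  assumes "\<sigma> (x, i) = (x, k)"
  shows "\<exists>j. \<sigma> (x, j) = (x, j + 1)"
proof -
  have *: "\<exists>j. \<sigma> (x, j) = (x, j + 1)" if "\<sigma> (x, i) = (x, k)" "i < k" for i k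
    using that
  proof (induction "nat (k - i)" arbitrary: i k rule: less_induct)
    case less
    show ?case
    proof (cases "k = i + 1")
      case True
      then show ?thesis using less.prems by blast
    next
      case False
      then obtain r' where r': "\<sigma> (x, i + 1) = (x, r')" "i < r'" "r' < k"
        using arc_inside[OF less.prems(1), of "i + 1"] less.prems(2) by auto
      have "r' \<noteq> i + 1" using r'(1) no_fix by metis
      then show ?thesis using less.hyps[of r' "i + 1"] r' by auto
    qed
  qed
  have "i \<noteq> k" using assms no_fix by metis
  moreover have "\<sigma> (x, k) = (x, i)" using assms invol by metis
  ultimately show ?thesis using *[of i k] *[of k i] assms by (cases i k rule: linorder_cases) auto
qed

text \<open>A longest arc will do; it exists because \<open>arc_short\<close> bounds the lengths.
  Another arc passing over the gap to the right of \<open>b\<close> would either cross it or contain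
  it and be longer.\<close>

lemma exists_exposed_arc:
  assumes "\<sigma> (x, i) = (x, k)"
  shows "\<exists>a b. a < b \<and> \<sigma> (x, a) = (x, b) \<and> (\<forall>i k. \<sigma> (x, i) = (x, k) \<and> i \<le> b \<longrightarrow> k \<le> b)"
proof -
  define P where "P ab \<longleftrightarrow> fst ab < snd ab \<and> \<sigma> (x, fst ab) = (x, snd ab)" for ab
  have "i \<noteq> k" using assms no_fix by metis
  moreover have "\<sigma> (x, k) = (x, i)" using assms invol by metis
  ultimately have "P (i, k) \<or> P (k, i)" using assms by (auto simp: P_def)
  moreover have "\<forall>ab. P ab \<longrightarrow> nat (snd ab - fst ab) < N"
    using arc_short by (fastforce simp: P_def)
  ultimately obtain ab where ab: "P ab" "\<forall>cd. P cd \<longrightarrow> nat (snd cd - fst cd) \<le> nat (snd ab - fst ab)"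
    using ex_has_greatest_nat[of P _ "\<lambda>ab. nat (snd ab - fst ab)" N] by metis
  obtain a b where [simp]: "ab = (a, b)" by (cases ab)
  have arc: "a < b" "\<sigma> (x, a) = (x, b)" using ab(1) by (simp_all add: P_def)
  have "k \<le> b" if "\<sigma> (x, i) = (x, k)" "i \<le> b" for i k
  proof (rule ccontr)
    assume "\<not> k \<le> b"
    then have k: "b < k" by simp
    have rev: "\<sigma> (x, b) = (x, a)" using arc invol by metis
    have "i \<noteq> b" "i \<noteq> a" using that rev arc k by auto
    moreover have "\<not> (a < i \<and> i < b)" using arc_inside[OF arc(2), of i] that k by force
    ultimately have "i < a" using that(2) by linarith
    then have "P (i, k)" using that k arc by (simp add: P_def)
    then have "nat (k - i) \<le> nat (b - a)" using ab(2) by fastforce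
    with \<open>i < a\<close> k arc show False by linarith
  qed
  then show ?thesis using arc by blast
qed

lemma through_mono:
  assumes "\<sigma> (x, i) = (opposite x, k)" "\<sigma> (x, i') = (opposite x, k')" "i < i'"
  shows "k < k'"
proof (rule ccontr)
  assume "\<not> k < k'"
  have "k \<noteq> k'"
  proof
    assume "k = k'"
    then have "\<sigma> (x, i) = \<sigma> (x, i')" using assms by metis
    then show False using assms(3) by simp
  qed
  with \<open>\<not> k < k'\<close> have k: "k' < k" by simp
  have rev: "\<sigma> (opposite x, k) = (x, i)" "\<sigma> (opposite x, k') = (x, i')" using assms invol by metis+
  show False
  proof (cases x)
    case Outer
    then show ?thesis using noncrossing[of "(Outer, i)" "(Outer, i')"] assms k by auto
  next
    case Inner
    then show ?thesis using noncrossing[of "(Outer, k')" "(Outer, k)"] rev assms(3) k by auto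
  qed
qed

text \<open>The through-lines give a strictly increasing map with
  \<open>f (i + N) = f i + N\<close>. Its \<open>N\<close> increments over one period are at least 1
  and add up to \<open>N\<close>, so each of them equals 1.\<close>

lemma all_through_shift:
  assumes through: "\<And>i. fst (\<sigma> (x, i)) \<noteq> x"
  shows "\<exists>s. \<sigma> = fst (diag_shift s)"
proof -
  define f where "f i = snd (\<sigma> (x, i))" for i
  have opp: "y \<noteq> x \<Longrightarrow> y = opposite x" for y by (cases x; cases y) auto
  have f: "\<sigma> (x, i) = (opposite x, f i)" for i
    using through[of i] opp by (cases "\<sigma> (x, i)") (auto simp: f_def)
  have mono: "f i + 1 \<le> f (i + 1)" for i
    using through_mono[OF f f, of i "i + 1"] by simp
  have steps: "f i + int n \<le> f (i + int n)" for i n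
  proof (induction n)
    case (Suc n)
    then show ?case using mono[of "i + int n"] by (simp add: algebra_simps)
  qed simp
  have per: "f (i + int N) = f i + int N" for i
    using periodic_pair[of "int N" x i] by (simp add: f_def)
  have succ: "f (i + 1) = f i + 1" for i
  proof -
    have "f (i + 1) + int (N - 1) \<le> f (i + 1 + int (N - 1))" by (rule steps)
    then have "f (i + 1) + int N - 1 \<le> f i + int N" using per[of i] N_pos by (simp add: of_nat_diff)
    then show ?thesis using mono[of i] by linarith
  qed
  have f_eq: "f i = f 0 + i" for i
  proof (induction i rule: int_induct[where k = 0])
    case (step1 i)
    then show ?case using succ[of i] by simp
  next
    case (step2 i)
    then show ?case using succ[of "i - 1"] by simp
  qed simp
  have 1: "\<sigma> (x, i) = (opposite x, i + f 0)" for i using f[of i] f_eq[of i] by simp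
  have 2: "\<sigma> (opposite x, i) = (x, i - f 0)" for i
    using 1[of "i - f 0"] invol[of "(x, i - f 0)"] by simp
  define s where "s = (case x of Outer \<Rightarrow> - f 0 | Inner \<Rightarrow> f 0)"
  have "\<sigma> (y, i) = fst (diag_shift s) (y, i)" for y i
    using 1[of i] 2[of i] by (cases x; cases y) (simp_all add: s_def)
  then have "\<sigma> = fst (diag_shift s)" by auto
  then show ?thesis ..
qed

text \<open>The cut follows the through-line from \<open>i0\<close> to \<open>k0\<close> on its left
  side and turns, near the inner line, to the gap at \<open>h\<close>. On the way it passes only
  points of inner arcs (\<open>first\<close>), and no inner arc reaches over the gap
  (\<open>gap\<close>).\<close>

lemma cut_of_through:
  assumes "\<sigma> (Outer, i0) = (Inner, k0)" and "h < k0"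
    and gap: "\<And>i k. \<sigma> (Inner, i) = (Inner, k) \<Longrightarrow> i \<le> h \<Longrightarrow> k \<le> h"
    and first: "\<And>k. h < k \<Longrightarrow> k < k0 \<Longrightarrow> fst (\<sigma> (Inner, k)) = Inner"
  shows "is_cut \<sigma> (i0 - 1) h"
proof -
  have rev: "\<sigma> (Inner, k0) = (Outer, i0)" using assms(1) invol by metis
  have "left_of (i0 - 1) h (\<sigma> p)" if left: "left_of (i0 - 1) h p" for p
  proof (cases p)
    case (Pair x i)
    show ?thesis
    proof (cases x)
      case Outer
      then have i: "i < i0" using left Pair by simp
      obtain y k where yk: "\<sigma> p = (y, k)" by (cases "\<sigma> p")
      show ?thesis
      proof (cases y)
        case y: Outer
        have "\<not> i0 < k"
        proof
          assume "i0 < k"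
          then have "(Outer, i0) \<lless> (Outer, k) \<and> (Outer, k) \<lless> \<sigma> (Outer, i0)" using assms(1) by simp
          from inside[OF conjunct1[OF this] conjunct2[OF this]] show False
            using yk y Pair Outer i invol[of p] by simp
        qed
        moreover have "k \<noteq> i0" using yk y Pair Outer assms(1) invol[of p] by auto
        ultimately show ?thesis using yk y by simp
      next
        case y: Inner
        have "k < k0" using through_mono[of Outer i k i0 k0] yk y Pair Outer i assms(1) by simp
        moreover have "\<not> h < k" using first[of k] \<open>k < k0\<close> yk y Pair Outer invol[of p] by auto
        ultimately show ?thesis using yk y by simp
      qed
    next
      case Inner
      then have i: "i \<le> h" using left Pair by simp
      obtain y k where yk: "\<sigma> p = (y, k)" by (cases "\<sigma> p")
      show ?thesis
      proof (cases y)
        case y: Outer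
        then show ?thesis using through_mono[of Inner i k k0 i0] yk Pair Inner i rev assms(2) by simp
      next
        case y: Inner
        then show ?thesis using gap[of i k] yk Pair Inner i by simp
      qed
    qed
  qed
  then show ?thesis unfolding is_cut_def using invol by metis
qed

end

lemma is_cut_step: "is_cut \<sigma> g h \<Longrightarrow> \<sigma> (Outer, j) = (Outer, j + 1) \<Longrightarrow> j \<noteq> g"
  unfolding is_cut_def by (metis left_of_simps(1) linorder_not_le order_refl zless_add1_eq)

context affine_matching
begin

text \<open>The inner gap is the one to the right of an exposed arc. The first through-line after
  that gap determines the outer gap; if there are no through-lines, the two boundaries are cut
  independently, each next to an exposed arc.\<close>

lemma exists_cut:
  assumes "\<sigma> (Inner, i) = (Inner, k)"
  shows "\<exists>l g h. l < h \<and> \<sigma> (Inner, l) = (Inner, h) \<and> is_cut \<sigma> g h"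
proof -
  obtain l h where lh: "l < h" "\<sigma> (Inner, l) = (Inner, h)"
    and gap: "\<And>i k. \<sigma> (Inner, i) = (Inner, k) \<Longrightarrow> i \<le> h \<Longrightarrow> k \<le> h"
    using exists_exposed_arc[OF assms] by blast
  show ?thesis
  proof (cases "\<exists>k. fst (\<sigma> (Inner, k)) = Outer")
    case True
    then obtain k where k: "fst (\<sigma> (Inner, k)) = Outer" ..
    \<comment> \<open>Large enough that the through-line, translated by \<open>int N * t\<close>,
      lies to the right of \<open>h\<close>.\<close>
    define t where "t = \<bar>h - k\<bar> + 1"
    have "h < k + int N * t"
    proof -
      have "t \<le> int N * t" using N_pos by (simp add: t_def)
      then show ?thesis unfolding t_def by linarith
    qed
    moreover have "fst (\<sigma> (Inner, k + int N * t)) = Outer" using k periodic_pair[of "int N * t" Inner k] by simp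
    ultimately have ex: "\<exists>n. fst (\<sigma> (Inner, h + 1 + int n)) = Outer"
      by (intro exI[of _ "nat (k + int N * t - h - 1)"]) simp
    define n where "n = (LEAST n. fst (\<sigma> (Inner, h + 1 + int n)) = Outer)"
    define k0 where "k0 = h + 1 + int n"
    have k0: "fst (\<sigma> (Inner, k0)) = Outer" using LeastI_ex[OF ex] by (simp add: n_def k0_def)
    have first: "fst (\<sigma> (Inner, k)) = Inner" if "h < k" "k < k0" for k
    proof -
      have "nat (k - h - 1) < n" using that by (simp add: k0_def) 
      from not_less_Least[OF this[unfolded n_def]] have "fst (\<sigma> (Inner, h + 1 + int (nat (k - h - 1)))) \<noteq> Outer" .
      then have "fst (\<sigma> (Inner, k)) \<noteq> Outer" using that by simp
      then show ?thesis by (cases "fst (\<sigma> (Inner, k))") auto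
    qed
    obtain i0 where "\<sigma> (Inner, k0) = (Outer, i0)" using k0 by (cases "\<sigma> (Inner, k0)") auto
    then have "\<sigma> (Outer, i0) = (Inner, k0)" using invol by metis
    then have "is_cut \<sigma> (i0 - 1) h"
      using first gap by (intro cut_of_through) (auto simp: k0_def)
    then show ?thesis using lh by blast
  next
    case False
    have side: "fst (\<sigma> p) = fst p" for p
    proof (cases p)
      case (Pair x i)
      have "fst (\<sigma> (Inner, i)) = Inner" for i using False by (cases "fst (\<sigma> (Inner, i))") auto
      moreover have "fst (\<sigma> (Outer, i)) = Outer" for i
      proof (rule ccontr)
        assume "fst (\<sigma> (Outer, i)) \<noteq> Outer"
        then obtain k where "\<sigma> (Outer, i) = (Inner, k)" by (cases "\<sigma> (Outer, i)"; cases "fst (\<sigma> (Outer, i))") auto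
        then have "\<sigma> (Inner, k) = (Outer, i)" using invol by metis
        then show False using False by (metis fst_conv)
      qed
      ultimately show ?thesis using Pair by (cases x) auto
    qed
    obtain c where "\<sigma> (Outer, 0) = (Outer, c)" using side[of "(Outer, 0)"] by (cases "\<sigma> (Outer, 0)") auto
    then obtain a g where gap': "\<And>i k. \<sigma> (Outer, i) = (Outer, k) \<Longrightarrow> i \<le> g \<Longrightarrow> k \<le> g"
      using exists_exposed_arc by blast
    have "left_of g h (\<sigma> p)" if "left_of g h p" for p
    proof (cases p)
      case (Pair x i)
      obtain k where k: "\<sigma> p = (x, k)" using side[of p] Pair by (cases "\<sigma> p") auto
      then show ?thesis using that gap gap' Pair by (cases x) auto
    qed
    then have "is_cut \<sigma> g h" unfolding is_cut_def using invol by metis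
    then show ?thesis using lh by blast
  qed
qed

text \<open>One of the translates of a small arc starts in the window from \<open>g - N + 1\<close>
  to \<open>g\<close>. It cannot start at \<open>g\<close> itself, since the cut would separate its
  two ends.\<close>

lemma small_arc_below_cut:
  assumes "is_cut \<sigma> g h" "\<sigma> (Outer, i) = (Outer, k)"
  shows "\<exists>j. \<sigma> (Outer, j) = (Outer, j + 1) \<and> g - int N < j \<and> j + 1 \<le> g"
proof -
  obtain j where j: "\<sigma> (Outer, j) = (Outer, j + 1)" using exists_small_arc[OF assms(2)] ..
  define j' where "j' = g - (g - j) mod int N"
  have "int N dvd j' - j"
    unfolding j'_def by (metis diff_diff_eq2 diff_right_commute dvd_minus_mod)
  then have "\<sigma> (Outer, j') = (Outer, j' + 1)"
    using periodic_pair[of "j' - j" Outer j] j by simp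
  moreover have "j' \<le> g" "g - int N < j'" using N_pos by (simp_all add: j'_def)
  moreover have "j' \<noteq> g" using is_cut_step assms(1) \<open>\<sigma> (Outer, j') = (Outer, j' + 1)\<close> by blast
  ultimately show ?thesis by auto
qed

end

section \<open>Generation by the translations and the \<open>e\<^sub>j\<close>\<close>

text \<open>Restricted to left multiplication by one generator at a time without contractible loops:
  along such a chain no power of \<open>m\<close> appears, so the product in the algebra stays a
  basis vector.\<close>

inductive_set generated :: "nat \<Rightarrow> affdiag set" for N where
  one: "diag_one \<in> generated N"
| shift: "d \<in> generated N \<Longrightarrow> s = 1 \<or> s = - 1 \<Longrightarrow> contractible_loops N (diag_shift s) d = 0 \<Longrightarrow>
      glue N (diag_shift s) d \<in> generated N"
| e: "d \<in> generated N \<Longrightarrow> N \<ge> 2 \<Longrightarrow> contractible_loops N (diag_e N j) d = 0 \<Longrightarrow>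
      glue N (diag_e N j) d \<in> generated N"

lemma diag_shift_mult: "glue N (diag_shift s) (diag_shift t) = diag_shift (s + t)"
  and contractible_loops_shift: "contractible_loops N (diag_shift s) (diag_shift t) = 0"
proof -
  have inv: "fst (diag_shift t) (fst (diag_shift t) p) = p" "fst (diag_shift t) p \<noteq> p" for p
    by (cases p; cases "fst p"; simp)+
  have d: "diag_shift t = (fst (diag_shift t), 0)" by (simp add: prod_eq_iff)
  have eq: "rotate_outer s (fst (diag_shift t) (rotate_outer (- s) p)) = fst (diag_shift (s + t)) p" for p
    by (cases p; cases "fst p") (simp_all add: algebra_simps)
  show "glue N (diag_shift s) (diag_shift t) = diag_shift (s + t)"
    by (subst d, subst glue_shift(1)[OF inv]) (simp add: eq prod_eq_iff fun_eq_iff)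
  show "contractible_loops N (diag_shift s) (diag_shift t) = 0"
    by (subst d) (rule glue_shift(2)[OF inv])
qed

lemma diag_shift_generated: "diag_shift s \<in> generated N"
proof (induction s rule: int_induct[where k = 0])
  case base
  then show ?case by (simp add: diag_shift_0 generated.one)
next
  case (step1 s)
  then show ?case using generated.shift[OF step1(2), of 1] by (simp add: diag_shift_mult contractible_loops_shift add.commute)
next
  case (step2 s)
  then show ?case using generated.shift[OF step2(2), of "- 1"] by (simp add: diag_shift_mult contractible_loops_shift)
qed

text \<open>Conjugation by \<open>push N j\<close> moves a small arc \<open>(j, j + 1)\<close> past the strand at \<open>j + 2\<close>.\<close>

definition push :: "nat \<Rightarrow> int \<Rightarrow> point \<Rightarrow> point" where
  "push N j p = (case fst p of Outer \<Rightarrow>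
       (if int N dvd snd p - j then translate 2 p
        else if int N dvd snd p - (j + 1) \<or> int N dvd snd p - (j + 2) then translate (- 1) p else p)
     | Inner \<Rightarrow> p)"

definition pull :: "nat \<Rightarrow> int \<Rightarrow> point \<Rightarrow> point" where
  "pull N j p = (case fst p of Outer \<Rightarrow>
       (if int N dvd snd p - (j + 2) then translate (- 2) p
        else if int N dvd snd p - j \<or> int N dvd snd p - (j + 1) then translate 1 p else p)
     | Inner \<Rightarrow> p)"

lemma dvd_exclusive:
  assumes "int N dvd i - a" "int N dvd i - b"
  shows "int N dvd b - a"
  using dvd_diff[OF assms] by simp

lemma push_pull_aux:
  assumes "N \<ge> 3"
  shows "\<not> (int N dvd i - j \<and> int N dvd i - (j + 1))" "\<not> (int N dvd i - (j + 1) \<and> int N dvd i - (j + 2))"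
    "\<not> (int N dvd i - j \<and> int N dvd i - (j + 2))"
proof -
  have *: "\<not> int N dvd 1" "\<not> int N dvd 2" using assms zdvd_imp_le[of "int N" 1] zdvd_imp_le[of "int N" 2] by auto
  show "\<not> (int N dvd i - j \<and> int N dvd i - (j + 1))" "\<not> (int N dvd i - (j + 1) \<and> int N dvd i - (j + 2))"
    "\<not> (int N dvd i - j \<and> int N dvd i - (j + 2))"
    using dvd_exclusive[of N i j "j + 1"] dvd_exclusive[of N i "j + 1" "j + 2"] dvd_exclusive[of N i j "j + 2"] *
    by auto
qed

lemma push_simps:
  assumes "N \<ge> 3"
  shows "int N dvd i - j \<Longrightarrow> push N j (Outer, i) = (Outer, i + 2)"
    "int N dvd i - (j + 1) \<Longrightarrow> push N j (Outer, i) = (Outer, i - 1)"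
    "int N dvd i - (j + 2) \<Longrightarrow> push N j (Outer, i) = (Outer, i - 1)"
    "\<not> int N dvd i - j \<Longrightarrow> \<not> int N dvd i - (j + 1) \<Longrightarrow> \<not> int N dvd i - (j + 2) \<Longrightarrow>
       push N j (Outer, i) = (Outer, i)"
    "push N j (Inner, i) = (Inner, i)" "fst (push N j p) = fst p"
  using push_pull_aux[OF assms, of i j] by (auto simp: push_def split: side.splits)

lemma pull_simps:
  assumes "N \<ge> 3"
  shows "int N dvd i - j \<Longrightarrow> pull N j (Outer, i) = (Outer, i + 1)"
    "int N dvd i - (j + 1) \<Longrightarrow> pull N j (Outer, i) = (Outer, i + 1)"
    "int N dvd i - (j + 2) \<Longrightarrow> pull N j (Outer, i) = (Outer, i - 2)"
    "\<not> int N dvd i - j \<Longrightarrow> \<not> int N dvd i - (j + 1) \<Longrightarrow> \<not> int N dvd i - (j + 2) \<Longrightarrow>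
       pull N j (Outer, i) = (Outer, i)"
    "pull N j (Inner, i) = (Inner, i)" "fst (pull N j p) = fst p"
  using push_pull_aux[OF assms, of i j] by (auto simp: pull_def split: side.splits)

lemma point_mod_cases:
  obtains (Inner) i where "p = (Inner, i)"
  | (0) i where "p = (Outer, i)" "int N dvd i - j"
  | (1) i where "p = (Outer, i)" "int N dvd i - (j + 1)"
  | (2) i where "p = (Outer, i)" "int N dvd i - (j + 2)"
  | (other) i where "p = (Outer, i)" "\<not> int N dvd i - j" "\<not> int N dvd i - (j + 1)" "\<not> int N dvd i - (j + 2)"
proof (cases p)
  case (Pair x i)
  then show thesis using that(1,2)[of i] that(3,4)[of i] that(5)[of i] by (cases x) blast+
qed

lemma pull_push [simp]: "N \<ge> 3 \<Longrightarrow> pull N j (push N j p) = p"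
  by (rule point_mod_cases[where p = p and N = N and j = j]) (simp_all add: push_simps pull_simps algebra_simps)

lemma push_pull [simp]: "N \<ge> 3 \<Longrightarrow> push N j (pull N j p) = p"
  by (rule point_mod_cases[where p = p and N = N and j = j]) (simp_all add: push_simps pull_simps algebra_simps)

lemma push_translate:
  assumes "int N dvd t" shows "push N j (translate t p) = translate t (push N j p)"
    and "pull N j (translate t p) = translate t (pull N j p)"
proof -
  have "int N dvd i + t - k \<longleftrightarrow> int N dvd i - k" for i k
    using dvd_add_left_iff[OF assms, of "i - k"] by (simp add: algebra_simps)
  note dvd = this[of "snd p"]
  show "push N j (translate t p) = translate t (push N j p)" "pull N j (translate t p) = translate t (pull N j p)"
    unfolding push_def pull_def translate_simps(2,3) dvd
    by (simp_all add: algebra_simps split: side.splits)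
qed

text \<open>Away from the lifts of \<open>j + 1\<close> and \<open>j + 2\<close>,
  \<open>push\<close> moves only the lifts of \<open>j\<close>, by 2, and the points that these jump
  over are exactly the excluded ones.\<close>

lemma push_mono:
  assumes N: "N \<ge> 3" and "p \<notin> arc_ends N (j + 1)" "r \<notin> arc_ends N (j + 1)" and less: "p \<lless> r"
  shows "push N j p \<lless> push N j r"
proof -
  have *: "push N j (Outer, i) = (Outer, if int N dvd i - j then i + 2 else i)"
    if "(Outer, i) \<notin> arc_ends N (j + 1)" for i
    using that push_simps(1,4)[OF N, of i j] by (auto simp: algebra_simps)
  have gap: "\<not> (k = i + 1 \<or> k = i + 2)" if "int N dvd i - j" "(Outer, k) \<notin> arc_ends N (j + 1)" for i k
    using that by (auto simp: algebra_simps)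
  obtain x i y k where pr: "p = (x, i)" "r = (y, k)" by (cases p; cases r)
  show ?thesis
  proof (cases x; cases y)
    assume "x = Outer" "y = Outer"
    then show ?thesis using assms(2,3) less * gap[of i k] unfolding pr by auto
  qed (use less pr push_simps(5,6)[OF N] in \<open>simp_all add: boundary_less_Outer boundary_less_Inner\<close>)
qed

context periodic_matching
begin

lemma arc_periodic:
  assumes arc: "\<sigma> (Outer, j) = (Outer, j + 1)" and "int N dvd i - j"
  shows "\<sigma> (Outer, i) = (Outer, i + 1) \<and> \<sigma> (Outer, i + 1) = (Outer, i)"
proof -
  have "\<sigma> (Outer, i) = (Outer, i + 1)"
    using periodic[OF assms(2), of "(Outer, j)"] arc by simp
  then show ?thesis using invol by metis
qed

lemma arc_ends_invariant:
  assumes arc: "\<sigma> (Outer, j) = (Outer, j + 1)"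
  shows "\<sigma> p \<in> arc_ends N j \<longleftrightarrow> p \<in> arc_ends N j"
proof -
  have *: "\<sigma> p \<in> arc_ends N j" if "p \<in> arc_ends N j" for p
    using that
  proof (rule arc_ends_cases)
    fix i assume i: "int N dvd i - j" "p = (Outer, i) \<or> p = (Outer, i + 1)"
    then have "(Outer, i) \<in> arc_ends N j" "(Outer, i + 1) \<in> arc_ends N j" by simp_all
    then show ?thesis using arc_periodic[OF arc i(1)] i(2) by (auto simp del: arc_ends_simps)
  qed
  from *[of p] *[of "\<sigma> p"] show ?thesis by auto
qed

end

text \<open>On diagrams this is the relation \<open>e_j e_{j+1} e_j = e_j\<close>:
  \<open>\<sigma>'\<close> is what left multiplication by \<open>e_{j+1}\<close> makes of
  \<open>\<sigma>\<close>, with the arc one place further right, and \<open>e_j\<close> leads back.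
  In terms of surgery, the strand that is cut is the one at \<open>j + 2\<close>.\<close>

lemma (in affine_matching) push_arc:
  assumes N: "N \<ge> 3" and arc: "\<sigma> (Outer, j) = (Outer, j + 1)"
  defines "\<sigma>' \<equiv> \<lambda>p. pull N j (\<sigma> (push N j p))"
  shows "affine_matching N \<sigma>'"
    and "\<sigma>' (Outer, j + 1) = (Outer, j + 2)"
    and "glue N (diag_e N j) (\<sigma>', k) = (\<sigma>, k)"
    and "contractible_loops N (diag_e N j) (\<sigma>', k) = 0"
proof -
  let ?J = "arc_ends N (j + 1)"
  have plus2: "j + 2 = j + 1 + 1" by simp
  show P: "\<sigma>' (Outer, j + 1) = (Outer, j + 2)"
    using N arc by (simp add: \<sigma>'_def push_simps pull_simps)
  have per': "\<sigma>' (translate t p) = translate t (\<sigma>' p)" if "int N dvd t" for t p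
    using that by (simp add: \<sigma>'_def push_translate periodic)
  have inv': "\<sigma>' (\<sigma>' p) = p" for p using N by (simp add: \<sigma>'_def)
  have nf': "\<sigma>' p \<noteq> p" for p
  proof
    assume "\<sigma>' p = p"
    then have "push N j (\<sigma>' p) = push N j p" by simp
    then show False using N by (simp add: \<sigma>'_def)
  qed
  interpret P': periodic_matching N \<sigma>'
  proof unfold_locales
    show "\<sigma>' (x, i + int N) = (fst (\<sigma>' (x, i)), snd (\<sigma>' (x, i)) + int N)" for x i
      using per'[of "int N" "(x, i)"] by (simp add: translate_def)
  qed (use N_pos inv' nf' in auto)
  note J = P'.arc_periodic[OF P[unfolded plus2]]
  note J_inv = P'.arc_ends_invariant[OF P[unfolded plus2]]
  have "\<not> (a \<lless> b \<and> b \<lless> \<sigma>' a \<and> \<sigma>' a \<lless> \<sigma>' b)" for a b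
  proof
    assume *: "a \<lless> b \<and> b \<lless> \<sigma>' a \<and> \<sigma>' a \<lless> \<sigma>' b"
    have "a \<notin> ?J"
    proof
      assume "a \<in> ?J"
      then obtain i where "int N dvd i - (j + 1)" "a = (Outer, i) \<or> a = (Outer, i + 1)" by (rule arc_ends_cases)
      then show False using * J[of i] by (auto simp: boundary_less_Outer)
    qed
    moreover have "b \<notin> ?J"
    proof
      assume "b \<in> ?J"
      then obtain i where "int N dvd i - (j + 1)" "b = (Outer, i) \<or> b = (Outer, i + 1)" by (rule arc_ends_cases)
      then show False using * J[of i] by (auto simp: boundary_less_Outer)
    qed
    \<comment> \<open>None of the four points lies on the small arc, so \<open>push\<close>
      preserves their order and carries the crossing back to \<open>\<sigma>\<close>.\<close>
    ultimately have "push N j a \<lless> push N j b \<and> push N j b \<lless> push N j (\<sigma>' a) \<and> push N j (\<sigma>' a) \<lless> push N j (\<sigma>' b)"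
      using * push_mono[OF N] J_inv by blast
    then show False using noncrossing N by (simp add: \<sigma>'_def)
  qed
  then show "affine_matching N \<sigma>'" by unfold_locales
  note J0 = arc_ends_invariant[OF arc]
  have partner: "\<sigma>' r = \<sigma> r \<and> \<sigma> r \<notin> arc_ends N j" if r: "r \<notin> arc_ends N j" "\<sigma>' r \<notin> arc_ends N j" for r
  proof -
    have nJ: "\<sigma> r \<notin> arc_ends N j" using r(1) J0 by blast
    have "\<not> (fst r = Outer \<and> int N dvd snd r - (j + 2))"
    proof
      assume *: "fst r = Outer \<and> int N dvd snd r - (j + 2)"
      then have "\<sigma>' r = (Outer, snd r - 1)"
        using J[of "snd r - 1"] by (cases r) (simp add: algebra_simps)
      then show False using r(2) * by (simp add: algebra_simps)
    qed
    then have push: "push N j r = r"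
      using r(1) by (cases r; cases "fst r") (auto simp: push_simps N algebra_simps)
    have "pull N j (\<sigma> r) = \<sigma> r"
    proof (cases "fst (\<sigma> r) = Outer \<and> int N dvd snd (\<sigma> r) - (j + 2)")
      case True
      then have "\<sigma>' r = (Outer, snd (\<sigma> r) - 2)"
        using push N by (cases "\<sigma> r") (simp add: \<sigma>'_def pull_simps)
      then show ?thesis using r(2) True by (simp add: algebra_simps)
    next
      case False
      then show ?thesis
        using nJ by (cases "\<sigma> r"; cases "fst (\<sigma> r)") (auto simp: pull_simps N algebra_simps)
    qed
    then show ?thesis using nJ push by (simp add: \<sigma>'_def)
  qed
  have far: "\<sigma> (Outer, j + 2) \<notin> arc_ends N j" "\<sigma>' (Outer, j) = \<sigma> (Outer, j + 2)"
  proof -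
    have j2: "(Outer, j + 2) \<notin> arc_ends N j" using push_pull_aux[OF N, of "j + 2" j] by (simp add: algebra_simps)
    show 1: "\<sigma> (Outer, j + 2) \<notin> arc_ends N j" using j2 J0 by blast
    have "\<not> (fst (\<sigma> (Outer, j + 2)) = Outer \<and> int N dvd snd (\<sigma> (Outer, j + 2)) - (j + 2))"
    proof
      assume *: "fst (\<sigma> (Outer, j + 2)) = Outer \<and> int N dvd snd (\<sigma> (Outer, j + 2)) - (j + 2)"
      then have "\<sigma> (Outer, j + 2) = translate (snd (\<sigma> (Outer, j + 2)) - (j + 2)) (Outer, j + 2)"
        by (cases "\<sigma> (Outer, j + 2)") simp
      then show False using * partner_not_translate by blast
    qed
    then have "pull N j (\<sigma> (Outer, j + 2)) = \<sigma> (Outer, j + 2)"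
      using 1 by (cases "\<sigma> (Outer, j + 2)"; cases "fst (\<sigma> (Outer, j + 2))") (auto simp: pull_simps N algebra_simps)
    then show "\<sigma>' (Outer, j) = \<sigma> (Outer, j + 2)" using N by (simp add: \<sigma>'_def push_simps)
  qed
  have "(Outer, j + 2) \<notin> arc_ends N j" using push_pull_aux[OF N, of "j + 2" j] by (simp add: algebra_simps)
  then show "glue N (diag_e N j) (\<sigma>', k) = (\<sigma>, k)" "contractible_loops N (diag_e N j) (\<sigma>', k) = 0"
    using e_product.glue_e[OF e_productI[OF periodic_matching_axioms P'.periodic_matching_axioms _ arc]] partner far P N by simp_all
qed

text \<open>\<open>push\<close> permutes each triple of lifts of \<open>j\<close>,
  \<open>j + 1\<close>, \<open>j + 2\<close>. The window bounds place the original triple left of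
  the gap at \<open>g\<close> and the next one, starting at \<open>j + N\<close>, right of it, so no
  triple is separated.\<close>

lemma push_left_of:
  assumes N: "N \<ge> 3" and j: "g - int N < j" "j + 2 \<le> g"
  shows "left_of g h (push N j p) \<longleftrightarrow> left_of g h p"
proof (rule point_mod_cases[where p = p and N = N and j = j])
  have aux: "i \<le> g \<longleftrightarrow> i' \<le> g"
    if i: "int N dvd i - j - u" "i' - i = u' - u" "0 \<le> u" "u \<le> 2" "0 \<le> u'" "u' \<le> 2" for i i' u u' :: int
  proof -
    obtain t where t: "i = j + u + int N * t" using i(1) by (auto simp: dvd_def algebra_simps)
    show ?thesis
    proof (cases "t \<le> 0")
      case True
      then have "int N * t \<le> 0" using N by (simp add: mult_nonneg_nonpos)
      then show ?thesis using t i j by linarith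
    next
      case False
      then have "int N * 1 \<le> int N * t" using N by (intro mult_left_mono) auto
      then show ?thesis using t i j by linarith
    qed
  qed
  show ?thesis if "p = (Outer, i)" "int N dvd i - j" for i
    using that aux[of i 0 "i + 2" 2] N by (simp add: push_simps)
  show ?thesis if "p = (Outer, i)" "int N dvd i - (j + 1)" for i
    using that aux[of i 1 "i - 1" 0] N by (simp add: push_simps algebra_simps)
  show ?thesis if "p = (Outer, i)" "int N dvd i - (j + 2)" for i
    using that aux[of i 2 "i - 1" 1] N by (simp add: push_simps algebra_simps)
qed (simp_all add: push_simps N)

text \<open>Since \<open>push\<close> fixes the inner points, inner arcs survive and the inner count
  that drives the later induction is unchanged. The number \<open>k\<close> of loops is arbitrary
  because the same move serves with and without non-contractible loops.\<close>

lemma push_arc_to_cut: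
  assumes "affine_matching N \<sigma>" "is_cut \<sigma> g h" "\<sigma> (Outer, j) = (Outer, j + 1)" "g - int N < j" "j + 1 \<le> g"
  shows "\<exists>\<sigma>'. affine_matching N \<sigma>' \<and> is_cut \<sigma>' g h \<and> \<sigma>' (Outer, g - 1) = (Outer, g) \<and>
    (\<forall>i. fst (\<sigma>' (Inner, i)) = fst (\<sigma> (Inner, i))) \<and>
    (\<forall>i k. \<sigma> (Inner, i) = (Inner, k) \<longrightarrow> \<sigma>' (Inner, i) = (Inner, k)) \<and>
    ((\<forall>p. fst (\<sigma> p) = fst p) \<longrightarrow> (\<forall>p. fst (\<sigma>' p) = fst p)) \<and>
    (\<forall>k. (\<sigma>', k) \<in> generated N \<longrightarrow> (\<sigma>, k) \<in> generated N)"
  using assms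
proof (induction "nat (g - 1 - j)" arbitrary: j \<sigma>)
  case 0
  then have "j = g - 1" by simp
  then show ?case using 0 by auto
next
  case (Suc n)
  then interpret affine_matching N \<sigma> by simp
  \<comment> \<open>The window of length \<open>N\<close> ending at \<open>g\<close> contains
    \<open>j\<close>, \<open>j + 1\<close> and \<open>j + 2\<close>, whence
    \<open>N \<ge> 3\<close>, as \<open>push\<close> requires.\<close>
  have j: "j + 2 \<le> g" "N \<ge> 3" using Suc.hyps(2) Suc.prems by linarith+
  define \<tau> where "\<tau> = (\<lambda>p. pull N j (\<sigma> (push N j p)))"
  note \<tau> = push_arc[OF j(2) Suc.prems(3), folded \<tau>_def]
  have \<tau>2: "\<tau> (Outer, j + 1) = (Outer, j + 1 + 1)" using \<tau>(2) by (simp add: \<tau>_def)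
  have left: "left_of g h (push N j p) \<longleftrightarrow> left_of g h p" for p
    using push_left_of j Suc.prems(4) by blast
  have cut: "is_cut \<tau> g h"
    unfolding is_cut_def
  proof
    fix p
    have "left_of g h (\<tau> p) \<longleftrightarrow> left_of g h (push N j (\<tau> p))" using left by simp
    also have "push N j (\<tau> p) = \<sigma> (push N j p)" using j(2) by (simp add: \<tau>_def)
    also have "left_of g h (\<sigma> (push N j p)) \<longleftrightarrow> left_of g h p" using Suc.prems(2) left unfolding is_cut_def by metis
    finally show "left_of g h (\<tau> p) \<longleftrightarrow> left_of g h p" .
  qed
  obtain \<sigma>' where \<sigma>': "affine_matching N \<sigma>'" "is_cut \<sigma>' g h" "\<sigma>' (Outer, g - 1) = (Outer, g)"
    "\<And>i. fst (\<sigma>' (Inner, i)) = fst (\<tau> (Inner, i))"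
    "\<And>i k. \<tau> (Inner, i) = (Inner, k) \<Longrightarrow> \<sigma>' (Inner, i) = (Inner, k)"
    "(\<forall>p. fst (\<tau> p) = fst p) \<Longrightarrow> (\<forall>p. fst (\<sigma>' p) = fst p)"
    "\<And>k. (\<sigma>', k) \<in> generated N \<Longrightarrow> (\<tau>, k) \<in> generated N"
  proof -
    have "n = nat (g - 1 - (j + 1))" "g - int N < j + 1" "j + 1 + 1 \<le> g"
      using Suc.hyps(2) Suc.prems(4) j by linarith+
    from Suc.hyps(1)[OF this(1) \<tau>(1) cut \<tau>2 this(2,3)] show thesis using that by blast
  qed
  have fst_\<tau>: "fst (\<tau> p) = fst (\<sigma> (push N j p))" for p using j(2) by (simp add: \<tau>_def pull_simps)
  have inner: "\<tau> (Inner, i) = (Inner, k)" if "\<sigma> (Inner, i) = (Inner, k)" for i k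
    using that j(2) by (simp add: \<tau>_def pull_simps push_simps)
  have gen: "(\<sigma>, k) \<in> generated N" if "(\<tau>, k) \<in> generated N" for k
    using generated.e[OF that, of j] \<tau>(3,4)[of k] j(2) by simp
  show ?case
  proof (intro exI[of _ \<sigma>'] conjI allI impI)
    show "fst (\<sigma>' (Inner, i)) = fst (\<sigma> (Inner, i))" for i
      using \<sigma>'(4)[of i] fst_\<tau>[of "(Inner, i)"] j(2) by (simp add: push_simps)
    show "fst (\<sigma>' p) = fst p" if "\<forall>p. fst (\<sigma> p) = fst p" for p
    proof -
      have "\<forall>p. fst (\<tau> p) = fst p" using that fst_\<tau> push_simps(6)[OF j(2)] by metis
      from \<sigma>'(6)[OF this] show ?thesis by blast
    qed
  qed (use \<sigma>' inner gen in blast)+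
qed

lemma is_cutD: "is_cut \<sigma> g h \<Longrightarrow> left_of g h (\<sigma> p) \<longleftrightarrow> left_of g h p"
  unfolding is_cut_def by blast

context periodic_matching
begin

lemma cut_translate:
  assumes "is_cut \<sigma> g h" "int N dvd t"
  shows "is_cut \<sigma> (g + t) (h + t)"
proof -
  have left: "left_of (g + t) (h + t) p \<longleftrightarrow> left_of g h (translate (- t) p)" for p
    by (cases p; cases "fst p") auto
  have "\<sigma> (translate (- t) p) = translate (- t) (\<sigma> p)" for p using assms(2) by (simp add: periodic)
  then show ?thesis using assms(1) unfolding is_cut_def left by metis
qed

lemma crossing_translate:
  assumes "int N dvd t"
  shows "(translate t p \<lless> translate t r \<and> translate t r \<lless> \<sigma> (translate t p) \<and>
      \<sigma> (translate t p) \<lless> \<sigma> (translate t r)) \<longleftrightarrow> (p \<lless> r \<and> r \<lless> \<sigma> p \<and> \<sigma> p \<lless> \<sigma> r)"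
  using assms by (simp add: periodic)

text \<open>\<open>E\<close> is meant to hold the points whose partner was changed,
  \<open>E0\<close> representatives of them modulo \<open>N\<close>. Crossings are translation
  invariant, so only those at a representative need a geometric argument.\<close>

lemma noncrossing_mod:
  assumes E: "\<And>p. p \<in> E \<Longrightarrow> \<exists>t. int N dvd t \<and> translate t p \<in> E0"
    and out: "\<And>p r. p \<notin> E \<Longrightarrow> r \<notin> E \<Longrightarrow> \<not> (p \<lless> r \<and> r \<lless> \<sigma> p \<and> \<sigma> p \<lless> \<sigma> r)"
    and base: "\<And>p r. p \<in> E0 \<or> r \<in> E0 \<Longrightarrow> \<not> (p \<lless> r \<and> r \<lless> \<sigma> p \<and> \<sigma> p \<lless> \<sigma> r)"
  shows "affine_matching N \<sigma>"
proof unfold_locales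
  fix p r
  show "\<not> (p \<lless> r \<and> r \<lless> \<sigma> p \<and> \<sigma> p \<lless> \<sigma> r)"
  proof (cases "p \<in> E \<or> r \<in> E")
    case True
    then obtain t where "int N dvd t" "translate t p \<in> E0 \<or> translate t r \<in> E0" using E by blast
    then show ?thesis using base crossing_translate by blast
  next
    case False
    then show ?thesis using out by blast
  qed
qed

end

section \<open>Merging an outer and an inner arc into two through-lines\<close>

lemma multiple_cases:
  assumes "int N dvd t"
  obtains "t \<le> - int N" | "t = 0" | "int N \<le> t"
proof -
  have "t > 0 \<Longrightarrow> int N \<le> t" "- t > 0 \<Longrightarrow> int N \<le> - t"
    using zdvd_imp_le[of "int N" t] zdvd_imp_le[of "int N" "- t"] assms by auto
  then show thesis using that by linarith
qed

text \<open>\<open>g - 1\<close> is reconnected with \<open>l\<close> and \<open>g\<close> with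
  \<open>h\<close>, in every translate. As \<open>g\<close> and \<open>h\<close> are adjacent to the
  cut, both new through-lines can run along its left side.\<close>

definition corner :: "nat \<Rightarrow> int \<Rightarrow> int \<Rightarrow> int \<Rightarrow> (point \<Rightarrow> point) \<Rightarrow> point \<Rightarrow> point" where
  "corner N g l h \<sigma> p = (case fst p of
     Outer \<Rightarrow> if int N dvd snd p - (g - 1) then (Inner, snd p - (g - 1) + l)
              else if int N dvd snd p - g then (Inner, snd p - g + h) else \<sigma> p
   | Inner \<Rightarrow> if int N dvd snd p - l then (Outer, snd p - l + (g - 1))
              else if int N dvd snd p - h then (Outer, snd p - h + g) else \<sigma> p)"

locale corner_setup = affine_matching +
  fixes g l h :: int
  assumes cut: "is_cut \<sigma> g h"
    and outer_arc: "\<sigma> (Outer, g - 1) = (Outer, g)"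
    and inner_less: "l < h"
    and inner_arc: "\<sigma> (Inner, l) = (Inner, h)"
begin

abbreviation "\<sigma>' \<equiv> corner N g l h \<sigma>"

definition ends :: "point set" where
  "ends = {p. \<exists>t. int N dvd t \<and> (p = (Outer, g - 1 + t) \<or> p = (Outer, g + t) \<or> p = (Inner, l + t) \<or> p = (Inner, h + t))}"

lemma short: "h < l + int N" using arc_short[OF inner_arc inner_less] .

lemma N2: "N \<ge> 2" using short inner_less by linarith

lemma excl: "\<not> int N dvd h - l" "\<not> int N dvd l - h" "\<not> int N dvd 1" "\<not> int N dvd - 1"
proof -
  have *: "\<not> int N dvd t" if "0 < t" "t < int N" for t using that zdvd_imp_le by force
  show "\<not> int N dvd h - l" "\<not> int N dvd 1" using *[of "h - l"] *[of 1] short inner_less N2 by auto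
  then show "\<not> int N dvd l - h" "\<not> int N dvd - 1" using dvd_minus_iff[of "int N" "h - l"] by auto
qed

lemma corner_eqs:
  assumes "int N dvd t"
  shows "\<sigma>' (Outer, g - 1 + t) = (Inner, l + t)" "\<sigma>' (Outer, g + t) = (Inner, h + t)"
    "\<sigma>' (Inner, l + t) = (Outer, g - 1 + t)" "\<sigma>' (Inner, h + t) = (Outer, g + t)"
proof -
  have "\<not> int N dvd t + 1" "\<not> int N dvd 1 + t" "\<not> int N dvd h + t - l"
    using excl dvd_add_left_iff[OF assms, of 1] dvd_add_left_iff[OF assms, of "h - l"]
    by (simp_all add: algebra_simps)
  then show "\<sigma>' (Outer, g - 1 + t) = (Inner, l + t)" "\<sigma>' (Outer, g + t) = (Inner, h + t)"
    "\<sigma>' (Inner, l + t) = (Outer, g - 1 + t)" "\<sigma>' (Inner, h + t) = (Outer, g + t)"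
    using assms by (simp_all add: corner_def)
qed

lemma corner_other: "p \<notin> ends \<Longrightarrow> \<sigma>' p = \<sigma> p"
proof -
  assume p: "p \<notin> ends"
  have "int N dvd snd p - a \<Longrightarrow> snd p = a + (snd p - a)" for a by simp
  then have "fst p = Outer \<Longrightarrow> \<not> int N dvd snd p - (g - 1) \<and> \<not> int N dvd snd p - g"
    "fst p = Inner \<Longrightarrow> \<not> int N dvd snd p - l \<and> \<not> int N dvd snd p - h"
    using p unfolding ends_def mem_Collect_eq by (metis prod.collapse)+
  then show ?thesis by (simp add: corner_def split: side.splits)
qed

lemma old_eqs:
  assumes "int N dvd t"
  shows "\<sigma> (Outer, g - 1 + t) = (Outer, g + t)" "\<sigma> (Outer, g + t) = (Outer, g - 1 + t)"
    "\<sigma> (Inner, l + t) = (Inner, h + t)" "\<sigma> (Inner, h + t) = (Inner, l + t)"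
proof -
  show 1: "\<sigma> (Outer, g - 1 + t) = (Outer, g + t)" "\<sigma> (Inner, l + t) = (Inner, h + t)"
    using periodic_pair[OF assms] outer_arc inner_arc by simp_all
  then show "\<sigma> (Outer, g + t) = (Outer, g - 1 + t)" "\<sigma> (Inner, h + t) = (Inner, l + t)"
    by (metis invol)+
qed

lemma ends_cases:
  assumes "p \<in> ends"
  obtains t where "int N dvd t" "p = (Outer, g - 1 + t)" | t where "int N dvd t" "p = (Outer, g + t)"
  | t where "int N dvd t" "p = (Inner, l + t)" | t where "int N dvd t" "p = (Inner, h + t)"
  using assms by (auto simp: ends_def)

lemma ends_mem:
  assumes "int N dvd t"
  shows "(Outer, g - 1 + t) \<in> ends" "(Outer, g + t) \<in> ends" "(Inner, l + t) \<in> ends" "(Inner, h + t) \<in> ends"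
  using assms by (auto simp: ends_def)

lemma old_ends: "\<sigma> p \<in> ends \<longleftrightarrow> p \<in> ends"
proof -
  have "\<sigma> p \<in> ends" if "p \<in> ends" for p
    using that by (rule ends_cases) (simp_all add: old_eqs ends_mem)
  from this[of p] this[of "\<sigma> p"] show ?thesis by auto
qed

lemma ends_translate: "int N dvd t \<Longrightarrow> translate t p \<in> ends \<longleftrightarrow> p \<in> ends"
proof -
  have "translate t p \<in> ends" if "p \<in> ends" "int N dvd t" for t p
    using that(1) by (rule ends_cases) (use that(2) ends_mem[of "_ + t"] in \<open>simp_all add: add.assoc\<close>)
  from this[of p t] this[of "translate t p" "- t"] show "int N dvd t \<Longrightarrow> ?thesis" by auto
qed

sublocale new: periodic_matching N \<sigma>'
proof unfold_locales
  show "\<sigma>' (\<sigma>' p) = p" for p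
  proof (cases "p \<in> ends")
    case True
    then show ?thesis by (rule ends_cases) (simp_all add: corner_eqs)
  next
    case False
    then show ?thesis using old_ends[of p] by (simp add: corner_other)
  qed
  show "\<sigma>' p \<noteq> p" for p
  proof (cases "p \<in> ends")
    case True
    then show ?thesis by (rule ends_cases) (simp_all add: corner_eqs)
  next
    case False
    then show ?thesis by (simp add: corner_other)
  qed
  show "\<sigma>' (x, i + int N) = (fst (\<sigma>' (x, i)), snd (\<sigma>' (x, i)) + int N)" for x i
  proof -
    have "\<sigma>' (translate (int N) p) = translate (int N) (\<sigma>' p)" for p
    proof (cases "p \<in> ends")
      case True
      have *: "translate (int N) (x, a + t) = (x, a + (t + int N))" for x a t by simp
      from True show ?thesis
        by (rule ends_cases) (simp_all only: corner_eqs * dvd_add dvd_refl)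
    next
      case False
      then show ?thesis using ends_translate[of "int N" p] by (simp add: corner_other periodic)
    qed
    from this[of "(x, i)"] show ?thesis by (simp add: translate_def)
  qed
qed (rule N_pos)

lemma cut': "is_cut \<sigma>' g h"
  unfolding is_cut_def
proof
  fix p
  show "left_of g h (\<sigma>' p) \<longleftrightarrow> left_of g h p"
  proof (cases "p \<in> ends")
    case True
    have "g - 1 + t \<le> g \<longleftrightarrow> l + t \<le> h" "g + t \<le> g \<longleftrightarrow> h + t \<le> h" if "int N dvd t" for t
      using that by (rule multiple_cases; use short inner_less N2 in auto)+
    then show ?thesis using True by (elim ends_cases) (simp_all add: corner_eqs)
  next
    case False
    then show ?thesis using is_cutD[OF cut] by (simp add: corner_other)
  qed
qed

text \<open>The former inner arc shielded these points: their partners lie under it too, so their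
  strands do not meet the new through-lines.\<close>

lemma between: 
  assumes "l < i" "i < h"
  shows "\<exists>k. \<sigma>' (Inner, i) = (Inner, k) \<and> l < k \<and> k < h"
proof -
  have "i \<noteq> l + t" "i \<noteq> h + t" if "int N dvd t" for t
    using that by (rule multiple_cases; use short assms in linarith)+
  then have "(Inner, i) \<notin> ends" unfolding ends_def by blast
  then show ?thesis using arc_inside[OF inner_arc assms] by (simp add: corner_other)
qed

lemma corner_base: "\<sigma>' (Outer, g - 1) = (Inner, l)" "\<sigma>' (Outer, g) = (Inner, h)"
    "\<sigma>' (Inner, l) = (Outer, g - 1)" "\<sigma>' (Inner, h) = (Outer, g)"
  using corner_eqs[of 0] by simp_all

text \<open>A strand crossing the through-line at \<open>g\<close> would join the two sides of the
  cut. A strand crossing the one at \<open>g - 1\<close> stays left of the cut, so one of its ends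
  lies at the other through-line or between the two, where \<open>between\<close> confines
  it.\<close>

lemma affine_matching_corner: "affine_matching N \<sigma>'"
proof (rule new.noncrossing_mod)
  let ?E0 = "{(Outer, g - 1), (Outer, g), (Inner, l), (Inner, h)}"
  show "\<exists>t. int N dvd t \<and> translate t p \<in> ?E0" if "p \<in> ends" for p
    using that
    by (elim ends_cases; rule_tac x = "- t" in exI; simp)
  show "\<not> (p \<lless> r \<and> r \<lless> \<sigma>' p \<and> \<sigma>' p \<lless> \<sigma>' r)" if "p \<notin> ends" "r \<notin> ends" for p r
    using that noncrossing[of p r] by (simp add: corner_other)
  have left: "left_of g h (\<sigma>' p) \<longleftrightarrow> left_of g h p" for p using is_cutD[OF cut'] .
  show "\<not> (p \<lless> r \<and> r \<lless> \<sigma>' p \<and> \<sigma>' p \<lless> \<sigma>' r)" if E0: "p \<in> ?E0 \<or> r \<in> ?E0" for p r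
  proof
    assume *: "p \<lless> r \<and> r \<lless> \<sigma>' p \<and> \<sigma>' p \<lless> \<sigma>' r"
    obtain x i y k where pr: "p = (x, i)" "r = (y, k)" by (cases p; cases r)
    obtain x' i' y' k' where pr': "\<sigma>' p = (x', i')" "\<sigma>' r = (y', k')" by (cases "\<sigma>' p"; cases "\<sigma>' r")
    have p_back: "\<sigma>' (x', i') = (x, i)" using pr(1) pr'(1) new.invol by metis
    from E0 consider "p = (Outer, g - 1)" | "p = (Outer, g)" | "r = (Outer, g - 1)" | "r = (Outer, g)"
      | "p = (Inner, l) \<or> p = (Inner, h)" | "r = (Inner, l) \<or> r = (Inner, h)"
      by blast
    then show False
    proof cases
      case 1
      then have [simp]: "y' = Inner" and "k' < l" using * pr' corner_base by (auto simp: boundary_less_Inner)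
      have "k' \<le> h" using \<open>k' < l\<close> inner_less by linarith
      then have "left_of g h r" using left[of r] pr' by simp
      then consider "r = (Outer, g)" | "r = (Inner, h)" | "y = Inner" "l < k" "k < h"
        using 1 * pr corner_base by (cases y; cases k h rule: linorder_cases) (auto simp: boundary_less_Inner)
      then show False using between[of k] pr pr' corner_base \<open>k' < l\<close> inner_less by cases auto
    next
      case 2
      then have "\<not> left_of g h r" using * pr corner_base by (cases y) (auto simp: boundary_less_Inner)
      moreover have "left_of g h (\<sigma>' r)" using 2 * pr' corner_base by (cases y') (auto simp: boundary_less_Inner)
      ultimately show False using left by blast
    next
      case 3
      then have x: "x = Outer" "i < g - 1" using * pr by (auto simp: boundary_less_Outer)
      then have "left_of g h (\<sigma>' p)" using left[of p] pr by simp
      then consider "\<sigma>' p = (Outer, g)" | "\<sigma>' p = (Inner, h)" | "x' = Inner" "l < i'" "i' < h"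
        using 3 * pr' corner_base by (cases x'; cases i' h rule: linorder_cases) (auto simp: boundary_less_Inner)
      then show False using between[of i'] x p_back pr' corner_base by cases auto
    next
      case 4
      then have "left_of g h p" using * pr by (cases x) (auto simp: boundary_less_Outer)
      moreover have "\<not> left_of g h (\<sigma>' p)"
        using 4 * pr' corner_base by (cases x') (auto simp: boundary_less_Inner)
      ultimately show False using left by blast
    next
      \<comment> \<open>A through-line has its outer end first in the boundary order, so an inner
        end of it can be neither the first of the four points nor, in the next case, the
        second.\<close>
      case 5
      then show False using * pr' corner_base by (cases y) (auto simp: boundary_less_Outer pr)
    next
      case 6
      then show False using * pr' corner_base by (cases x') (auto simp: boundary_less_Outer)
    qed
  qed
qed

lemma glue_corner:
  "glue N (diag_e N (g - 1)) (\<sigma>', k) = (\<sigma>, k)"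
  "contractible_loops N (diag_e N (g - 1)) (\<sigma>', k) = 0"
proof -
  have J: "(Outer, g - 1 + t) \<in> arc_ends N (g - 1)" "(Outer, g + t) \<in> arc_ends N (g - 1)" if "int N dvd t" for t
    using that by (simp_all add: algebra_simps)
  have same: "\<sigma>' r = \<sigma> r" if "r \<notin> arc_ends N (g - 1)" "\<sigma>' r \<notin> arc_ends N (g - 1)" for r
  proof (cases "r \<in> ends")
    case True
    then show ?thesis by (rule ends_cases) (use that J in \<open>auto simp: corner_eqs simp del: arc_ends_simps\<close>)
  qed (rule corner_other)
  show "glue N (diag_e N (g - 1)) (\<sigma>', k) = (\<sigma>, k)"
    "contractible_loops N (diag_e N (g - 1)) (\<sigma>', k) = 0"
    using e_product.glue_e[OF e_productI[OF periodic_matching_axioms new.periodic_matching_axioms N2, of "g - 1"]] same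
      outer_arc corner_base inner_arc by simp_all
qed

lemma corner_generated: "(\<sigma>', k) \<in> generated N \<Longrightarrow> (\<sigma>, k) \<in> generated N"
  using generated.e[of "(\<sigma>', k)" N "g - 1"] unfolding glue_corner using N2 by blast

text \<open>The count runs over residues modulo \<open>N\<close> of ends of inner arcs. The residue
  of \<open>l\<close> leaves the set, as \<open>l\<close> is now on a through-line, and nothing
  enters it.\<close>

lemma corner_measure:
  "card {i \<in> {0..<int N}. fst (\<sigma>' (Inner, i)) = Inner} < card {i \<in> {0..<int N}. fst (\<sigma> (Inner, i)) = Inner}"
proof (rule psubset_card_mono)
  show "finite {i \<in> {0..<int N}. fst (\<sigma> (Inner, i)) = Inner}"
    by (rule finite_subset[of _ "{0..<int N}"]) auto
  have old: "fst (\<sigma> (Inner, i)) = Inner" if "fst (\<sigma>' (Inner, i)) = Inner" for i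
  proof (cases "(Inner, i) \<in> ends")
    case True
    then show ?thesis by (rule ends_cases) (use that corner_eqs in auto)
  qed (use that corner_other in auto)
  have "int N dvd l mod int N - l" by (metis dvd_minus_mod dvd_minus_iff minus_diff_eq)
  then have "fst (\<sigma>' (Inner, l mod int N)) = Outer" "fst (\<sigma> (Inner, l mod int N)) = Inner"
    using corner_eqs(3)[of "l mod int N - l"] old_eqs(3)[of "l mod int N - l"] by simp_all
  moreover have "l mod int N \<in> {0..<int N}" using N_pos by simp
  ultimately have "l mod int N \<in> {i \<in> {0..<int N}. fst (\<sigma> (Inner, i)) = Inner}"
    "l mod int N \<notin> {i \<in> {0..<int N}. fst (\<sigma>' (Inner, i)) = Inner}" by auto
  moreover have "{i \<in> {0..<int N}. fst (\<sigma>' (Inner, i)) = Inner} \<subseteq> {i \<in> {0..<int N}. fst (\<sigma> (Inner, i)) = Inner}"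
    using old by blast
  ultimately show "{i \<in> {0..<int N}. fst (\<sigma>' (Inner, i)) = Inner} \<subset> {i \<in> {0..<int N}. fst (\<sigma> (Inner, i)) = Inner}"
    by blast
qed

end

section \<open>Trading a non-contractible loop for a long outer arc\<close>

definition encircle :: "nat \<Rightarrow> int \<Rightarrow> (point \<Rightarrow> point) \<Rightarrow> point \<Rightarrow> point" where
  "encircle N g \<sigma> p = (case fst p of
     Outer \<Rightarrow> if int N dvd snd p - g then (Outer, snd p + int N - 1)
              else if int N dvd snd p - (g - 1) then (Outer, snd p - int N + 1) else \<sigma> p
   | Inner \<Rightarrow> \<sigma> p)"

text \<open>The ends of the small arc are reconnected the other way round the annulus,
  \<open>g\<close> with \<open>g - 1 + N\<close>; a through-line would be in the way. Together with
  the inner arc of \<open>e_{g-1}\<close> this long arc closes up to a non-contractible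
  loop.\<close>

locale encircle_setup = affine_matching +
  fixes g h :: int
  assumes cut: "is_cut \<sigma> g h"
    and outer_arc: "\<sigma> (Outer, g - 1) = (Outer, g)"
    and no_through: "fst (\<sigma> p) = fst p"
begin

abbreviation "\<sigma>' \<equiv> encircle N g \<sigma>"
abbreviation "J \<equiv> arc_ends N (g - 1)"

lemma N2: "N \<ge> 2" using arc_short[OF outer_arc] by simp

lemma encircle_eqs:
  assumes "int N dvd t"
  shows "\<sigma>' (Outer, g + t) = (Outer, g - 1 + (t + int N))" "\<sigma>' (Outer, g - 1 + t) = (Outer, g + (t - int N))"
proof -
  have "\<not> int N dvd t - 1"
    using not_both_dvd[OF N2, of t] assms by blast
  then show "\<sigma>' (Outer, g + t) = (Outer, g - 1 + (t + int N))" "\<sigma>' (Outer, g - 1 + t) = (Outer, g + (t - int N))"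
    using assms by (simp_all add: encircle_def algebra_simps)
qed

lemma J_mem: "int N dvd t \<Longrightarrow> (Outer, g + t) \<in> J" "int N dvd t \<Longrightarrow> (Outer, g - 1 + t) \<in> J"
  by (simp_all add: algebra_simps)

lemma J_cases:
  assumes "p \<in> J"
  obtains t where "int N dvd t" "p = (Outer, g + t)" | t where "int N dvd t" "p = (Outer, g - 1 + t)"
  using assms
proof (rule arc_ends_cases)
  fix i assume i: "int N dvd i - (g - 1)" "p = (Outer, i) \<or> p = (Outer, i + 1)"
  then show thesis using that[of "i - (g - 1)"] by auto
qed

lemma encircle_other: "p \<notin> J \<Longrightarrow> \<sigma>' p = \<sigma> p"
  by (cases p; cases "fst p") (simp_all add: encircle_def algebra_simps)

lemma old_J: "\<sigma> p \<in> J \<longleftrightarrow> p \<in> J"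
  using arc_ends_invariant[of "g - 1"] outer_arc by simp

lemma fst_encircle: "fst (\<sigma>' p) = fst p"
  using no_through by (simp add: encircle_def split: side.splits)

sublocale new: periodic_matching N \<sigma>'
proof unfold_locales
  show "\<sigma>' (\<sigma>' p) = p" for p
  proof (cases "p \<in> J")
    case True
    then show ?thesis
      by (rule J_cases) (simp_all only: encircle_eqs dvd_add dvd_diff dvd_refl add_diff_cancel diff_add_cancel)
  next
    case False
    then show ?thesis using old_J[of p] by (simp add: encircle_other)
  qed
  show "\<sigma>' p \<noteq> p" for p
  proof (cases "p \<in> J")
    case True
    then show ?thesis by (rule J_cases) (use N2 in \<open>simp_all add: encircle_eqs\<close>)
  next
    case False
    then show ?thesis by (simp add: encircle_other)
  qed
  show "\<sigma>' (x, i + int N) = (fst (\<sigma>' (x, i)), snd (\<sigma>' (x, i)) + int N)" for x i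
  proof -
    have "\<sigma>' (translate (int N) p) = translate (int N) (\<sigma>' p)" for p
    proof (cases "p \<in> J")
      case True
      have *: "translate (int N) (x, a + t) = (x, a + (t + int N))" for x a t by simp
      from True show ?thesis
        by (rule J_cases) (simp_all only: encircle_eqs * dvd_add dvd_diff dvd_refl add_diff_cancel diff_add_cancel)
    next
      case False
      then show ?thesis using arc_ends_translate[of N "int N" p "g - 1"] by (simp add: encircle_other periodic)
    qed
    from this[of "(x, i)"] show ?thesis by (simp add: translate_def)
  qed
qed (rule N_pos)

lemma affine_matching_encircle: "affine_matching N \<sigma>'"
proof (rule new.noncrossing_mod)
  \<comment> \<open>The representatives are the two ends of one lift of the long arc, so that a
    crossing can be located relative to the interval between them.\<close>
  let ?E0 = "{(Outer, g), (Outer, g - 1 + int N)}"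
  show "\<exists>t. int N dvd t \<and> translate t p \<in> ?E0" if "p \<in> J" for p
    using that
  proof (rule J_cases)
    fix t assume "int N dvd t" "p = (Outer, g + t)"
    then show ?thesis by (intro exI[of _ "- t"]) simp
  next
    fix t assume "int N dvd t" "p = (Outer, g - 1 + t)"
    then show ?thesis by (intro exI[of _ "int N - t"]) simp
  qed
  show "\<not> (p \<lless> r \<and> r \<lless> \<sigma>' p \<and> \<sigma>' p \<lless> \<sigma>' r)" if "p \<notin> J" "r \<notin> J" for p r
    using that noncrossing[of p r] by (simp add: encircle_other)
  have base: "\<sigma>' (Outer, g) = (Outer, g - 1 + int N)" "\<sigma>' (Outer, g - 1 + int N) = (Outer, g)"
    using encircle_eqs(1)[of 0] encircle_eqs(2)[of "int N"] by simp_all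
  have left: "left_of g h (\<sigma> p) \<longleftrightarrow> left_of g h p" "left_of (g + int N) (h + int N) (\<sigma> p) \<longleftrightarrow> left_of (g + int N) (h + int N) p" for p
    using is_cutD[OF cut] is_cutD[OF cut_translate[OF cut]] by simp_all
  show "\<not> (p \<lless> r \<and> r \<lless> \<sigma>' p \<and> \<sigma>' p \<lless> \<sigma>' r)" if E0: "p \<in> ?E0 \<or> r \<in> ?E0" for p r
  proof
    assume *: "p \<lless> r \<and> r \<lless> \<sigma>' p \<and> \<sigma>' p \<lless> \<sigma>' r"
    obtain x i y k where pr: "p = (x, i)" "r = (y, k)" by (cases p; cases r)
    obtain i' k' where pr': "\<sigma>' p = (x, i')" "\<sigma>' r = (y, k')"
      using fst_encircle[of p] fst_encircle[of r] pr by (cases "\<sigma>' p"; cases "\<sigma>' r") auto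
    from E0 consider "p = (Outer, g)" | "p = (Outer, g - 1 + int N)" | "r = (Outer, g)" | "r = (Outer, g - 1 + int N)"
      by blast
    then show False
    proof cases
      case 1
      then have k: "y = Outer" "g < k" "k < g - 1 + int N" "g - 1 + int N < k'"
        using * pr pr' base by (auto simp: boundary_less_Outer)
      have nJ: "r \<notin> J"
      proof
        assume "r \<in> J"
        then show False
        proof (rule J_cases)
          fix t assume "int N dvd t" "r = (Outer, g + t)"
          then show False using k pr by (elim multiple_cases) auto
        next
          fix t assume "int N dvd t" "r = (Outer, g - 1 + t)"
          then show False using k pr by (elim multiple_cases) auto
        qed
      qed
      then have "\<sigma> r = (Outer, k')" using pr' k by (simp add: encircle_other)
      \<comment> \<open>The translated cut leaves only \<open>g + N\<close> as partner of
        \<open>r\<close>. That point belongs to \<open>J\<close>, which is closed under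
        \<open>\<sigma>\<close>, so \<open>r\<close> would belong to \<open>J\<close> as
        well.\<close>
      then have "k' \<le> g + int N" using left(2)[of r] pr k by simp
      then have "\<sigma> r = (Outer, g + int N)" using k \<open>\<sigma> r = (Outer, k')\<close> by simp
      then show False using nJ old_J[of r] J_mem(1)[of "int N"] by simp
    next
      case 2
      then show False using * base N2 by (auto simp: boundary_less_Outer)
    next
      case 3
      then have i: "x = Outer" "i < g" "g < i'" "i' < g - 1 + int N"
        using * pr pr' base by (auto simp: boundary_less_Outer)
      show False
      proof (cases "p \<in> J")
        case True
        then show False
        proof (rule J_cases)
          fix t assume t: "int N dvd t" "p = (Outer, g + t)"
          then have "i' = g - 1 + (t + int N)" using encircle_eqs(1)[of t] pr'(1) by simp
          then show False using t i pr by (elim multiple_cases) auto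
        next
          fix t assume t: "int N dvd t" "p = (Outer, g - 1 + t)"
          then have "i' = g + (t - int N)" using encircle_eqs(2)[of t] pr'(1) by simp
          then show False using t i pr N2 by auto
        qed
      next
        case False
        then have "\<sigma> p = (Outer, i')" using pr' i by (simp add: encircle_other)
        then show False using left(1)[of p] pr i by simp
      qed
    next
      case 4
      then show False using * base N2 pr' by (cases x) (auto simp: boundary_less_Outer)
    qed
  qed
qed

lemma encircle_generated: "(\<sigma>', k) \<in> generated N \<Longrightarrow> (\<sigma>, Suc k) \<in> generated N"
proof -
  assume "(\<sigma>', k) \<in> generated N"
  moreover have "\<sigma>' (Outer, g - 1 + 1) = (Outer, g - 1 + int N)" using encircle_eqs(1)[of 0] by simp
  ultimately show ?thesis
    using e_product.glue_e_loop[OF e_productI[OF periodic_matching_axioms new.periodic_matching_axioms N2, of "g - 1"] _ encircle_other]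
      generated.e[of "(\<sigma>', k)" N "g - 1"] outer_arc N2 by simp
qed

end

lemma generated_no_loops:
  assumes "affine_matching N \<sigma>"
  shows "(\<sigma>, 0) \<in> generated N"
  using assms
proof (induction "card {i \<in> {0..<int N}. fst (\<sigma> (Inner, i)) = Inner}" arbitrary: \<sigma> rule: less_induct)
  case (less \<sigma>)
  then interpret affine_matching N \<sigma> by simp
  show ?case
  proof (cases "\<exists>i. fst (\<sigma> (Inner, i)) = Inner")
    case False
    then obtain s where "\<sigma> = fst (diag_shift s)" using all_through_shift[of Inner] by blast
    then have "(\<sigma>, 0) = diag_shift s" by (simp add: prod_eq_iff)
    then show ?thesis using diag_shift_generated by simp
  next
    case True
    then obtain i k where "\<sigma> (Inner, i) = (Inner, k)" by (metis prod.collapse)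
    then obtain l g h where lgh: "l < h" "\<sigma> (Inner, l) = (Inner, h)" "is_cut \<sigma> g h"
      using exists_cut by blast
    \<comment> \<open>If all outer points were on through-lines, the matching would be a
      translation, contrary to the inner arc from \<open>l\<close> to \<open>h\<close>.\<close>
    have "\<exists>i. fst (\<sigma> (Outer, i)) = Outer"
    proof (rule ccontr)
      assume "\<not> ?thesis"
      then obtain s where "\<sigma> = fst (diag_shift s)" using all_through_shift[of Outer] by blast
      then show False using lgh(2) by simp
    qed
    then obtain i' k' where "\<sigma> (Outer, i') = (Outer, k')" by (metis prod.collapse)
    then obtain j where "\<sigma> (Outer, j) = (Outer, j + 1)" "g - int N < j" "j + 1 \<le> g"
      using small_arc_below_cut[OF lgh(3)] by blast
    from push_arc_to_cut[OF less.prems lgh(3) this]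
    obtain \<tau> where \<tau>: "affine_matching N \<tau>" "is_cut \<tau> g h" "\<tau> (Outer, g - 1) = (Outer, g)"
      "\<And>i. fst (\<tau> (Inner, i)) = fst (\<sigma> (Inner, i))" "\<tau> (Inner, l) = (Inner, h)"
      "(\<tau>, 0) \<in> generated N \<Longrightarrow> (\<sigma>, 0) \<in> generated N"
      using lgh(2) by blast
    interpret T: corner_setup N \<tau> g l h
      using \<tau>(1,2,3,5) lgh(1) by (simp add: corner_setup_def corner_setup_axioms_def)
    have "(T.\<sigma>', 0) \<in> generated N"
      by (rule less.hyps) (use T.corner_measure T.affine_matching_corner \<tau>(4) in auto)
    then show ?thesis using T.corner_generated \<tau>(6) by blast
  qed
qed

text \<open>Loops are removed one at a time. In their presence there are no through-lines, so a
  small outer arc can be brought to a cut and replaced by the long arc, which accounts for one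
  loop.\<close>

lemma generated_loops:
  assumes "affine_matching N \<sigma>" "k = 0 \<or> (\<forall>p. fst (\<sigma> p) = fst p)"
  shows "(\<sigma>, k) \<in> generated N"
  using assms
proof (induction k arbitrary: \<sigma>)
  case 0
  then show ?case using generated_no_loops by blast
next
  case (Suc k)
  then interpret affine_matching N \<sigma> by simp
  have side: "fst (\<sigma> p) = fst p" for p using Suc.prems(2) by blast
  obtain k0 where "\<sigma> (Inner, 0) = (Inner, k0)" using side[of "(Inner, 0)"] by (cases "\<sigma> (Inner, 0)") auto
  then obtain g h where cut: "is_cut \<sigma> g h" using exists_cut by blast
  obtain k1 where "\<sigma> (Outer, 0) = (Outer, k1)" using side[of "(Outer, 0)"] by (cases "\<sigma> (Outer, 0)") auto
  then obtain j where "\<sigma> (Outer, j) = (Outer, j + 1)" "g - int N < j" "j + 1 \<le> g"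
    using small_arc_below_cut[OF cut] by blast
  from push_arc_to_cut[OF Suc.prems(1) cut this]
  obtain \<tau> where \<tau>: "affine_matching N \<tau>" "is_cut \<tau> g h" "\<tau> (Outer, g - 1) = (Outer, g)"
    "\<And>p. fst (\<tau> p) = fst p" "(\<tau>, Suc k) \<in> generated N \<Longrightarrow> (\<sigma>, Suc k) \<in> generated N"
    using side by blast
  interpret T: encircle_setup N \<tau> g h
    using \<tau>(1-4) by (simp add: encircle_setup_def encircle_setup_axioms_def)
  have "(T.\<sigma>', k) \<in> generated N"
    by (rule Suc.IH) (use T.affine_matching_encircle T.fst_encircle in auto)
  then show ?case using T.encircle_generated \<tau>(5) by blast
qed

theorem affdiags_generated: "N \<ge> 1 \<Longrightarrow> affdiags N \<subseteq> generated N"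
proof
  fix d assume N: "N \<ge> 1" and d: "d \<in> affdiags N"
  obtain \<sigma> k where "d = (\<sigma>, k)" by (cases d)
  then show "d \<in> generated N" using generated_loops affdiags_iff[OF N] d by blast
qed

section \<open>Linear extension\<close>

lemma pm_extend_superset:
  assumes "finite A" "Poly_Mapping.keys v \<subseteq> A"
  shows "pm_extend \<phi> v = (\<Sum>b\<in>A. pm_scale (Poly_Mapping.lookup v b) (\<phi> b))"
  unfolding pm_extend_def using assms
  by (intro sum.mono_neutral_left) (auto simp: in_keys_iff)

lemma pm_extend_zero [simp]: "pm_extend \<phi> 0 = 0"
  by (simp add: pm_extend_def)

lemma pm_extend_add: "pm_extend \<phi> (v + w) = pm_extend \<phi> v + pm_extend \<phi> w"
proof -
  let ?A = "Poly_Mapping.keys v \<union> Poly_Mapping.keys w"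
  have "pm_extend \<phi> (v + w) = (\<Sum>b\<in>?A. pm_scale (Poly_Mapping.lookup (v + w) b) (\<phi> b))"
    by (rule pm_extend_superset) (use keys_add[of v w] in auto)
  then show ?thesis
    by (simp add: pm_extend_superset[of ?A v] pm_extend_superset[of ?A w] lookup_add pm.scale_left_distrib sum.distrib)
qed

lemma pm_extend_scale: "pm_extend \<phi> (pm_scale c v) = pm_scale c (pm_extend \<phi> v)"
proof -
  have "pm_extend \<phi> (pm_scale c v) =
      (\<Sum>b\<in>Poly_Mapping.keys v. pm_scale (Poly_Mapping.lookup (pm_scale c v) b) (\<phi> b))"
    by (rule pm_extend_superset) (auto simp: in_keys_iff lookup_pm_scale)
  then show ?thesis
    by (simp add: pm_extend_def lookup_pm_scale pm.scale_sum_right)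
qed

lemma pm_extend_uminus: "pm_extend \<phi> (- v) = - pm_extend \<phi> v"
  using pm_extend_scale[of \<phi> "- 1" v] by simp

lemma pm_extend_diff: "pm_extend \<phi> (v - w) = pm_extend \<phi> v - pm_extend \<phi> w"
  using pm_extend_add[of \<phi> v "- w"] by (simp add: pm_extend_uminus)

lemma pm_extend_basis [simp]: "pm_extend \<phi> (basis b) = \<phi> b"
  by (simp add: pm_extend_def)

lemma pm_extend_fun_add: "pm_extend (\<lambda>b. \<phi> b + \<psi> b) v = pm_extend \<phi> v + pm_extend \<psi> v"
  by (simp add: pm_extend_def pm.scale_right_distrib sum.distrib)

lemma pm_extend_fun_scale: "pm_extend (\<lambda>b. pm_scale c (\<phi> b)) v = pm_scale c (pm_extend \<phi> v)"
  by (simp add: pm_extend_def pm.scale_sum_right mult.commute)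

lemma pm_expansion: "v = (\<Sum>b\<in>Poly_Mapping.keys v. pm_scale (Poly_Mapping.lookup v b) (basis b))"
  by (rule poly_mapping_eqI)
    (simp add: lookup_sum lookup_pm_scale lookup_single when_def in_keys_iff if_distrib cong: if_cong)

lemma pm_induct_keys:
  assumes keys: "Poly_Mapping.keys v \<subseteq> K"
    and zero: "P 0" and basis: "\<And>b c. b \<in> K \<Longrightarrow> P (pm_scale c (basis b))"
    and add: "\<And>v w. P v \<Longrightarrow> P w \<Longrightarrow> P (v + w)"
  shows "P v"
proof -
  have "P (\<Sum>b\<in>A. pm_scale (f b) (basis b))" if "finite A" "A \<subseteq> K" for A f
    using that by (induction A rule: finite_induct) (auto intro: zero basis add)
  from this[OF finite_keys keys, of "Poly_Mapping.lookup v"] show ?thesis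
    unfolding pm_expansion[symmetric] .
qed

lemma pm_induct [case_names zero scale add basis]:
  assumes "P 0" "\<And>c v. P v \<Longrightarrow> P (pm_scale c v)" "\<And>v w. P v \<Longrightarrow> P w \<Longrightarrow> P (v + w)" "\<And>b. P (basis b)"
  shows "P v"
  by (rule pm_induct_keys[of v UNIV P]) (use assms in auto)

lemma keys_scale: "Poly_Mapping.keys (pm_scale c v) \<subseteq> Poly_Mapping.keys v"
  by (auto simp: in_keys_iff lookup_pm_scale)

lemma pm_tensor_basis: "pm_tensor (basis a) (basis b) = basis (a, b)"
  by (simp add: pm_tensor_def)

lemma pm_tensor_add_left: "pm_tensor (x + x') y = pm_tensor x y + pm_tensor x' y"
  and pm_tensor_add_right: "pm_tensor x (y + y') = pm_tensor x y + pm_tensor x y'"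
  and pm_tensor_scale_left: "pm_tensor (pm_scale c x) y = pm_scale c (pm_tensor x y)"
  and pm_tensor_scale_right: "pm_tensor x (pm_scale c y) = pm_scale c (pm_tensor x y)"
  and pm_tensor_zero_left [simp]: "pm_tensor 0 y = 0"
  and pm_tensor_zero_right [simp]: "pm_tensor x 0 = 0"
  by (simp_all add: pm_tensor_def pm_extend_add pm_extend_scale pm_extend_fun_add pm_extend_fun_scale)
    (simp add: pm_extend_def)

lemmas pm_tensor_linear = pm_tensor_add_left pm_tensor_add_right pm_tensor_scale_left pm_tensor_scale_right

lemma carrier_basis_algebra: "x \<in> carrier (basis_algebra B p e) \<longleftrightarrow> Poly_Mapping.keys x \<subseteq> B"
  by (simp add: basis_algebra_def)

lemma basis_algebra_add [simp]: "x \<oplus>\<^bsub>basis_algebra B p e\<^esub> y = x + y"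
  and basis_algebra_one [simp]: "\<one>\<^bsub>basis_algebra B p e\<^esub> = basis e"
  by (simp_all add: basis_algebra_def)

lemma basis_algebra_mult_basis: "basis a \<otimes>\<^bsub>basis_algebra B p e\<^esub> basis b = p a b"
  by (simp add: basis_algebra_def)

lemma basis_algebra_mult_linear:
  "(x + x') \<otimes>\<^bsub>basis_algebra B p e\<^esub> y = x \<otimes>\<^bsub>basis_algebra B p e\<^esub> y + x' \<otimes>\<^bsub>basis_algebra B p e\<^esub> y"
  "x \<otimes>\<^bsub>basis_algebra B p e\<^esub> (y + y') = x \<otimes>\<^bsub>basis_algebra B p e\<^esub> y + x \<otimes>\<^bsub>basis_algebra B p e\<^esub> y'"
  "pm_scale c x \<otimes>\<^bsub>basis_algebra B p e\<^esub> y = pm_scale c (x \<otimes>\<^bsub>basis_algebra B p e\<^esub> y)"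
  "x \<otimes>\<^bsub>basis_algebra B p e\<^esub> pm_scale c y = pm_scale c (x \<otimes>\<^bsub>basis_algebra B p e\<^esub> y)"
  "0 \<otimes>\<^bsub>basis_algebra B p e\<^esub> y = 0"
  "x \<otimes>\<^bsub>basis_algebra B p e\<^esub> 0 = 0"
  by (simp_all add: basis_algebra_def pm_extend_add pm_extend_scale pm_extend_fun_add pm_extend_fun_scale)
    (simp add: pm_extend_def)

lemma carrier_basis_algebra_closed:
  "x \<in> carrier (basis_algebra B p e) \<Longrightarrow> y \<in> carrier (basis_algebra B p e) \<Longrightarrow>
    x + y \<in> carrier (basis_algebra B p e)"
  "x \<in> carrier (basis_algebra B p e) \<Longrightarrow> pm_scale c x \<in> carrier (basis_algebra B p e)"
  "0 \<in> carrier (basis_algebra B p e)"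
  using keys_add[of x y] keys_scale[of c x] by (auto simp: carrier_basis_algebra)

lemma basis_carrier: "basis b \<in> carrier (basis_algebra B p e) \<longleftrightarrow> b \<in> B"
  by (simp add: carrier_basis_algebra)

text \<open>Both sides are linear in each of the four arguments, which are reduced to basis vectors
  one after the other.\<close>

lemma pm_tensor_mult:
  "pm_tensor x y \<otimes>\<^bsub>aTL_tensor m K L\<^esub> pm_tensor x' y' =
   pm_tensor (x \<otimes>\<^bsub>aTL m K\<^esub> x') (y \<otimes>\<^bsub>aTL m L\<^esub> y')"
proof -
  note lin = basis_algebra_mult_linear pm_tensor_linear
  have 1: "pm_tensor (basis a) (basis b) \<otimes>\<^bsub>aTL_tensor m K L\<^esub> pm_tensor (basis c) (basis d) =
    pm_tensor (basis a \<otimes>\<^bsub>aTL m K\<^esub> basis c) (basis b \<otimes>\<^bsub>aTL m L\<^esub> basis d)" for a b c d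
    unfolding aTL_tensor_def aTL_def by (simp add: basis_algebra_mult_basis pm_tensor_basis)
  have 2: "pm_tensor (basis a) (basis b) \<otimes>\<^bsub>aTL_tensor m K L\<^esub> pm_tensor (basis c) y' =
    pm_tensor (basis a \<otimes>\<^bsub>aTL m K\<^esub> basis c) (basis b \<otimes>\<^bsub>aTL m L\<^esub> y')" for a b c
    by (induction y' rule: pm_induct) (use 1 in \<open>simp_all add: aTL_tensor_def aTL_def lin\<close>)
  have 3: "pm_tensor (basis a) (basis b) \<otimes>\<^bsub>aTL_tensor m K L\<^esub> pm_tensor x' y' =
    pm_tensor (basis a \<otimes>\<^bsub>aTL m K\<^esub> x') (basis b \<otimes>\<^bsub>aTL m L\<^esub> y')" for a b
    by (induction x' rule: pm_induct) (use 2 in \<open>simp_all add: aTL_tensor_def aTL_def lin\<close>)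
  have 4: "pm_tensor (basis a) y \<otimes>\<^bsub>aTL_tensor m K L\<^esub> pm_tensor x' y' =
    pm_tensor (basis a \<otimes>\<^bsub>aTL m K\<^esub> x') (y \<otimes>\<^bsub>aTL m L\<^esub> y')" for a
    by (induction y rule: pm_induct) (use 3 in \<open>simp_all add: aTL_tensor_def aTL_def lin\<close>)
  show ?thesis
    by (induction x rule: pm_induct) (use 4 in \<open>simp_all add: aTL_tensor_def aTL_def lin\<close>)
qed

lemma pm_tensor_carrier:
  assumes "x \<in> carrier (aTL m K)" "y \<in> carrier (aTL m L)"
  shows "pm_tensor x y \<in> carrier (aTL_tensor m K L)"
proof -
  have "Poly_Mapping.keys (pm_tensor x y) \<subseteq> (\<Union>a\<in>Poly_Mapping.keys x. \<Union>b\<in>Poly_Mapping.keys y. {(a, b)})"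
    unfolding pm_tensor_def pm_extend_def
    by (intro order.trans[OF keys_sum] UN_mono order_refl order.trans[OF keys_scale] order.trans[OF keys_sum])
      simp
  then show ?thesis using assms by (auto simp: aTL_def aTL_tensor_def carrier_basis_algebra)
qed

section \<open>Generators of the affine Temperley--Lieb algebra\<close>

lemmas aTL_mult_linear = basis_algebra_mult_linear[where B = "affdiags N" and p = "diag_mult m N" and e = diag_one for m N, folded aTL_def]
lemmas aTL_closed = carrier_basis_algebra_closed[where B = "affdiags N" and p = "diag_mult m N" and e = diag_one for m N, folded aTL_def]
lemmas aTL_basis_carrier = basis_carrier[where B = "affdiags N" and p = "diag_mult m N" and e = diag_one for m N, folded aTL_def]

lemma aTL_add [simp]: "x \<oplus>\<^bsub>aTL m N\<^esub> y = x + y" and aTL_one [simp]: "\<one>\<^bsub>aTL m N\<^esub> = tl_one"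
  by (simp_all add: aTL_def)

lemma aTL_mult_basis: "contractible_loops N a b = 0 \<Longrightarrow> basis a \<otimes>\<^bsub>aTL m N\<^esub> basis b = basis (glue N a b)"
  by (simp add: aTL_def basis_algebra_mult_basis diag_mult_def)

text \<open>A strand joining neighbours cannot be crossed, and through-lines with a common shift are
  parallel. This covers the translations as well as \<open>e_j\<close>, where the shift is
  0.\<close>

lemma affine_matching_short:
  assumes "periodic_matching N \<sigma>"
    and short: "\<And>x i. \<sigma> (x, i) = (x, i + 1) \<or> \<sigma> (x, i) = (x, i - 1) \<or> \<sigma> (x, i) = (opposite x, i - (if x = Outer then s else - s))"
  shows "affine_matching N \<sigma>"
proof -
  have "\<not> (p \<lless> r \<and> r \<lless> \<sigma> p \<and> \<sigma> p \<lless> \<sigma> r)" for p r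
  proof -
    obtain x i y k where [simp]: "p = (x, i)" "r = (y, k)" by (cases p; cases r)
    show ?thesis using short[of x i] short[of y k] by (cases x; cases y) auto
  qed
  then show ?thesis using assms(1) by (simp add: affine_matching_def affine_matching_axioms_def)
qed

lemma diag_shift_affdiags: "N \<ge> 1 \<Longrightarrow> diag_shift s \<in> affdiags N"
proof -
  assume N: "N \<ge> 1"
  have "periodic_matching N (fst (diag_shift s))"
  proof unfold_locales
    show "fst (diag_shift s) (fst (diag_shift s) p) = p" "fst (diag_shift s) p \<noteq> p" for p
      by (cases p; cases "fst p"; simp)+
    show "fst (diag_shift s) (x, i + int N) = (fst (fst (diag_shift s) (x, i)), snd (fst (diag_shift s) (x, i)) + int N)" for x i
      by (cases x) simp_all
  qed (rule N)
  moreover have "fst (diag_shift s) (x, i) = (opposite x, i - (if x = Outer then s else - s))" for x i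
    by (cases x) simp_all
  ultimately have "affine_matching N (fst (diag_shift s))" by (intro affine_matching_short[where s = s]) auto
  moreover have "diag_shift s = (fst (diag_shift s), 0)" by (simp add: prod_eq_iff)
  ultimately show ?thesis using affdiags_iff[OF N, of "fst (diag_shift s)" 0] by simp
qed

lemma diag_e_periodic:
  assumes N: "N \<ge> 2" shows "periodic_matching N (fst (diag_e N j))"
proof unfold_locales
  show "fst (diag_e N j) (fst (diag_e N j) p) = p" for p
  proof (cases p)
    case (Pair x i)
    consider "int N dvd i - j" | "int N dvd i - j - 1" | "\<not> int N dvd i - j" "\<not> int N dvd i - j - 1" by blast
    then show ?thesis
    proof cases
      case 1
      moreover from 1 have "int N dvd (i + 1) - j - 1" by (simp add: algebra_simps)
      ultimately show ?thesis using Pair N by (simp add: diag_e_simps)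
    next
      case 2
      moreover from 2 have "int N dvd (i - 1) - j" by (simp add: algebra_simps)
      ultimately show ?thesis using Pair N by (simp add: diag_e_simps)
    next
      case 3
      then show ?thesis using Pair by (cases x) (simp_all add: diag_e_simps)
    qed
  qed
  show "fst (diag_e N j) p \<noteq> p" for p
    by (cases p; cases "fst p") (auto simp: diag_e_def)
  show "fst (diag_e N j) (x, i + int N) = (fst (fst (diag_e N j) (x, i)), snd (fst (diag_e N j) (x, i)) + int N)" for x i
  proof -
    have "int N dvd i + int N - j \<longleftrightarrow> int N dvd i - j" "int N dvd i + int N - j - 1 \<longleftrightarrow> int N dvd i - j - 1"
      using dvd_add_left_iff[of "int N" "int N" "i - j"] dvd_add_left_iff[of "int N" "int N" "i - j - 1"]
      by (simp_all add: algebra_simps)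
    then show ?thesis by (simp add: diag_e_def)
  qed
qed (use N in simp)

lemma diag_e_affdiags: "N \<ge> 2 \<Longrightarrow> diag_e N j \<in> affdiags N"
proof -
  assume N: "N \<ge> 2"
  have "affine_matching N (fst (diag_e N j))"
    by (rule affine_matching_short[where s = 0, OF diag_e_periodic[OF N]]) (simp add: diag_e_def)
  moreover have "diag_e N j = (fst (diag_e N j), 0)" by (simp add: prod_eq_iff diag_e_simps)
  ultimately show ?thesis using affdiags_iff[of N "fst (diag_e N j)" 0] N by simp
qed

text \<open>Rotation by \<open>1 - j\<close> takes \<open>e_j\<close> to \<open>e_1\<close>. The
  product on the right is a renumbering of \<open>e_j\<close>; the one on the left is a surgery
  product whose second factor happens to be the translation.\<close>

lemma diag_e_conjugate:
  assumes N: "N \<ge> 2"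
  shows "glue N (diag_e N 1) (diag_shift (1 - j)) = glue N (diag_shift (1 - j)) (diag_e N j)"
    and "contractible_loops N (diag_e N 1) (diag_shift (1 - j)) = 0"
    and "contractible_loops N (diag_shift (1 - j)) (diag_e N j) = 0"
proof -
  let ?s = "1 - j"
  interpret e: periodic_matching N "fst (diag_e N j)" using diag_e_periodic[OF N] .
  define \<tau> where "\<tau> p = rotate_outer ?s (fst (diag_e N j) (rotate_outer (- ?s) p))" for p
  have d: "diag_e N j = (fst (diag_e N j), 0)" "diag_shift ?s = (fst (diag_shift ?s), 0)"
    by (simp_all add: prod_eq_iff diag_e_simps)
  have 1: "glue N (diag_shift ?s) (diag_e N j) = (\<tau>, 0)" "contractible_loops N (diag_shift ?s) (diag_e N j) = 0"
    by (subst d(1), subst glue_shift; simp add: \<tau>_def fun_eq_iff)+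
  have rot: "rotate_outer t (translate u p) = translate u (rotate_outer t p)" for t u p
    by (cases p; cases "fst p") (simp_all add: algebra_simps)
  have per: "periodic_matching N \<tau>"
  proof unfold_locales
    show "\<tau> (\<tau> p) = p" for p by (simp add: \<tau>_def)
    show "\<tau> p \<noteq> p" for p
    proof
      assume "\<tau> p = p"
      then have "rotate_outer (- ?s) (\<tau> p) = rotate_outer (- ?s) p" by simp
      then show False by (simp add: \<tau>_def)
    qed
    show "\<tau> (x, i + int N) = (fst (\<tau> (x, i)), snd (\<tau> (x, i)) + int N)" for x i
    proof -
      have "\<tau> (translate (int N) (x, i)) = translate (int N) (\<tau> (x, i))"
        unfolding \<tau>_def by (simp only: rot e.periodic dvd_refl)
      then show ?thesis by (simp add: translate_def)
    qed
  qed (use N in simp)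
  have per': "periodic_matching N (fst (diag_shift ?s))"
    using diag_shift_affdiags[of N ?s] affdiags_iff[of N "fst (diag_shift ?s)" 0] N d(2)
    by (simp add: affine_matching_def)
  have arc: "\<tau> (Outer, 1) = (Outer, 1 + 1)" by (simp add: \<tau>_def diag_e_simps)
  have same: "fst (diag_shift ?s) r = \<tau> r"
    if "r \<notin> arc_ends N 1" "fst (diag_shift ?s) r \<notin> arc_ends N 1" for r
    using that by (cases r; cases "fst r") (simp_all add: \<tau>_def diag_e_simps algebra_simps)
  have ends: "fst (diag_shift ?s) (Outer, 1) \<notin> arc_ends N 1" "fst (diag_shift ?s) (Outer, 1 + 1) \<notin> arc_ends N 1"
    by simp_all
  have q: "fst (diag_shift ?s) (Outer, 1 + 1) = \<tau> (fst (diag_shift ?s) (Outer, 1))"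
    by (simp add: \<tau>_def diag_e_simps)
  note g = e_product.glue_e[OF e_productI[OF per per' N arc] same ends q, where k = 0]
  have "glue N (diag_e N 1) (diag_shift ?s) = (\<tau>, 0)" "contractible_loops N (diag_e N 1) (diag_shift ?s) = 0"
    using g by (subst d(2); simp)+
  then show "glue N (diag_e N 1) (diag_shift ?s) = glue N (diag_shift ?s) (diag_e N j)"
    "contractible_loops N (diag_e N 1) (diag_shift ?s) = 0" "contractible_loops N (diag_shift ?s) (diag_e N j) = 0"
    using 1 by simp_all
qed

text \<open>\<open>e_1\<close> generates together with \<open>u\<close> and its inverse because
  every \<open>e_j\<close>, \<open>e_0\<close> included, equals \<open>u^{j-1} e_1 u^{1-j}\<close>.
  In the application \<open>S\<close> is the set on which two homomorphisms agree.\<close>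

lemma aTL_generated:
  assumes N: "N \<ge> 1" and "ring (aTL m N)"
    and add: "\<And>x y. x \<in> S \<Longrightarrow> y \<in> S \<Longrightarrow> x + y \<in> S"
    and scale: "\<And>c x. x \<in> S \<Longrightarrow> pm_scale c x \<in> S"
    and mult: "\<And>x y. x \<in> S \<Longrightarrow> y \<in> S \<Longrightarrow> x \<otimes>\<^bsub>aTL m N\<^esub> y \<in> S"
    and one: "tl_one \<in> S" and u: "tl_u \<in> S" and u_inv: "basis (diag_shift (- 1)) \<in> S"
    and e1: "N \<ge> 2 \<Longrightarrow> tl_e N 1 \<in> S"
  shows "carrier (aTL m N) \<subseteq> S"
proof
  interpret ring "aTL m N" by fact
  have glue: "basis (glue N a b) \<in> S" if "basis a \<in> S" "basis b \<in> S" "contractible_loops N a b = 0" for a b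
    using mult[OF that(1,2)] that(3) by (simp add: aTL_mult_basis)
  have shift1: "basis (diag_shift t) \<in> S" if "t = 1 \<or> t = - 1" for t
    using that u u_inv diag_shift_1 by auto
  have shift: "basis (diag_shift t) \<in> S" for t
  proof (induction t rule: int_induct[where k = 0])
    case base
    then show ?case using one by (simp add: diag_shift_0)
  next
    case (step1 t)
    then show ?case using glue[OF shift1[of 1] step1(2)] by (simp add: diag_shift_mult contractible_loops_shift add.commute)
  next
    case (step2 t)
    then show ?case using glue[OF shift1[of "- 1"] step2(2)] by (simp add: diag_shift_mult contractible_loops_shift)
  qed
  have e: "tl_e N j \<in> S" if N2: "N \<ge> 2" for j
  proof -
    have car: "basis (diag_shift t) \<in> carrier (aTL m N)" "tl_e N j \<in> carrier (aTL m N)" for t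
      using N N2 by (simp_all add: aTL_basis_carrier diag_shift_affdiags diag_e_affdiags)
    have "basis (diag_shift (j - 1)) \<otimes>\<^bsub>aTL m N\<^esub> basis (diag_shift (1 - j)) = tl_one"
      by (simp add: aTL_mult_basis contractible_loops_shift diag_shift_mult diag_shift_0)
    then have "tl_e N j = (basis (diag_shift (j - 1)) \<otimes>\<^bsub>aTL m N\<^esub> basis (diag_shift (1 - j))) \<otimes>\<^bsub>aTL m N\<^esub> tl_e N j"
      using car l_one by simp
    also have "\<dots> = basis (diag_shift (j - 1)) \<otimes>\<^bsub>aTL m N\<^esub> (basis (diag_shift (1 - j)) \<otimes>\<^bsub>aTL m N\<^esub> tl_e N j)"
      using car by (simp add: m_assoc)
    also have "basis (diag_shift (1 - j)) \<otimes>\<^bsub>aTL m N\<^esub> tl_e N j = tl_e N 1 \<otimes>\<^bsub>aTL m N\<^esub> basis (diag_shift (1 - j))"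
      using diag_e_conjugate[OF N2, of j] by (simp add: aTL_mult_basis)
    finally show ?thesis using mult shift e1[OF N2] by metis
  qed
  have diag: "basis d \<in> S" if "d \<in> generated N" for d
    using that
  proof induction
    case one
    then show ?case using assms(6) by simp
  next
    case (shift d s)
    then show ?case using glue shift1 shift by blast
  next
    case (e d j)
    then show ?case using glue \<open>\<And>j. N \<ge> 2 \<Longrightarrow> tl_e N j \<in> S\<close> by blast
  qed
  fix x assume "x \<in> carrier (aTL m N)"
  then have keys: "Poly_Mapping.keys x \<subseteq> affdiags N" by (simp add: aTL_def carrier_basis_algebra)
  show "x \<in> S"
  proof (rule pm_induct_keys[OF keys])
    show "0 \<in> S" using scale[OF one, of 0] by simp
    show "pm_scale c (basis b) \<in> S" if "b \<in> affdiags N" for b c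
      using scale diag affdiags_generated[OF N] that by blast
  qed (rule add)
qed

section \<open>The embeddings\<close>

definition alg_hom :: "complex \<Rightarrow> nat \<Rightarrow> nat \<Rightarrow> ((affdiag \<Rightarrow>\<^sub>0 complex) \<Rightarrow> (affdiag \<Rightarrow>\<^sub>0 complex)) \<Rightarrow> bool" where
  "alg_hom m K M f \<longleftrightarrow> f \<in> carrier (aTL m K) \<rightarrow> carrier (aTL m M) \<and>
     (\<forall>x\<in>carrier (aTL m K). \<forall>y\<in>carrier (aTL m K). f (x + y) = f x + f y) \<and>
     (\<forall>c. \<forall>x\<in>carrier (aTL m K). f (pm_scale c x) = pm_scale c (f x)) \<and>
     (\<forall>x\<in>carrier (aTL m K). \<forall>y\<in>carrier (aTL m K). f (x \<otimes>\<^bsub>aTL m K\<^esub> y) = f x \<otimes>\<^bsub>aTL m M\<^esub> f y) \<and>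
     f tl_one = tl_one"

lemma alg_hom_compose: "alg_hom m K L f \<Longrightarrow> alg_hom m L M g \<Longrightarrow> alg_hom m K M (\<lambda>x. g (f x))"
  unfolding alg_hom_def by (auto simp: Pi_iff)

lemma tl_one_carrier: "N \<ge> 1 \<Longrightarrow> tl_one \<in> carrier (aTL m N)"
  and tl_u_carrier: "N \<ge> 1 \<Longrightarrow> tl_u \<in> carrier (aTL m N)"
  and tl_u_inv_carrier: "N \<ge> 1 \<Longrightarrow> basis (diag_shift (- 1)) \<in> carrier (aTL m N)"
  and tl_e_carrier: "N \<ge> 2 \<Longrightarrow> tl_e N j \<in> carrier (aTL m N)"
  using diag_shift_affdiags[of N 0] diag_shift_affdiags[of N 1] diag_shift_affdiags[of N "- 1"] diag_e_affdiags[of N j]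
  by (simp_all add: aTL_basis_carrier diag_shift_0 diag_shift_1)

lemma tl_u_inv: "tl_u \<otimes>\<^bsub>aTL m N\<^esub> basis (diag_shift (- 1)) = tl_one"
  "basis (diag_shift (- 1)) \<otimes>\<^bsub>aTL m N\<^esub> tl_u = tl_one"
  by (simp_all add: diag_shift_1[symmetric] aTL_mult_basis contractible_loops_shift diag_shift_mult diag_shift_0)

lemma tl_one_mult_one: "tl_one \<otimes>\<^bsub>aTL m N\<^esub> tl_one = tl_one"
  by (simp add: diag_shift_0[symmetric] aTL_mult_basis contractible_loops_shift diag_shift_mult)

text \<open>Agreement on \<open>u\<close> passes to its inverse by uniqueness of inverses, and the
  elements on which two homomorphisms agree form a subalgebra. The range of \<open>j\<close> is the
  one in which an embedding takes \<open>e_j\<close> to a single generator.\<close>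

lemma alg_hom_eqI:
  assumes K: "K \<ge> 1" and "ring (aTL m K)" and "ring (aTL m M)" and f: "alg_hom m K M f" and g: "alg_hom m K M g"
    and u: "f tl_u = g tl_u" and e: "\<And>j. 1 \<le> j \<Longrightarrow> j \<le> int K - 1 \<Longrightarrow> f (tl_e K j) = g (tl_e K j)"
    and x: "x \<in> carrier (aTL m K)"
  shows "f x = g x"
proof -
  interpret K: ring "aTL m K" by fact
  interpret M: ring "aTL m M" by fact
  let ?v = "basis (diag_shift (- 1))"
  let ?S = "{x \<in> carrier (aTL m K). f x = g x}"
  have car: "tl_u \<in> carrier (aTL m K)" "?v \<in> carrier (aTL m K)"
    using K by (simp_all add: tl_u_carrier tl_u_inv_carrier)
  have im: "f tl_u \<in> carrier (aTL m M)" "f ?v \<in> carrier (aTL m M)" "g ?v \<in> carrier (aTL m M)"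
    using f g car by (auto simp: alg_hom_def)
  have mult: "h x \<otimes>\<^bsub>aTL m M\<^esub> h y = h (x \<otimes>\<^bsub>aTL m K\<^esub> y)" "h tl_one = tl_one"
    if "alg_hom m K M h" "x \<in> carrier (aTL m K)" "y \<in> carrier (aTL m K)" for h x y
    using that by (simp_all add: alg_hom_def)
  have "f ?v \<otimes>\<^bsub>aTL m M\<^esub> f tl_u = tl_one" using mult[OF f car(2,1)] by (simp add: tl_u_inv)
  moreover have "f tl_u \<otimes>\<^bsub>aTL m M\<^esub> g ?v = tl_one" unfolding u using mult[OF g car] by (simp add: tl_u_inv)
  ultimately have v: "f ?v = g ?v"
    using M.m_assoc[OF im(2,1,3)] M.r_one[OF im(2)] M.l_one[OF im(3)] by simp
  have "carrier (aTL m K) \<subseteq> ?S"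
  proof (rule aTL_generated[OF K K.ring_axioms])
    show "x \<otimes>\<^bsub>aTL m K\<^esub> y \<in> ?S" if "x \<in> ?S" "y \<in> ?S" for x y
      using that f g by (auto simp: alg_hom_def)
    show "x + y \<in> ?S" if "x \<in> ?S" "y \<in> ?S" for x y
      using that f g by (auto simp: alg_hom_def aTL_closed)
    show "pm_scale c x \<in> ?S" if "x \<in> ?S" for c x
      using that f g by (auto simp: alg_hom_def aTL_closed)
    show "tl_one \<in> ?S" using f g K by (auto simp: alg_hom_def tl_one_carrier)
    show "tl_e K 1 \<in> ?S" if "K \<ge> 2" using e[of 1] that by (simp add: tl_e_carrier)
  qed (use u v car in auto)
  then show ?thesis using x by auto
qed

lemma tl_prod_simps [simp]: "tl_prod m N [] = tl_one" "tl_prod m N (x # xs) = x \<otimes>\<^bsub>aTL m N\<^esub> tl_prod m N xs"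
  by (simp_all add: tl_prod_def)

lemma tl_prod_carrier:
  assumes "ring (aTL m N)" "set xs \<subseteq> carrier (aTL m N)"
  shows "tl_prod m N xs \<in> carrier (aTL m N)"
proof -
  interpret ring "aTL m N" by fact
  show ?thesis using assms(2) by (induction xs) (use one_closed in auto)
qed

lemma tl_prod_append:
  assumes "ring (aTL m N)" "set xs \<subseteq> carrier (aTL m N)" "set ys \<subseteq> carrier (aTL m N)"
  shows "tl_prod m N (xs @ ys) = tl_prod m N xs \<otimes>\<^bsub>aTL m N\<^esub> tl_prod m N ys"
proof -
  interpret ring "aTL m N" by fact
  have ys: "tl_prod m N ys \<in> carrier (aTL m N)" using tl_prod_carrier assms by blast
  show ?thesis using assms(2)
  proof (induction xs)
    case Nil
    then show ?case using ys l_one by simp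
  next
    case (Cons x xs)
    then show ?case using ys tl_prod_carrier[OF assms(1), of xs] by (simp add: m_assoc)
  qed
qed

lemma alg_hom_tl_prod:
  assumes "ring (aTL m K)" "alg_hom m K M f" "set xs \<subseteq> carrier (aTL m K)"
  shows "f (tl_prod m K xs) = tl_prod m M (map f xs)"
  using assms(3)
proof (induction xs)
  case Nil
  then show ?case using assms(2) by (simp add: alg_hom_def)
next
  case (Cons x xs)
  then show ?case using assms(2) tl_prod_carrier[OF assms(1), of xs] by (simp add: alg_hom_def)
qed

lemma tl_g_carrier: "N \<ge> 2 \<Longrightarrow> tl_g s N j \<in> carrier (aTL m N)"
  and tl_g_inv_carrier: "N \<ge> 2 \<Longrightarrow> tl_g_inv s N j \<in> carrier (aTL m N)"
proof -
  assume N: "N \<ge> 2"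
  have minus: "x - y = x + pm_scale (- 1) y" for x y :: "affdiag \<Rightarrow>\<^sub>0 complex" by simp
  show "tl_g s N j \<in> carrier (aTL m N)" "tl_g_inv s N j \<in> carrier (aTL m N)"
    unfolding tl_g_def tl_g_inv_def minus using N tl_one_carrier[of N] tl_e_carrier[of N]
    by (intro aTL_closed; simp)+
qed

lemma alg_hom_minus:
  assumes "alg_hom m K M f" "x \<in> carrier (aTL m K)" "y \<in> carrier (aTL m K)"
  shows "f (x - y) = f x - f y"
proof -
  have "f (x + pm_scale (- 1) y) = f x + pm_scale (- 1) (f y)"
    using assms aTL_closed(2)[OF assms(3), of "- 1"] unfolding alg_hom_def by metis
  then show ?thesis by simp
qed

lemma alg_hom_tl_g:
  assumes f: "alg_hom m K M f" and K: "K \<ge> 2" and e: "f (tl_e K j) = tl_e M j'"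
  shows "f (tl_g s K j) = tl_g s M j'" "f (tl_g_inv s K j) = tl_g_inv s M j'"
proof -
  have one: "tl_one \<in> carrier (aTL m K)" "f tl_one = tl_one"
    using K f by (simp_all add: tl_one_carrier alg_hom_def)
  have car: "tl_e K j \<in> carrier (aTL m K)" using K by (rule tl_e_carrier)
  have sc: "f (pm_scale c x) = pm_scale c (f x)" if "x \<in> carrier (aTL m K)" for c x
    using f that by (simp add: alg_hom_def)
  have closed: "pm_scale c x - pm_scale d y \<in> carrier (aTL m K)"
    if "x \<in> carrier (aTL m K)" "y \<in> carrier (aTL m K)" for c d x y
  proof -
    have "pm_scale c x + pm_scale (- d) y \<in> carrier (aTL m K)" using that by (intro aTL_closed)
    then show ?thesis by simp
  qed
  show "f (tl_g s K j) = tl_g s M j'" "f (tl_g_inv s K j) = tl_g_inv s M j'"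
    unfolding tl_g_def tl_g_inv_def
    by (simp_all add: sc closed one car alg_hom_minus[OF f] aTL_closed e del: pm.scale_minus_left)
qed

section \<open>A single embedding and its restrictions to the two tensor factors\<close>

locale fusion_data =
  fixes m s :: complex and eps :: embeddings
  assumes emb: "K \<ge> 1 \<Longrightarrow> L \<ge> 1 \<Longrightarrow> fusion_embedding m s K L (eps K L)"
begin

abbreviation "T \<equiv> aTL m"
abbreviation "E K L x y \<equiv> eps K L (pm_tensor x y)"

lemma eps_facts:
  assumes "K \<ge> 1" "L \<ge> 1"
  shows "ring_hom_ring (aTL_tensor m K L) (T (K + L)) (eps K L)"
    "\<And>c x. x \<in> carrier (aTL_tensor m K L) \<Longrightarrow> eps K L (pm_scale c x) = pm_scale c (eps K L x)"
    "\<And>j. 1 \<le> j \<Longrightarrow> j \<le> int K - 1 \<Longrightarrow> E K L (tl_e K j) tl_one = tl_e (K + L) j"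
    "\<And>k. 1 \<le> k \<Longrightarrow> k \<le> int L - 1 \<Longrightarrow> E K L tl_one (tl_e L k) = tl_e (K + L) (int K + k)"
    "E K L tl_u tl_one = tl_prod m (K + L) (tl_u # map (tl_g_inv s (K + L)) (rev [int K..int (K + L) - 1]))"
    "E K L tl_one tl_u = tl_prod m (K + L) (map (tl_g s (K + L)) (rev [1..int K]) @ [tl_u])"
  using emb[OF assms] unfolding fusion_embedding_def Let_def by auto

text \<open>The ring laws are part of \<open>ring_hom_ring\<close>. This algebra is the target of
  the embedding for the decomposition of \<open>N\<close> into \<open>N - 1\<close> and 1, both
  positive.\<close>

lemma ring_T: "N \<ge> 2 \<Longrightarrow> ring (T N)"
proof -
  assume "N \<ge> 2"
  then have "ring_hom_ring (aTL_tensor m (N - 1) 1) (T (N - 1 + 1)) (eps (N - 1) 1)"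
    by (intro eps_facts) auto
  then show ?thesis using \<open>N \<ge> 2\<close> by (simp add: ring_hom_ring_def)
qed

lemma E_closed:
  assumes "K \<ge> 1" "L \<ge> 1" "x \<in> carrier (T K)" "y \<in> carrier (T L)"
  shows "E K L x y \<in> carrier (T (K + L))"
proof -
  interpret ring_hom_ring "aTL_tensor m K L" "T (K + L)" "eps K L" using eps_facts(1)[OF assms(1,2)] .
  show ?thesis using assms by (simp add: pm_tensor_carrier)
qed

lemma eps_add:
  assumes "K \<ge> 1" "L \<ge> 1" "v \<in> carrier (aTL_tensor m K L)" "w \<in> carrier (aTL_tensor m K L)"
  shows "eps K L (v + w) = eps K L v + eps K L w"
proof -
  interpret h: ring_hom_ring "aTL_tensor m K L" "T (K + L)" "eps K L" using eps_facts(1)[OF assms(1,2)] .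
  show ?thesis using h.hom_add[OF assms(3,4)] by (simp add: aTL_tensor_def aTL_def)
qed

lemma E_add_left:
  assumes "K \<ge> 1" "L \<ge> 1" "x \<in> carrier (T K)" "x' \<in> carrier (T K)" "y \<in> carrier (T L)"
  shows "E K L (x + x') y = E K L x y + E K L x' y"
  using assms by (simp add: pm_tensor_linear pm_tensor_carrier eps_add)

lemma E_add_right:
  assumes "K \<ge> 1" "L \<ge> 1" "x \<in> carrier (T K)" "y \<in> carrier (T L)" "y' \<in> carrier (T L)"
  shows "E K L x (y + y') = E K L x y + E K L x y'"
  using assms by (simp add: pm_tensor_linear pm_tensor_carrier eps_add)

lemma E_scale:
  assumes "K \<ge> 1" "L \<ge> 1" "x \<in> carrier (T K)" "y \<in> carrier (T L)"
  shows "E K L (pm_scale c x) y = pm_scale c (E K L x y)" "E K L x (pm_scale c y) = pm_scale c (E K L x y)"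
  using assms by (simp_all add: pm_tensor_linear pm_tensor_carrier eps_facts(2))

lemma E_mult:
  assumes "K \<ge> 1" "L \<ge> 1" "x \<in> carrier (T K)" "x' \<in> carrier (T K)" "y \<in> carrier (T L)" "y' \<in> carrier (T L)"
  shows "E K L (x \<otimes>\<^bsub>T K\<^esub> x') (y \<otimes>\<^bsub>T L\<^esub> y') = E K L x y \<otimes>\<^bsub>T (K + L)\<^esub> E K L x' y'"
proof -
  interpret h: ring_hom_ring "aTL_tensor m K L" "T (K + L)" "eps K L" using eps_facts(1)[OF assms(1,2)] .
  show ?thesis using h.hom_mult[of "pm_tensor x y" "pm_tensor x' y'"] assms
    by (simp add: pm_tensor_carrier pm_tensor_mult)
qed

lemma E_one:
  assumes "K \<ge> 1" "L \<ge> 1"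
  shows "E K L tl_one tl_one = tl_one"
proof -
  interpret h: ring_hom_ring "aTL_tensor m K L" "T (K + L)" "eps K L" using eps_facts(1)[OF assms(1,2)] .
  show ?thesis using h.hom_one by (simp add: aTL_tensor_def aTL_def pm_tensor_basis)
qed

lemma E_hom:
  assumes "K \<ge> 1" "L \<ge> 1"
  shows "alg_hom m K (K + L) (\<lambda>x. E K L x tl_one)" "alg_hom m L (K + L) (E K L tl_one)"
  using assms tl_one_carrier[OF assms(1)] tl_one_carrier[OF assms(2)] tl_one_mult_one
    E_mult[OF assms, of _ _ tl_one tl_one] E_mult[OF assms, of tl_one tl_one]
  by (auto simp: alg_hom_def E_closed E_add_left E_add_right E_scale E_one)

lemma map_plus_upto: "map ((+) a) [i..j] = [a + i..a + j]" for a i j :: int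
  by (rule nth_equalityI) (simp_all add: nth_upto)

text \<open>A further homomorphism that shifts the index of every \<open>e_j\<close> by
  \<open>d\<close> shifts the \<open>g_j\<close> alike, so only the image of \<open>u\<close> stays
  open in the word. The shift is 0 for the left factor of an embedding and the size of the first
  block for the right factor.\<close>

lemma hom_E_u:
  assumes K: "K \<ge> 1" and L: "L \<ge> 1" and M: "M \<ge> 2" and f: "alg_hom m (K + L) M f"
    and e: "\<And>j. 1 \<le> j \<Longrightarrow> j \<le> int (K + L) - 1 \<Longrightarrow> f (tl_e (K + L) j) = tl_e M (d + j)"
  shows "f (E K L tl_u tl_one) =
      tl_prod m M (f tl_u # map (tl_g_inv s M) (rev [d + int K..d + (int (K + L) - 1)]))"
    and "f (E K L tl_one tl_u) = tl_prod m M (map (tl_g s M) (rev [d + 1..d + int K]) @ [f tl_u])"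
proof -
  have KL: "K + L \<ge> 1" "K + L \<ge> 2" using K L by linarith+
  have g: "f (tl_g s (K + L) j) = tl_g s M (d + j)" "f (tl_g_inv s (K + L) j) = tl_g_inv s M (d + j)"
    if "1 \<le> j" "j \<le> int (K + L) - 1" for j
    using alg_hom_tl_g[OF f KL(2) e[OF that]] by auto
  note hom = alg_hom_tl_prod[OF ring_T[OF KL(2)] f]
  have "map f (map (tl_g_inv s (K + L)) (rev [int K..int (K + L) - 1])) =
      map (tl_g_inv s M) (rev [d + int K..d + (int (K + L) - 1)])"
    unfolding map_plus_upto[symmetric] using g(2) K by (simp add: rev_map)
  then show "f (E K L tl_u tl_one) =
      tl_prod m M (f tl_u # map (tl_g_inv s M) (rev [d + int K..d + (int (K + L) - 1)]))"
    unfolding eps_facts(5)[OF K L] using hom[of "tl_u # map (tl_g_inv s (K + L)) (rev [int K..int (K + L) - 1])"]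
      KL tl_u_carrier tl_g_inv_carrier by (simp del: tl_prod_simps add: image_subset_iff)
  have "map f (map (tl_g s (K + L)) (rev [1..int K])) = map (tl_g s M) (rev [d + 1..d + int K])"
    unfolding map_plus_upto[symmetric] using g(1) L by (simp add: rev_map)
  then show "f (E K L tl_one tl_u) = tl_prod m M (map (tl_g s M) (rev [d + 1..d + int K]) @ [f tl_u])"
    unfolding eps_facts(6)[OF K L] using hom[of "map (tl_g s (K + L)) (rev [1..int K]) @ [tl_u]"]
      KL tl_u_carrier tl_g_carrier by (simp del: tl_prod_simps add: image_subset_iff)
qed

section \<open>Associativity of the embeddings on each of three factors\<close>

context
  fixes N1 N2 N3 N :: nat
  assumes Ns: "N1 \<ge> 1" "N2 \<ge> 1" "N3 \<ge> 1" and N: "N = N1 + N2 + N3"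
begin

lemma sum_bounds: "N1 + N2 \<ge> 1" "N2 + N3 \<ge> 1" "N \<ge> 2"
  using Ns N by linarith+

lemma hom_left: "alg_hom m (N1 + N2) N (\<lambda>x. E (N1 + N2) N3 x tl_one)"
  and hom_right: "alg_hom m (N2 + N3) N (E N1 (N2 + N3) tl_one)"
  using E_hom(1)[OF sum_bounds(1) Ns(3)] E_hom(2)[OF Ns(1) sum_bounds(2)] by (simp_all add: N add.assoc)

lemma left_e: "1 \<le> j \<Longrightarrow> j \<le> int (N1 + N2) - 1 \<Longrightarrow> E (N1 + N2) N3 (tl_e (N1 + N2) j) tl_one = tl_e N j"
  and right_e: "1 \<le> j \<Longrightarrow> j \<le> int (N2 + N3) - 1 \<Longrightarrow>
    E N1 (N2 + N3) tl_one (tl_e (N2 + N3) j) = tl_e N (int N1 + j)"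
  using eps_facts(3)[OF sum_bounds(1) Ns(3)] eps_facts(4)[OF Ns(1) sum_bounds(2)] by (simp_all add: N add.assoc)

lemma left_u: "E (N1 + N2) N3 tl_u tl_one = tl_prod m N (tl_u # map (tl_g_inv s N) (rev [int (N1 + N2)..int N - 1]))"
  and right_u: "E N1 (N2 + N3) tl_one tl_u = tl_prod m N (map (tl_g s N) (rev [1..int N1]) @ [tl_u])"
  using eps_facts(5)[OF sum_bounds(1) Ns(3)] eps_facts(6)[OF Ns(1) sum_bounds(2)] by (simp_all only: N add.assoc)

lemma generator_carrier: "tl_g s N ` I \<subseteq> carrier (T N)" "tl_g_inv s N ` I \<subseteq> carrier (T N)" "tl_u \<in> carrier (T N)"
  using sum_bounds(3) tl_g_carrier tl_g_inv_carrier tl_u_carrier by auto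

lemma tl_prod_flatten: 
  assumes "set xs \<subseteq> carrier (T N)" "set ys \<subseteq> carrier (T N)"
  shows "tl_prod m N (tl_prod m N xs # ys) = tl_prod m N (xs @ ys)"
    "tl_prod m N (xs @ [tl_prod m N ys]) = tl_prod m N (xs @ ys)"
proof -
  interpret ring "T N" by (rule ring_T[OF sum_bounds(3)])
  have car: "tl_prod m N ys \<in> carrier (T N)" using tl_prod_carrier[OF ring_axioms assms(2)] .
  show "tl_prod m N (tl_prod m N xs # ys) = tl_prod m N (xs @ ys)"
    "tl_prod m N (xs @ [tl_prod m N ys]) = tl_prod m N (xs @ ys)"
    using tl_prod_append[OF ring_axioms assms] tl_prod_append[OF ring_axioms assms(1), of "[tl_prod m N ys]"]
      car r_one[OF car] by simp_all
qed

text \<open>Embedding twice on the left gives \<open>u g_{N-1}^{-1} ... g_{N1+N2}^{-1}\<close>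
  followed by \<open>g_{N1+N2-1}^{-1} ... g_{N1}^{-1}\<close>, and this is the single descending
  word for a second block of size \<open>N2 + N3\<close>.\<close>

lemma E_assoc1:
  assumes "ring (T N1)" "x \<in> carrier (T N1)"
  shows "E (N1 + N2) N3 (E N1 N2 x tl_one) tl_one = E N1 (N2 + N3) x tl_one"
proof (rule alg_hom_eqI[OF Ns(1) assms(1) ring_T[OF sum_bounds(3)] _ _ _ _ assms(2)])
  show "alg_hom m N1 N (\<lambda>x. E (N1 + N2) N3 (E N1 N2 x tl_one) tl_one)"
    by (rule alg_hom_compose[OF E_hom(1)[OF Ns(1,2)] hom_left])
  show "alg_hom m N1 N (\<lambda>x. E N1 (N2 + N3) x tl_one)"
    using E_hom(1)[OF Ns(1) sum_bounds(2)] by (simp add: N add.assoc)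
  show "E (N1 + N2) N3 (E N1 N2 (tl_e N1 j) tl_one) tl_one = E N1 (N2 + N3) (tl_e N1 j) tl_one"
    if "1 \<le> j" "j \<le> int N1 - 1" for j
    using that left_e[of j] eps_facts(3)[OF Ns(1,2) that] eps_facts(3)[OF Ns(1) sum_bounds(2) that]
    by (simp add: N add.assoc)
  let ?w = "\<lambda>i j. map (tl_g_inv s N) (rev [i..j])"
  have "E (N1 + N2) N3 (E N1 N2 tl_u tl_one) tl_one =
      tl_prod m N ((tl_u # ?w (int (N1 + N2)) (int N - 1)) @ ?w (int N1) (int (N1 + N2) - 1))"
    using hom_E_u(1)[OF Ns(1,2) sum_bounds(3) hom_left, of 0] left_e
      tl_prod_flatten(1)[of "tl_u # ?w (int (N1 + N2)) (int N - 1)" "?w (int N1) (int (N1 + N2) - 1)"] generator_carrier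
    by (simp add: left_u del: tl_prod_simps)
  also have "(tl_u # ?w (int (N1 + N2)) (int N - 1)) @ ?w (int N1) (int (N1 + N2) - 1) = tl_u # ?w (int N1) (int N - 1)"
    using upto_split2[of "int N1" "int (N1 + N2) - 1" "int N - 1"] Ns(2)
    by (simp add: N map_append[symmetric] rev_append[symmetric] del: map_append rev_append)
  also have "tl_prod m N \<dots> = E N1 (N2 + N3) tl_u tl_one"
    using eps_facts(5)[OF Ns(1) sum_bounds(2)] by (simp add: N add.assoc)
  finally show "E (N1 + N2) N3 (E N1 N2 tl_u tl_one) tl_one = E N1 (N2 + N3) tl_u tl_one" .
qed

text \<open>Embedding twice on the right gives \<open>g_{N1+N2} ... g_{N1+1}\<close> followed by
  \<open>g_{N1} ... g_1 u\<close>, and this is the single descending word for a first block of size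
  \<open>N1 + N2\<close>.\<close>

lemma E_assoc3:
  assumes "ring (T N3)" "x \<in> carrier (T N3)"
  shows "E (N1 + N2) N3 tl_one x = E N1 (N2 + N3) tl_one (E N2 N3 tl_one x)"
proof (rule alg_hom_eqI[OF Ns(3) assms(1) ring_T[OF sum_bounds(3)] _ _ _ _ assms(2)])
  show "alg_hom m N3 N (\<lambda>x. E N1 (N2 + N3) tl_one (E N2 N3 tl_one x))"
    by (rule alg_hom_compose[OF E_hom(2)[OF Ns(2,3)] hom_right])
  show "alg_hom m N3 N (E (N1 + N2) N3 tl_one)"
    using E_hom(2)[OF sum_bounds(1) Ns(3)] by (simp add: N)
  show "E (N1 + N2) N3 tl_one (tl_e N3 j) = E N1 (N2 + N3) tl_one (E N2 N3 tl_one (tl_e N3 j))"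
    if "1 \<le> j" "j \<le> int N3 - 1" for j
    using that right_e[of "int N2 + j"] eps_facts(4)[OF Ns(2,3) that] eps_facts(4)[OF sum_bounds(1) Ns(3) that]
    by (simp add: N add.assoc)
  let ?w = "\<lambda>i j. map (tl_g s N) (rev [i..j])"
  have "E N1 (N2 + N3) tl_one (E N2 N3 tl_one tl_u) =
      tl_prod m N (?w (int N1 + 1) (int N1 + int N2) @ (?w 1 (int N1) @ [tl_u]))"
    using hom_E_u(2)[OF Ns(2,3) sum_bounds(3) hom_right right_e]
      tl_prod_flatten(2)[of "?w (int N1 + 1) (int N1 + int N2)" "?w 1 (int N1) @ [tl_u]"] generator_carrier
    by (simp add: right_u del: tl_prod_simps)
  also have "?w (int N1 + 1) (int N1 + int N2) @ (?w 1 (int N1) @ [tl_u]) = ?w 1 (int (N1 + N2)) @ [tl_u]"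
    using upto_split2[of 1 "int N1" "int N1 + int N2"] Ns(1)
    by (simp add: map_append[symmetric] rev_append[symmetric] del: map_append rev_append)
  also have "tl_prod m N \<dots> = E (N1 + N2) N3 tl_one tl_u"
    using eps_facts(6)[OF sum_bounds(1) Ns(3)] by (simp only: N)
  finally show "E (N1 + N2) N3 tl_one tl_u = E N1 (N2 + N3) tl_one (E N2 N3 tl_one tl_u)" by (rule sym)
qed

text \<open>Both sides become \<open>g_{N1} ... g_1 u g_{N-1}^{-1} ... g_{N1+N2}^{-1}\<close>: the
  right embedding writes before \<open>u\<close>, the left one after it, so their order does not
  matter.\<close>

lemma E_assoc2:
  assumes "ring (T N2)" "x \<in> carrier (T N2)"
  shows "E (N1 + N2) N3 (E N1 N2 tl_one x) tl_one = E N1 (N2 + N3) tl_one (E N2 N3 x tl_one)"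
proof (rule alg_hom_eqI[OF Ns(2) assms(1) ring_T[OF sum_bounds(3)] _ _ _ _ assms(2)])
  show "alg_hom m N2 N (\<lambda>x. E N1 (N2 + N3) tl_one (E N2 N3 x tl_one))"
    by (rule alg_hom_compose[OF E_hom(1)[OF Ns(2,3)] hom_right])
  show "alg_hom m N2 N (\<lambda>x. E (N1 + N2) N3 (E N1 N2 tl_one x) tl_one)"
    by (rule alg_hom_compose[OF E_hom(2)[OF Ns(1,2)] hom_left])
  show "E (N1 + N2) N3 (E N1 N2 tl_one (tl_e N2 j)) tl_one = E N1 (N2 + N3) tl_one (E N2 N3 (tl_e N2 j) tl_one)"
    if "1 \<le> j" "j \<le> int N2 - 1" for j
    using that right_e[of j] left_e[of "int N1 + j"] eps_facts(4)[OF Ns(1,2) that] eps_facts(3)[OF Ns(2,3) that]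
    by simp
  let ?G = "map (tl_g s N) (rev [1..int N1])"
  let ?P = "map (tl_g_inv s N) (rev [int (N1 + N2)..int N - 1])"
  have "E (N1 + N2) N3 (E N1 N2 tl_one tl_u) tl_one = tl_prod m N (?G @ (tl_u # ?P))"
    using hom_E_u(2)[OF Ns(1,2) sum_bounds(3) hom_left, of 0] left_e tl_prod_flatten(2)[of ?G "tl_u # ?P"] generator_carrier
    by (simp add: left_u del: tl_prod_simps)
  moreover have "[int N1 + int N2..int N1 + (int (N2 + N3) - 1)] = [int (N1 + N2)..int N - 1]"
    by (simp add: N algebra_simps)
  then have "E N1 (N2 + N3) tl_one (E N2 N3 tl_u tl_one) = tl_prod m N ((?G @ [tl_u]) @ ?P)"
    using hom_E_u(1)[OF Ns(2,3) sum_bounds(3) hom_right right_e] tl_prod_flatten(1)[of "?G @ [tl_u]" ?P] generator_carrier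
    by (simp add: right_u del: tl_prod_simps)
  ultimately show "E (N1 + N2) N3 (E N1 N2 tl_one tl_u) tl_one = E N1 (N2 + N3) tl_one (E N2 N3 tl_u tl_one)"
    by simp
qed

end

lemma E_split:
  assumes "K \<ge> 1" "L \<ge> 1" "ring (T K)" "ring (T L)" "x \<in> carrier (T K)" "y \<in> carrier (T L)"
  shows "E K L x y = E K L x tl_one \<otimes>\<^bsub>T (K + L)\<^esub> E K L tl_one y"
    "E K L x y = E K L tl_one y \<otimes>\<^bsub>T (K + L)\<^esub> E K L x tl_one"
proof -
  interpret K: ring "T K" by fact
  interpret L: ring "T L" by fact
  show "E K L x y = E K L x tl_one \<otimes>\<^bsub>T (K + L)\<^esub> E K L tl_one y"
    "E K L x y = E K L tl_one y \<otimes>\<^bsub>T (K + L)\<^esub> E K L x tl_one"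
    using assms E_mult[OF assms(1,2), of x tl_one tl_one y] E_mult[OF assms(1,2), of tl_one x y tl_one]
      K.one_closed L.one_closed K.r_one K.l_one L.r_one L.l_one by simp_all
qed

lemma E_assoc:
  assumes N: "N1 \<ge> 1" "N2 \<ge> 1" "N3 \<ge> 1" and R: "ring (T N1)" "ring (T N2)" "ring (T N3)"
    and x: "x \<in> carrier (T N1)" and y: "y \<in> carrier (T N2)" and z: "z \<in> carrier (T N3)"
  shows "E (N1 + N2) N3 (E N1 N2 x y) z = E N1 (N2 + N3) x (E N2 N3 y z)"
proof -
  have N': "N1 + N2 \<ge> 1" "N2 + N3 \<ge> 1" "N1 + N2 \<ge> 2" "N2 + N3 \<ge> 2" "N1 + (N2 + N3) \<ge> 2" using N by linarith+
  note one = tl_one_carrier[where m = m]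
  interpret T: ring "T (N1 + (N2 + N3))" by (rule ring_T[OF N'(5)])
  let ?m = "\<lambda>a b. a \<otimes>\<^bsub>T (N1 + (N2 + N3))\<^esub> b"
  have x': "E N1 N2 x tl_one \<in> carrier (T (N1 + N2))" and y': "E N1 N2 tl_one y \<in> carrier (T (N1 + N2))"
    and y'': "E N2 N3 y tl_one \<in> carrier (T (N2 + N3))" and z'': "E N2 N3 tl_one z \<in> carrier (T (N2 + N3))"
    using N x y z one by (simp_all add: E_closed)
  have "E (N1 + N2) N3 (E N1 N2 x y) z = ?m (E (N1 + N2) N3 (E N1 N2 x y) tl_one) (E (N1 + N2) N3 tl_one z)"
    using E_split(1)[OF N'(1) N(3) ring_T[OF N'(3)] R(3) _ z, of "E N1 N2 x y"] E_closed[OF N(1,2) x y]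
    by (simp add: add.assoc)
  also have "E (N1 + N2) N3 (E N1 N2 x y) tl_one =
      ?m (E (N1 + N2) N3 (E N1 N2 x tl_one) tl_one) (E (N1 + N2) N3 (E N1 N2 tl_one y) tl_one)"
    using E_split(1)[OF N(1,2) R(1,2) x y] E_mult[OF N'(1) N(3) x' y' one[OF N(3)] one[OF N(3)]]
    by (simp add: add.assoc tl_one_mult_one)
  also have "E (N1 + N2) N3 (E N1 N2 x tl_one) tl_one = E N1 (N2 + N3) x tl_one"
    by (rule E_assoc1[OF N refl R(1) x])
  also have "E (N1 + N2) N3 (E N1 N2 tl_one y) tl_one = E N1 (N2 + N3) tl_one (E N2 N3 y tl_one)"
    by (rule E_assoc2[OF N refl R(2) y])
  also have "E (N1 + N2) N3 tl_one z = E N1 (N2 + N3) tl_one (E N2 N3 tl_one z)"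
    by (rule E_assoc3[OF N refl R(3) z])
  also have "?m (?m (E N1 (N2 + N3) x tl_one) (E N1 (N2 + N3) tl_one (E N2 N3 y tl_one)))
      (E N1 (N2 + N3) tl_one (E N2 N3 tl_one z)) =
    ?m (E N1 (N2 + N3) x tl_one) (?m (E N1 (N2 + N3) tl_one (E N2 N3 y tl_one)) (E N1 (N2 + N3) tl_one (E N2 N3 tl_one z)))"
    using N N' x y'' z'' one by (intro T.m_assoc) (simp_all add: E_closed)
  also have "?m (E N1 (N2 + N3) tl_one (E N2 N3 y tl_one)) (E N1 (N2 + N3) tl_one (E N2 N3 tl_one z)) =
      E N1 (N2 + N3) tl_one (E N2 N3 y z)"
    using E_mult[OF N(1) N'(2) one[OF N(1)] one[OF N(1)] y'' z''] E_split(1)[OF N(2,3) R(2,3) y z]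
    by (simp add: tl_one_mult_one)
  also have "?m (E N1 (N2 + N3) x tl_one) (E N1 (N2 + N3) tl_one (E N2 N3 y z)) = E N1 (N2 + N3) x (E N2 N3 y z)"
    using E_split(1)[OF N(1) N'(2) R(1) ring_T[OF N'(4)] x, of "E N2 N3 y z"] E_closed[OF N(2,3) y z] by simp
  finally show ?thesis .
qed

end

section \<open>The fusion product as a module\<close>

text \<open>\<open>N\<close> is a parameter with an equation instead of the term
  \<open>K + L\<close>, so that differently bracketed sums of sizes in iterated products name the
  same algebra.\<close>

locale fusion_pair = fusion_data +
  fixes K L N :: nat and M1 :: "'a tlmod" and M2 :: "'b tlmod"
  assumes K: "K \<ge> 1" and L: "L \<ge> 1" and N: "N = K + L"
    and M1: "left_module (aTL m K) M1" and M2: "left_module (aTL m L) M2"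
begin

abbreviation "F \<equiv> fusion m eps K L M1 M2"
abbreviation "rels \<equiv> fusion_rels m eps K L M1 M2"
abbreviation "coset \<equiv> fusion_coset m eps K L M1 M2"
abbreviation "el \<equiv> fusion_elem m eps K L M1 M2"
abbreviation "free \<equiv> carrier (fusion_free m K L M1 M2)"

sublocale TK: ring "T K" using M1 by (rule left_module.axioms(1))
sublocale TL: ring "T L" using M2 by (rule left_module.axioms(1))
sublocale TN: ring "T N" using ring_T[of N] K L N by simp
sublocale A1: abelian_group M1 using M1 by (rule left_module.axioms(2))
sublocale A2: abelian_group M2 using M2 by (rule left_module.axioms(2))

lemmas M1_smult = left_module.lsmult_closed[OF M1] left_module.lsmult_one[OF M1, simplified]
lemmas M2_smult = left_module.lsmult_closed[OF M2] left_module.lsmult_one[OF M2, simplified]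

lemma one_car [simp]: "tl_one \<in> carrier (T K)" "tl_one \<in> carrier (T L)" "tl_one \<in> carrier (T N)"
  using TK.one_closed TL.one_closed TN.one_closed by simp_all

lemma E_car [simp]: "b \<in> carrier (T K) \<Longrightarrow> c \<in> carrier (T L) \<Longrightarrow> E K L b c \<in> carrier (T N)"
  using E_closed K L N by simp

lemma T_scale: 
  "pm_scale c tl_one \<otimes>\<^bsub>T N\<^esub> a = pm_scale c a" "a \<otimes>\<^bsub>T N\<^esub> pm_scale c tl_one = pm_scale c a"
  if "a \<in> carrier (T N)"
  using that TN.l_one[OF that] TN.r_one[OF that] by (simp_all add: aTL_mult_linear)

lemma free_iff: "v \<in> free \<longleftrightarrow> Poly_Mapping.keys v \<subseteq> carrier (T N) \<times> carrier M1 \<times> carrier M2"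
  by (simp add: fusion_free_def N)

lemma free_closed: "0 \<in> free" "v \<in> free \<Longrightarrow> w \<in> free \<Longrightarrow> v + w \<in> free" "v \<in> free \<Longrightarrow> pm_scale c v \<in> free"
  using keys_add[of v w] keys_scale[of c v] by (auto simp: free_iff)

lemma free_basis: "a \<in> carrier (T N) \<Longrightarrow> x \<in> carrier M1 \<Longrightarrow> y \<in> carrier M2 \<Longrightarrow> basis (a, x, y) \<in> free"
  by (simp add: free_iff)

lemma free_extend: 
  assumes "v \<in> free" "0 \<in> W" "\<And>v w. v \<in> W \<Longrightarrow> w \<in> W \<Longrightarrow> v + w \<in> W" "\<And>c v. v \<in> W \<Longrightarrow> pm_scale c v \<in> W"
    "\<And>a x y. a \<in> carrier (T N) \<Longrightarrow> x \<in> carrier M1 \<Longrightarrow> y \<in> carrier M2 \<Longrightarrow> \<phi> (a, x, y) \<in> W"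
  shows "pm_extend \<phi> v \<in> W"
  using assms(1)[unfolded free_iff]
  by (rule pm_induct_keys) (use assms(2-) in \<open>auto simp: pm_extend_add pm_extend_scale\<close>)

lemma subspace_rels: "pm.subspace rels"
  unfolding fusion_rels_def Let_def by (rule pm.subspace_span)

lemmas rels_closed = pm.subspace_0[OF subspace_rels] pm.subspace_add[OF subspace_rels]
  pm.subspace_diff[OF subspace_rels] pm.subspace_neg[OF subspace_rels] pm.subspace_scale[OF subspace_rels]

lemma rels_gens:
  assumes "a \<in> carrier (T N)" "x \<in> carrier M1" "y \<in> carrier M2"
  shows "a' \<in> carrier (T N) \<Longrightarrow> basis (a + a', x, y) - basis (a, x, y) - basis (a', x, y) \<in> rels"
    "x' \<in> carrier M1 \<Longrightarrow> basis (a, x \<oplus>\<^bsub>M1\<^esub> x', y) - basis (a, x, y) - basis (a, x', y) \<in> rels"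
    "y' \<in> carrier M2 \<Longrightarrow> basis (a, x, y \<oplus>\<^bsub>M2\<^esub> y') - basis (a, x, y) - basis (a, x, y') \<in> rels"
    "basis (pm_scale c a, x, y) - pm_scale c (basis (a, x, y)) \<in> rels"
    "b \<in> carrier (T K) \<Longrightarrow> d \<in> carrier (T L) \<Longrightarrow>
      basis (a \<otimes>\<^bsub>T N\<^esub> E K L b d, x, y) - basis (a, b \<odot>\<^bsub>M1\<^esub> x, d \<odot>\<^bsub>M2\<^esub> y) \<in> rels"
proof -
  note rels = fusion_rels_def[of m eps K L M1 M2, unfolded Let_def N[symmetric] aTL_add]
  show "basis (a + a', x, y) - basis (a, x, y) - basis (a', x, y) \<in> rels" if "a' \<in> carrier (T N)"
    unfolding rels
    by (rule pm.span_base, (rule UnI1)+, intro CollectI exI conjI, rule refl) (fact assms that)+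
  show "basis (a, x \<oplus>\<^bsub>M1\<^esub> x', y) - basis (a, x, y) - basis (a, x', y) \<in> rels" if "x' \<in> carrier M1"
    unfolding rels
    by (rule pm.span_base, rule UnI1, rule UnI1, rule UnI1, rule UnI1, rule UnI1, rule UnI2,
        intro CollectI exI conjI, rule refl) (fact assms that)+
  show "basis (a, x, y \<oplus>\<^bsub>M2\<^esub> y') - basis (a, x, y) - basis (a, x, y') \<in> rels" if "y' \<in> carrier M2"
    unfolding rels
    by (rule pm.span_base, rule UnI1, rule UnI1, rule UnI1, rule UnI1, rule UnI2,
        intro CollectI exI conjI, rule refl) (fact assms that)+
  show "basis (pm_scale c a, x, y) - pm_scale c (basis (a, x, y)) \<in> rels"
    unfolding rels
    by (rule pm.span_base, rule UnI1, rule UnI1, rule UnI1, rule UnI2,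
        intro CollectI exI conjI, rule refl) (fact assms)+
  show "basis (a \<otimes>\<^bsub>T N\<^esub> E K L b d, x, y) - basis (a, b \<odot>\<^bsub>M1\<^esub> x, d \<odot>\<^bsub>M2\<^esub> y) \<in> rels"
    if "b \<in> carrier (T K)" "d \<in> carrier (T L)"
    unfolding rels
    by (rule pm.span_base, rule UnI2, intro CollectI exI conjI, rule refl) (fact assms that)+
qed

text \<open>The scalar relations in the second and third entries are dealt with once and for all: a
  scalar acts as a multiple of the unit, the embedding preserves such multiples, and balancing moves
  them to the first entry.\<close>

lemma rels_induct:
  assumes W: "pm.subspace W" and v: "v \<in> rels"
    and add1: "\<And>a a' x y. \<lbrakk>a \<in> carrier (T N); a' \<in> carrier (T N); x \<in> carrier M1; y \<in> carrier M2\<rbrakk> \<Longrightarrow>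
      \<phi> (a + a', x, y) - \<phi> (a, x, y) - \<phi> (a', x, y) \<in> W"
    and add2: "\<And>a x x' y. \<lbrakk>a \<in> carrier (T N); x \<in> carrier M1; x' \<in> carrier M1; y \<in> carrier M2\<rbrakk> \<Longrightarrow>
      \<phi> (a, x \<oplus>\<^bsub>M1\<^esub> x', y) - \<phi> (a, x, y) - \<phi> (a, x', y) \<in> W"
    and add3: "\<And>a x y y'. \<lbrakk>a \<in> carrier (T N); x \<in> carrier M1; y \<in> carrier M2; y' \<in> carrier M2\<rbrakk> \<Longrightarrow>
      \<phi> (a, x, y \<oplus>\<^bsub>M2\<^esub> y') - \<phi> (a, x, y) - \<phi> (a, x, y') \<in> W"
    and scale: "\<And>c a x y. \<lbrakk>a \<in> carrier (T N); x \<in> carrier M1; y \<in> carrier M2\<rbrakk> \<Longrightarrow>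
      \<phi> (pm_scale c a, x, y) - pm_scale c (\<phi> (a, x, y)) \<in> W"
    and bal: "\<And>a b d x y. \<lbrakk>a \<in> carrier (T N); b \<in> carrier (T K); d \<in> carrier (T L); x \<in> carrier M1; y \<in> carrier M2\<rbrakk> \<Longrightarrow>
      \<phi> (a \<otimes>\<^bsub>T N\<^esub> E K L b d, x, y) - \<phi> (a, b \<odot>\<^bsub>M1\<^esub> x, d \<odot>\<^bsub>M2\<^esub> y) \<in> W"
  shows "pm_extend \<phi> v \<in> W"
proof -
  have E1: "E K L (pm_scale c tl_one) tl_one = pm_scale c tl_one" "E K L tl_one (pm_scale c tl_one) = pm_scale c tl_one" for c
    using K L by (simp_all add: E_scale E_one)
  have sc1: "\<phi> (a, cact M1 c x, y) - pm_scale c (\<phi> (a, x, y)) \<in> W"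
    if t: "a \<in> carrier (T N)" "x \<in> carrier M1" "y \<in> carrier M2" for a x y c
    using pm.subspace_diff[OF W scale[OF t, of c] bal[OF t(1) aTL_closed(2)[OF one_car(1), of c] one_car(2) t(2,3)]] t
    by (simp add: E1 T_scale M2_smult)
  have sc2: "\<phi> (a, x, cact M2 c y) - pm_scale c (\<phi> (a, x, y)) \<in> W"
    if t: "a \<in> carrier (T N)" "x \<in> carrier M1" "y \<in> carrier M2" for a x y c
    using pm.subspace_diff[OF W scale[OF t, of c] bal[OF t(1) one_car(1) aTL_closed(2)[OF one_car(2), of c] t(2,3)]] t
    by (simp add: E1 T_scale M1_smult)
  have "pm.subspace {v. pm_extend \<phi> v \<in> W}"
    using W by (auto simp: pm.subspace_def pm_extend_add pm_extend_scale)
  then have "rels \<subseteq> {v. pm_extend \<phi> v \<in> W}"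
    unfolding fusion_rels_def Let_def N[symmetric] aTL_add
    by (intro pm.span_minimal)
      (use add1 add2 add3 scale bal sc1 sc2 in \<open>auto simp: pm_extend_diff pm_extend_scale\<close>)
  then show ?thesis using v by auto
qed

lemma coset_mem: "w \<in> coset v \<longleftrightarrow> w - v \<in> rels"
proof -
  have "coset v = {r + v | r. r \<in> rels}"
    by (auto simp: fusion_coset_def a_r_coset_def r_coset_def fusion_free_def)
  moreover have "w = (w - v) + v" by simp
  ultimately show ?thesis by auto
qed

lemma coset_self: "v \<in> coset v"
  using rels_closed(1) by (simp add: coset_mem)

lemma coset_eq_iff: "coset v = coset w \<longleftrightarrow> v - w \<in> rels"
proof
  assume "coset v = coset w"
  then show "v - w \<in> rels" using coset_self coset_mem by metis
next
  assume vw: "v - w \<in> rels"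
  have "u - v \<in> rels \<longleftrightarrow> u - w \<in> rels" for u
    using rels_closed(2)[OF _ vw, of "u - v"] rels_closed(3)[OF _ vw, of "u - w"] by auto
  then show "coset v = coset w" by (auto simp: coset_mem)
qed

lemma carrier_F: "X \<in> carrier F \<longleftrightarrow> (\<exists>v\<in>free. X = coset v)"
  by (auto simp: fusion_def A_RCOSETS_def RCOSETS_def fusion_coset_def a_r_coset_def r_coset_def fusion_free_def)

lemma coset_car: "v \<in> free \<Longrightarrow> coset v \<in> carrier F"
  using carrier_F by blast

lemma zero_F: "\<zero>\<^bsub>F\<^esub> = coset 0"
  using coset_mem[of _ 0] by (auto simp: fusion_def)

lemma add_F: "coset v \<oplus>\<^bsub>F\<^esub> coset w = coset (v + w)"
proof -
  have "coset v \<oplus>\<^bsub>F\<^esub> coset w = {x + y | x y. x \<in> coset v \<and> y \<in> coset w}"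
    by (auto simp: fusion_def set_add_def set_mult_def fusion_free_def)
  also have "\<dots> = coset (v + w)"
  proof (intro subset_antisym subsetI)
    fix u assume "u \<in> {x + y | x y. x \<in> coset v \<and> y \<in> coset w}"
    then obtain x y where u: "u = x + y" "x - v \<in> rels" "y - w \<in> rels" by (auto simp: coset_mem)
    then show "u \<in> coset (v + w)" using rels_closed(2)[OF u(2,3)] by (simp add: coset_mem algebra_simps)
  next
    fix u assume "u \<in> coset (v + w)"
    then have "u - w \<in> coset v" "u = (u - w) + w" by (simp_all add: coset_mem algebra_simps)
    then show "u \<in> {x + y | x y. x \<in> coset v \<and> y \<in> coset w}" using coset_self by blast
  qed
  finally show ?thesis .
qed

end

text \<open>Well-definedness of maps given as a union over all representatives, the form in which
  \<open>smult\<close> and \<open>fusion_map\<close> are defined: if relations go to relations, the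
  cosets in the union coincide.\<close>

lemma (in fusion_pair) union_coset:
  assumes "fusion_pair m s eps K' L' N' M1' M2'"
    and "\<And>r. r \<in> rels \<Longrightarrow> pm_extend \<phi> r \<in> fusion_rels m eps K' L' M1' M2'"
  shows "(\<Union>v\<in>coset w. fusion_coset m eps K' L' M1' M2' (pm_extend \<phi> v)) = fusion_coset m eps K' L' M1' M2' (pm_extend \<phi> w)"
proof -
  interpret Q: fusion_pair m s eps K' L' N' M1' M2' by fact
  have "Q.coset (pm_extend \<phi> v) = Q.coset (pm_extend \<phi> w)" if "v \<in> coset w" for v
    using that assms(2)[of "v - w"] by (simp add: coset_mem Q.coset_eq_iff pm_extend_diff)
  then show ?thesis using coset_self by blast
qed

context fusion_pair
begin

lemma smult_F:
  assumes t: "t \<in> carrier (T N)"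
  shows "t \<odot>\<^bsub>F\<^esub> coset v = coset (pm_extend (\<lambda>(a, x, y). basis (t \<otimes>\<^bsub>T N\<^esub> a, x, y)) v)"
proof -
  let ?\<phi> = "\<lambda>(a, x, y). basis (t \<otimes>\<^bsub>T N\<^esub> a, x, y)"
  have "pm_extend ?\<phi> r \<in> rels" if "r \<in> rels" for r
    by (rule rels_induct[OF subspace_rels that])
      (use t rels_gens in \<open>auto simp: aTL_mult_linear TN.m_assoc[symmetric]\<close>)
  from union_coset[OF fusion_pair_axioms this] show ?thesis by (simp add: fusion_def N)
qed

lemma coset_expand:
  assumes "pm.subspace W" "v \<in> free" "\<And>a x y. \<lbrakk>a \<in> carrier (T N); x \<in> carrier M1; y \<in> carrier M2\<rbrakk> \<Longrightarrow> \<phi> (a, x, y) - \<psi> (a, x, y) \<in> W"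
  shows "pm_extend \<phi> v - pm_extend \<psi> v \<in> W"
proof -
  have "pm_extend (\<lambda>k. \<phi> k + pm_scale (- 1) (\<psi> k)) v \<in> W"
    by (rule free_extend[OF assms(2)])
      (use assms(1,3) in \<open>auto simp: pm.subspace_0 pm.subspace_add pm.subspace_scale\<close>)
  then show ?thesis unfolding pm_extend_fun_add pm_extend_fun_scale by simp
qed

lemma pm_extend_id: "pm_extend basis v = v"
  unfolding pm_extend_def by (rule pm_expansion[symmetric])

lemma cact_F: "v \<in> free \<Longrightarrow> cact F c (coset v) = coset (pm_scale c v)"
proof -
  assume v: "v \<in> free"
  have "pm_extend (\<lambda>(a, x, y). basis (pm_scale c tl_one \<otimes>\<^bsub>T N\<^esub> a, x, y)) v - pm_extend (\<lambda>k. pm_scale c (basis k)) v \<in> rels"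
    by (rule coset_expand[OF subspace_rels v]) (simp add: T_scale rels_gens)
  then have "pm_extend (\<lambda>(a, x, y). basis (pm_scale c tl_one \<otimes>\<^bsub>T N\<^esub> a, x, y)) v - pm_scale c v \<in> rels"
    by (simp add: pm_extend_fun_scale pm_extend_id)
  then show ?thesis using smult_F[OF aTL_closed(2)[OF one_car(3)]] by (simp add: coset_eq_iff)
qed

lemma lact_free:
  "t \<in> carrier (T N) \<Longrightarrow> v \<in> free \<Longrightarrow> pm_extend (\<lambda>(a, x, y). basis (t \<otimes>\<^bsub>T N\<^esub> a, x, y)) v \<in> free"
  by (rule free_extend) (auto simp: free_closed free_basis)

lemma abelian_group_F: "abelian_group F"
proof (rule abelian_groupI)
  show "\<exists>Y\<in>carrier F. Y \<oplus>\<^bsub>F\<^esub> X = \<zero>\<^bsub>F\<^esub>" if X: "X \<in> carrier F" for X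
  proof -
    obtain v where v: "v \<in> free" "X = coset v" using X carrier_F by blast
    have "coset (pm_scale (- 1) v) \<oplus>\<^bsub>F\<^esub> X = \<zero>\<^bsub>F\<^esub>" by (simp add: v add_F zero_F)
    then show ?thesis using free_closed(3)[OF v(1)] coset_car by blast
  qed
qed (use free_closed in \<open>auto simp: carrier_F add_F zero_F algebra_simps\<close>)

lemma module_F: "left_module (T N) F"
proof (intro left_module.intro left_module_axioms.intro)
  show "ring (T N)" by unfold_locales
  show "abelian_group F" by (rule abelian_group_F)
  show "t \<odot>\<^bsub>F\<^esub> X \<in> carrier F" if "t \<in> carrier (T N)" "X \<in> carrier F" for t X
    using that lact_free by (auto simp: carrier_F smult_F)
  show "(t \<oplus>\<^bsub>T N\<^esub> t') \<odot>\<^bsub>F\<^esub> X = t \<odot>\<^bsub>F\<^esub> X \<oplus>\<^bsub>F\<^esub> t' \<odot>\<^bsub>F\<^esub> X"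
    if t: "t \<in> carrier (T N)" "t' \<in> carrier (T N)" and X: "X \<in> carrier F" for t t' X
  proof -
    obtain v where v: "v \<in> free" "X = coset v" using X carrier_F by blast
    define \<psi> where "\<psi> t = (\<lambda>(a, x, y). basis (t \<otimes>\<^bsub>T N\<^esub> a, x :: 'a, y :: 'b))" for t
    have "pm_extend (\<psi> (t + t')) v - pm_extend (\<lambda>k. \<psi> t k + \<psi> t' k) v \<in> rels"
      by (rule coset_expand[OF subspace_rels v(1)])
        (use t rels_gens(1) in \<open>simp add: \<psi>_def aTL_mult_linear diff_diff_add\<close>)
    then show ?thesis
      using t aTL_closed(1)[OF t] smult_F[folded \<psi>_def]
      by (simp add: v add_F coset_eq_iff pm_extend_fun_add)
  qed
  show "t \<odot>\<^bsub>F\<^esub> (X \<oplus>\<^bsub>F\<^esub> Y) = t \<odot>\<^bsub>F\<^esub> X \<oplus>\<^bsub>F\<^esub> t \<odot>\<^bsub>F\<^esub> Y"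
    if "t \<in> carrier (T N)" "X \<in> carrier F" "Y \<in> carrier F" for t X Y
    using that by (auto simp: carrier_F smult_F add_F pm_extend_add)
  show "(t \<otimes>\<^bsub>T N\<^esub> t') \<odot>\<^bsub>F\<^esub> X = t \<odot>\<^bsub>F\<^esub> (t' \<odot>\<^bsub>F\<^esub> X)"
    if t: "t \<in> carrier (T N)" "t' \<in> carrier (T N)" and X: "X \<in> carrier F" for t t' X
  proof -
    obtain v where v: "v \<in> free" "X = coset v" using X carrier_F by blast
    have "pm_extend (\<lambda>(a, x, y). basis ((t \<otimes>\<^bsub>T N\<^esub> t') \<otimes>\<^bsub>T N\<^esub> a, x, y)) v =
        pm_extend (\<lambda>(a, x, y). basis (t \<otimes>\<^bsub>T N\<^esub> a, x, y)) (pm_extend (\<lambda>(a, x, y). basis (t' \<otimes>\<^bsub>T N\<^esub> a, x, y)) v)"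
      by (rule pm_induct_keys[OF v(1)[unfolded free_iff]])
        (use t in \<open>auto simp: pm_extend_add pm_extend_scale TN.m_assoc\<close>)
    then show ?thesis using t by (simp add: v smult_F)
  qed
  show "\<one>\<^bsub>T N\<^esub> \<odot>\<^bsub>F\<^esub> X = X" if X: "X \<in> carrier F" for X
  proof -
    obtain v where v: "v \<in> free" "X = coset v" using X carrier_F by blast
    show ?thesis using cact_F[OF v(1), of 1] by (simp add: v)
  qed
qed

section \<open>Spanning elements and the universal property of the fusion product\<close>

sublocale F: abelian_group F by (rule abelian_group_F)

lemma el_car: "a \<in> carrier (T N) \<Longrightarrow> x \<in> carrier M1 \<Longrightarrow> y \<in> carrier M2 \<Longrightarrow> el a x y \<in> carrier F"
  by (simp add: fusion_elem_def coset_car free_basis)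

lemma el_rules:
  assumes "a \<in> carrier (T N)" "x \<in> carrier M1" "y \<in> carrier M2"
  shows "a' \<in> carrier (T N) \<Longrightarrow> el (a + a') x y = el a x y \<oplus>\<^bsub>F\<^esub> el a' x y"
    "x' \<in> carrier M1 \<Longrightarrow> el a (x \<oplus>\<^bsub>M1\<^esub> x') y = el a x y \<oplus>\<^bsub>F\<^esub> el a x' y"
    "y' \<in> carrier M2 \<Longrightarrow> el a x (y \<oplus>\<^bsub>M2\<^esub> y') = el a x y \<oplus>\<^bsub>F\<^esub> el a x y'"
    "el (pm_scale c a) x y = cact F c (el a x y)"
    "b \<in> carrier (T K) \<Longrightarrow> d \<in> carrier (T L) \<Longrightarrow>
      el (a \<otimes>\<^bsub>T N\<^esub> E K L b d) x y = el a (b \<odot>\<^bsub>M1\<^esub> x) (d \<odot>\<^bsub>M2\<^esub> y)"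
    "t \<in> carrier (T N) \<Longrightarrow> t \<odot>\<^bsub>F\<^esub> el a x y = el (t \<otimes>\<^bsub>T N\<^esub> a) x y"
  using rels_gens[OF assms] assms
  by (simp_all add: fusion_elem_def add_F cact_F free_basis coset_eq_iff smult_F diff_diff_add)

text \<open>A scalar is absorbed into the first entry, so every element is a sum of elements
  \<open>el a x y\<close>; the empty sum is the one whose three entries are 0.\<close>

lemma F_induct [consumes 1, case_names el add]:
  assumes X: "X \<in> carrier F"
    and el: "\<And>a x y. \<lbrakk>a \<in> carrier (T N); x \<in> carrier M1; y \<in> carrier M2\<rbrakk> \<Longrightarrow> P (el a x y)"
    and add: "\<And>X Y. \<lbrakk>X \<in> carrier F; Y \<in> carrier F; P X; P Y\<rbrakk> \<Longrightarrow> P (X \<oplus>\<^bsub>F\<^esub> Y)"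
  shows "P X"
proof -
  obtain v where v: "v \<in> free" "X = coset v" using X carrier_F by blast
  have sc: "coset (pm_scale c (basis (a, x, y))) = el (pm_scale c a) x y"
    if "a \<in> carrier (T N)" "x \<in> carrier M1" "y \<in> carrier M2" for a x y c
    using rels_closed(4)[OF rels_gens(4)[OF that, of c]] by (simp add: fusion_elem_def coset_eq_iff)
  have zero: "P (coset 0)"
    using el[OF aTL_closed(3) A1.zero_closed A2.zero_closed]
      sc[OF aTL_closed(3) A1.zero_closed A2.zero_closed, of 0] by simp
  have "v \<in> free \<and> P (coset v)"
  proof (rule pm_induct_keys[OF v(1)[unfolded free_iff]])
    show "0 \<in> free \<and> P (coset 0)" using zero free_closed by simp
    show "pm_scale c (basis b) \<in> free \<and> P (coset (pm_scale c (basis b)))"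
      if "b \<in> carrier (T N) \<times> carrier M1 \<times> carrier M2" for b c
      using that sc el aTL_closed(2) free_closed(3) free_basis by auto
    show "v + w \<in> free \<and> P (coset (v + w))" if "v \<in> free \<and> P (coset v)" "w \<in> free \<and> P (coset w)" for v w
      using that add[of "coset v" "coset w"] coset_car free_closed(2) by (simp add: add_F)
  qed
  then show ?thesis using v by simp
qed

lemma F_smult_add:
  "\<lbrakk>t \<in> carrier (T N); X \<in> carrier F; Y \<in> carrier F\<rbrakk> \<Longrightarrow> t \<odot>\<^bsub>F\<^esub> (X \<oplus>\<^bsub>F\<^esub> Y) = t \<odot>\<^bsub>F\<^esub> X \<oplus>\<^bsub>F\<^esub> t \<odot>\<^bsub>F\<^esub> Y"
  "\<lbrakk>t \<in> carrier (T N); X \<in> carrier F\<rbrakk> \<Longrightarrow> t \<odot>\<^bsub>F\<^esub> X \<in> carrier F"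
  using left_module.lsmult_r_distr[OF module_F] left_module.lsmult_closed[OF module_F] by blast+

lemma lmod_homI:
  assumes h: "h \<in> carrier F \<rightarrow> carrier P" and P: "left_module (T N) P"
    and add: "\<And>X Y. X \<in> carrier F \<Longrightarrow> Y \<in> carrier F \<Longrightarrow> h (X \<oplus>\<^bsub>F\<^esub> Y) = h X \<oplus>\<^bsub>P\<^esub> h Y"
    and smult: "\<And>t a x y. \<lbrakk>t \<in> carrier (T N); a \<in> carrier (T N); x \<in> carrier M1; y \<in> carrier M2\<rbrakk> \<Longrightarrow>
      h (el (t \<otimes>\<^bsub>T N\<^esub> a) x y) = t \<odot>\<^bsub>P\<^esub> h (el a x y)"
  shows "h \<in> lmod_hom (T N) F P"
proof -
  have "h (t \<odot>\<^bsub>F\<^esub> X) = t \<odot>\<^bsub>P\<^esub> h X" if t: "t \<in> carrier (T N)" and X: "X \<in> carrier F" for t X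
    using X
  proof (induction rule: F_induct)
    case (el a x y)
    then show ?case using t smult by (simp add: el_rules)
  next
    case (add X Y)
    then show ?case
      using t h left_module.lsmult_r_distr[OF P t, of "h X" "h Y"]
      by (simp add: F_smult_add assms(3) Pi_iff)
  qed
  then show ?thesis using h add by (simp add: lmod_hom_def)
qed

text \<open>Values in another fusion product have representatives in a free space; choosing one for
  each triple and extending linearly gives a map that respects the relations. Only additivity is
  claimed, because the intermediate lifts for the associator go between modules over different
  algebras.\<close>

lemma fusion_lift:
  assumes "fusion_pair m s eps K' L' N' M1' M2'"
  defines "P \<equiv> fusion m eps K' L' M1' M2'"
  assumes f: "\<And>a x y. \<lbrakk>a \<in> carrier (T N); x \<in> carrier M1; y \<in> carrier M2\<rbrakk> \<Longrightarrow> f a x y \<in> carrier P"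
    and add1: "\<And>a a' x y. \<lbrakk>a \<in> carrier (T N); a' \<in> carrier (T N); x \<in> carrier M1; y \<in> carrier M2\<rbrakk> \<Longrightarrow>
      f (a + a') x y = f a x y \<oplus>\<^bsub>P\<^esub> f a' x y"
    and add2: "\<And>a x x' y. \<lbrakk>a \<in> carrier (T N); x \<in> carrier M1; x' \<in> carrier M1; y \<in> carrier M2\<rbrakk> \<Longrightarrow>
      f a (x \<oplus>\<^bsub>M1\<^esub> x') y = f a x y \<oplus>\<^bsub>P\<^esub> f a x' y"
    and add3: "\<And>a x y y'. \<lbrakk>a \<in> carrier (T N); x \<in> carrier M1; y \<in> carrier M2; y' \<in> carrier M2\<rbrakk> \<Longrightarrow>
      f a x (y \<oplus>\<^bsub>M2\<^esub> y') = f a x y \<oplus>\<^bsub>P\<^esub> f a x y'"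
    and scale: "\<And>c a x y. \<lbrakk>a \<in> carrier (T N); x \<in> carrier M1; y \<in> carrier M2\<rbrakk> \<Longrightarrow>
      f (pm_scale c a) x y = cact P c (f a x y)"
    and bal: "\<And>a b d x y. \<lbrakk>a \<in> carrier (T N); b \<in> carrier (T K); d \<in> carrier (T L); x \<in> carrier M1; y \<in> carrier M2\<rbrakk> \<Longrightarrow>
      f (a \<otimes>\<^bsub>T N\<^esub> E K L b d) x y = f a (b \<odot>\<^bsub>M1\<^esub> x) (d \<odot>\<^bsub>M2\<^esub> y)"
  shows "\<exists>h. h \<in> carrier F \<rightarrow> carrier P \<and>
    (\<forall>X\<in>carrier F. \<forall>Y\<in>carrier F. h (X \<oplus>\<^bsub>F\<^esub> Y) = h X \<oplus>\<^bsub>P\<^esub> h Y) \<and>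
    (\<forall>a\<in>carrier (T N). \<forall>x\<in>carrier M1. \<forall>y\<in>carrier M2. h (el a x y) = f a x y)"
proof -
  interpret Q: fusion_pair m s eps K' L' N' M1' M2' by fact
  have P: "P = Q.F" by (simp add: P_def)
  define rep where "rep X = (SOME v. v \<in> Q.free \<and> X = Q.coset v)" for X
  have rep: "rep X \<in> Q.free \<and> X = Q.coset (rep X)" if "X \<in> carrier P" for X
    unfolding rep_def by (rule someI_ex) (use that Q.carrier_F P in auto)
  define \<phi> where "\<phi> = (\<lambda>(a, x, y). rep (f a x y))"
  have \<phi>: "\<phi> (a, x, y) \<in> Q.free" "Q.coset (\<phi> (a, x, y)) = f a x y"
    if "a \<in> carrier (T N)" "x \<in> carrier M1" "y \<in> carrier M2" for a x y
    using rep[OF f[OF that]] by (simp_all add: \<phi>_def)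
  have rels: "pm_extend \<phi> r \<in> Q.rels" if "r \<in> rels" for r
  proof (rule rels_induct[OF Q.subspace_rels that], goal_cases)
    case (1 a a' x y)
    then have "Q.coset (\<phi> (a + a', x, y)) = Q.coset (\<phi> (a, x, y) + \<phi> (a', x, y))"
      using add1 aTL_closed(1) by (simp add: \<phi> Q.add_F[symmetric] P)
    then show ?case by (simp add: Q.coset_eq_iff diff_diff_add)
  next
    case (2 a x x' y)
    then have "Q.coset (\<phi> (a, x \<oplus>\<^bsub>M1\<^esub> x', y)) = Q.coset (\<phi> (a, x, y) + \<phi> (a, x', y))"
      using add2 by (simp add: \<phi> Q.add_F[symmetric] P)
    then show ?case by (simp add: Q.coset_eq_iff diff_diff_add)
  next
    case (3 a x y y')
    then have "Q.coset (\<phi> (a, x, y \<oplus>\<^bsub>M2\<^esub> y')) = Q.coset (\<phi> (a, x, y) + \<phi> (a, x, y'))"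
      using add3 by (simp add: \<phi> Q.add_F[symmetric] P)
    then show ?case by (simp add: Q.coset_eq_iff diff_diff_add)
  next
    case (4 c a x y)
    then have "Q.coset (\<phi> (pm_scale c a, x, y)) = Q.coset (pm_scale c (\<phi> (a, x, y)))"
      using scale aTL_closed(2) by (simp add: \<phi> Q.cact_F[symmetric] P)
    then show ?case by (simp add: Q.coset_eq_iff)
  next
    case (5 a b d x y)
    then have "Q.coset (\<phi> (a \<otimes>\<^bsub>T N\<^esub> E K L b d, x, y)) = Q.coset (\<phi> (a, b \<odot>\<^bsub>M1\<^esub> x, d \<odot>\<^bsub>M2\<^esub> y))"
      using bal by (simp add: \<phi> M1_smult M2_smult)
    then show ?case by (simp add: Q.coset_eq_iff)
  qed
  define h where "h X = (\<Union>v\<in>X. Q.coset (pm_extend \<phi> v))" for X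
  have h: "h (coset v) = Q.coset (pm_extend \<phi> v)" for v
    unfolding h_def using union_coset[OF assms(1) rels] .
  have "h \<in> carrier F \<rightarrow> carrier P"
  proof
    fix X assume "X \<in> carrier F"
    then obtain v where v: "v \<in> free" "X = coset v" using carrier_F by blast
    have "pm_extend \<phi> v \<in> Q.free"
      by (rule free_extend[OF v(1)]) (use \<phi> Q.free_closed in auto)
    then show "h X \<in> carrier P" using v h Q.coset_car P by simp
  qed
  moreover have "h (X \<oplus>\<^bsub>F\<^esub> Y) = h X \<oplus>\<^bsub>P\<^esub> h Y" if "X \<in> carrier F" "Y \<in> carrier F" for X Y
    using that by (auto simp: carrier_F add_F h Q.add_F P pm_extend_add)
  moreover have "h (el a x y) = f a x y" if "a \<in> carrier (T N)" "x \<in> carrier M1" "y \<in> carrier M2" for a x y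
    using that \<phi> by (simp add: fusion_elem_def h)
  ultimately show ?thesis by blast
qed

lemma fusion_map:
  assumes Q: "fusion_pair m s eps K L N M1' M2'"
    and f: "f \<in> lmod_hom (T K) M1 M1'" and g: "g \<in> lmod_hom (T L) M2 M2'"
  shows "\<lbrakk>a \<in> carrier (T N); x \<in> carrier M1; y \<in> carrier M2\<rbrakk> \<Longrightarrow>
      fusion_map m eps K L M1' M2' f g (el a x y) = fusion_elem m eps K L M1' M2' a (f x) (g y)"
    and "fusion_map m eps K L M1' M2' f g \<in> lmod_hom (T N) F (fusion m eps K L M1' M2')"
proof -
  interpret Q: fusion_pair m s eps K L N M1' M2' by fact
  let ?\<phi> = "\<lambda>(a, x, y). basis (a, f x, g y)"
  let ?h = "fusion_map m eps K L M1' M2' f g"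
  have car: "x \<in> carrier M1 \<Longrightarrow> f x \<in> carrier M1'" "y \<in> carrier M2 \<Longrightarrow> g y \<in> carrier M2'" for x y
    using f g by (auto simp: lmod_hom_def)
  have rels: "pm_extend ?\<phi> r \<in> Q.rels" if "r \<in> rels" for r
    by (rule rels_induct[OF Q.subspace_rels that])
      (use f g car Q.rels_gens in \<open>auto simp: lmod_hom_def\<close>)
  have h: "?h (coset v) = Q.coset (pm_extend ?\<phi> v)" for v
    unfolding fusion_map_def using union_coset[OF Q rels] .
  show el: "?h (el a x y) = Q.el a (f x) (g y)" if "a \<in> carrier (T N)" "x \<in> carrier M1" "y \<in> carrier M2" for a x y
    by (simp add: fusion_elem_def h)
  show "?h \<in> lmod_hom (T N) F Q.F"
  proof (rule lmod_homI[OF _ Q.module_F])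
    show "?h \<in> carrier F \<rightarrow> carrier Q.F"
    proof
      fix X assume "X \<in> carrier F"
      then obtain v where v: "v \<in> free" "X = coset v" using carrier_F by blast
      have "pm_extend ?\<phi> v \<in> Q.free"
        by (rule free_extend[OF v(1)]) (use car Q.free_closed Q.free_basis in auto)
      then show "?h X \<in> carrier Q.F" using v h Q.coset_car by simp
    qed
    show "?h (X \<oplus>\<^bsub>F\<^esub> Y) = ?h X \<oplus>\<^bsub>Q.F\<^esub> ?h Y" if "X \<in> carrier F" "Y \<in> carrier F" for X Y
      using that by (auto simp: carrier_F add_F h Q.add_F pm_extend_add)
  qed (simp add: el Q.el_rules car)
qed

end

section \<open>The associator\<close>

text \<open>\<open>D\<close> is the domain and \<open>P\<close> the codomain of the associator; both
  are modules over the algebra on \<open>N\<close> points.\<close>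

locale fusion_triple = fusion_data +
  fixes N1 N2 N3 N12 N23 N :: nat and M1 :: "'a tlmod" and M2 :: "'b tlmod" and M3 :: "'c tlmod"
  assumes N1: "N1 \<ge> 1" and N2: "N2 \<ge> 1" and N3: "N3 \<ge> 1"
    and N12: "N12 = N1 + N2" and N23: "N23 = N2 + N3" and N: "N = N1 + N2 + N3"
    and M1: "left_module (aTL m N1) M1" and M2: "left_module (aTL m N2) M2" and M3: "left_module (aTL m N3) M3"
begin

sublocale p12: fusion_pair m s eps N1 N2 N12 M1 M2
  by (intro fusion_pair.intro fusion_pair_axioms.intro fusion_data_axioms N1 N2 N12 M1 M2)

sublocale p23: fusion_pair m s eps N2 N3 N23 M2 M3
  by (intro fusion_pair.intro fusion_pair_axioms.intro fusion_data_axioms N2 N3 N23 M2 M3)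

sublocale D: fusion_pair m s eps N12 N3 N "fusion m eps N1 N2 M1 M2" M3
  by (intro fusion_pair.intro fusion_pair_axioms.intro fusion_data_axioms p12.module_F M3)
    (use N1 N3 N12 N in simp_all)

sublocale P: fusion_pair m s eps N1 N23 N M1 "fusion m eps N2 N3 M2 M3"
  by (intro fusion_pair.intro fusion_pair_axioms.intro fusion_data_axioms p23.module_F M1)
    (use N1 N2 N23 N in simp_all)

abbreviation mult_N (infixl \<open>\<cdot>\<close> 70) where "a \<cdot> b \<equiv> a \<otimes>\<^bsub>T N\<^esub> b"

lemma assoc:
  "\<lbrakk>x \<in> carrier (T N1); y \<in> carrier (T N2); z \<in> carrier (T N3)\<rbrakk> \<Longrightarrow>
    E N12 N3 (E N1 N2 x y) z = E N1 N23 x (E N2 N3 y z)"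
  using E_assoc[OF N1 N2 N3 p12.TK.ring_axioms p12.TL.ring_axioms p23.TL.ring_axioms] by (simp add: N12 N23)

lemma Ns: "N12 \<ge> 1" "N23 \<ge> 1"
  using N1 N2 N12 N23 by auto

lemma E12_mult:
  "\<lbrakk>x \<in> carrier (T N12); x' \<in> carrier (T N12); y \<in> carrier (T N3); y' \<in> carrier (T N3)\<rbrakk> \<Longrightarrow>
    E N12 N3 x y \<cdot> E N12 N3 x' y' = E N12 N3 (x \<otimes>\<^bsub>T N12\<^esub> x') (y \<otimes>\<^bsub>T N3\<^esub> y')"
  using E_mult[OF Ns(1) N3] D.N by simp

lemma E23_mult:
  "\<lbrakk>x \<in> carrier (T N1); x' \<in> carrier (T N1); y \<in> carrier (T N23); y' \<in> carrier (T N23)\<rbrakk> \<Longrightarrow>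
    E N1 N23 x y \<cdot> E N1 N23 x' y' = E N1 N23 (x \<otimes>\<^bsub>T N1\<^esub> x') (y \<otimes>\<^bsub>T N23\<^esub> y')"
  using E_mult[OF N1 Ns(2)] P.N by simp

lemma right_third: "z \<in> carrier (T N3) \<Longrightarrow> E N12 N3 tl_one z = E N1 N23 tl_one (E N2 N3 tl_one z)"
  using assoc[of tl_one tl_one z] E_one[OF N1 N2] by simp

lemma left_first: "x \<in> carrier (T N1) \<Longrightarrow> E N1 N23 x tl_one = E N12 N3 (E N1 N2 x tl_one) tl_one"
  using assoc[of x tl_one tl_one] E_one[OF N2 N3] by simp

lemma one_simps [simp]:
  "x \<in> carrier (T N1) \<Longrightarrow> x \<otimes>\<^bsub>T N1\<^esub> tl_one = x" "x \<in> carrier (T N1) \<Longrightarrow> tl_one \<otimes>\<^bsub>T N1\<^esub> x = x"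
  "x \<in> carrier (T N3) \<Longrightarrow> x \<otimes>\<^bsub>T N3\<^esub> tl_one = x" "x \<in> carrier (T N3) \<Longrightarrow> tl_one \<otimes>\<^bsub>T N3\<^esub> x = x"
  "x \<in> carrier (T N12) \<Longrightarrow> x \<otimes>\<^bsub>T N12\<^esub> tl_one = x" "x \<in> carrier (T N12) \<Longrightarrow> tl_one \<otimes>\<^bsub>T N12\<^esub> x = x"
  "x \<in> carrier (T N23) \<Longrightarrow> x \<otimes>\<^bsub>T N23\<^esub> tl_one = x" "x \<in> carrier (T N23) \<Longrightarrow> tl_one \<otimes>\<^bsub>T N23\<^esub> x = x"
  "x \<in> carrier (T N) \<Longrightarrow> x \<cdot> tl_one = x" "x \<in> carrier (T N) \<Longrightarrow> tl_one \<cdot> x = x"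
  using D.TN.r_one D.TN.l_one p12.TN.r_one p12.TN.l_one p23.TN.r_one p23.TN.l_one
    p12.TK.r_one p12.TK.l_one p23.TL.r_one p23.TL.l_one by simp_all

lemma D_induct [consumes 1, case_names el add]:
  assumes "Z \<in> carrier D.F"
    and el: "\<And>a b x y z. \<lbrakk>a \<in> carrier (T N); b \<in> carrier (T N12); x \<in> carrier M1; y \<in> carrier M2; z \<in> carrier M3\<rbrakk> \<Longrightarrow>
      Q (D.el a (p12.el b x y) z)"
    and add: "\<And>X Y. \<lbrakk>X \<in> carrier D.F; Y \<in> carrier D.F; Q X; Q Y\<rbrakk> \<Longrightarrow> Q (X \<oplus>\<^bsub>D.F\<^esub> Y)"
  shows "Q Z"
  using assms(1)
proof (induction rule: D.F_induct)
  case (el a X z)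
  from el(2) show ?case
  proof (induction rule: p12.F_induct)
    case (el b x y)
    then show ?case using assms(2) \<open>a \<in> carrier (T N)\<close> \<open>z \<in> carrier M3\<close> by blast
  next
    case (add X Y)
    then show ?case using \<open>a \<in> carrier (T N)\<close> \<open>z \<in> carrier M3\<close>
      by (simp add: D.el_rules(2) D.el_car assms(3))
  qed
qed (rule add)

lemma P_induct [consumes 1, case_names el add]:
  assumes "Z \<in> carrier P.F"
    and el: "\<And>a b x y z. \<lbrakk>a \<in> carrier (T N); b \<in> carrier (T N23); x \<in> carrier M1; y \<in> carrier M2; z \<in> carrier M3\<rbrakk> \<Longrightarrow>
      Q (P.el a x (p23.el b y z))"
    and add: "\<And>X Y. \<lbrakk>X \<in> carrier P.F; Y \<in> carrier P.F; Q X; Q Y\<rbrakk> \<Longrightarrow> Q (X \<oplus>\<^bsub>P.F\<^esub> Y)"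
  shows "Q Z"
  using assms(1)
proof (induction rule: P.F_induct)
  case (el a x X)
  from el(3) show ?case
  proof (induction rule: p23.F_induct)
    case (el b y z)
    then show ?case using assms(2) \<open>a \<in> carrier (T N)\<close> \<open>x \<in> carrier M1\<close> by blast
  next
    case (add X Y)
    then show ?case using \<open>a \<in> carrier (T N)\<close> \<open>x \<in> carrier M1\<close>
      by (simp add: P.el_rules(3) P.el_car assms(3))
  qed
qed (rule add)

lemma smult_el23:
  "\<lbrakk>t \<in> carrier (T N23); b \<in> carrier (T N23); y \<in> carrier M2; z \<in> carrier M3\<rbrakk> \<Longrightarrow>
    t \<odot>\<^bsub>p23.F\<^esub> p23.el b y z = p23.el (t \<otimes>\<^bsub>T N23\<^esub> b) y z"
  by (simp add: p23.el_rules)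

lemma smult_el12:
  "\<lbrakk>t \<in> carrier (T N12); b \<in> carrier (T N12); x \<in> carrier M1; y \<in> carrier M2\<rbrakk> \<Longrightarrow>
    t \<odot>\<^bsub>p12.F\<^esub> p12.el b x y = p12.el (t \<otimes>\<^bsub>T N12\<^esub> b) x y"
  by (simp add: p12.el_rules)

lemma el23_E:
  "\<lbrakk>c \<in> carrier (T N2); d \<in> carrier (T N3); y \<in> carrier M2; z \<in> carrier M3\<rbrakk> \<Longrightarrow>
    p23.el (E N2 N3 c d) y z = p23.el tl_one (c \<odot>\<^bsub>M2\<^esub> y) (d \<odot>\<^bsub>M3\<^esub> z)"
  using p23.el_rules(5)[of tl_one y z c d] by simp

lemma el12_E:
  "\<lbrakk>c \<in> carrier (T N1); d \<in> carrier (T N2); x \<in> carrier M1; y \<in> carrier M2\<rbrakk> \<Longrightarrow>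
    p12.el (E N1 N2 c d) x y = p12.el tl_one (c \<odot>\<^bsub>M1\<^esub> x) (d \<odot>\<^bsub>M2\<^esub> y)"
  using p12.el_rules(5)[of tl_one x y c d] by simp

text \<open>For fixed \<open>a\<close> and \<open>z\<close> the formula is lifted over
  \<open>M1\<close> and \<open>M2\<close>, which gives \<open>k a z\<close>; these maps are then
  lifted in \<open>a\<close>, their argument and \<open>z\<close>. What the second lift demands of
  them is checked on elements \<open>p12.el b x y\<close> and extended by additivity.\<close>

lemma exists_alpha:
  "\<exists>\<alpha>\<in>lmod_hom (T N) D.F P.F. \<forall>a\<in>carrier (T N). \<forall>b\<in>carrier (T N12). \<forall>x\<in>carrier M1. \<forall>y\<in>carrier M2. \<forall>z\<in>carrier M3.
     \<alpha> (D.el a (p12.el b x y) z) = P.el (a \<cdot> E N12 N3 b tl_one) x (p23.el tl_one y z)"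
proof -
  define H where "H a z h \<longleftrightarrow> h \<in> carrier p12.F \<rightarrow> carrier P.F \<and>
    (\<forall>X\<in>carrier p12.F. \<forall>Y\<in>carrier p12.F. h (X \<oplus>\<^bsub>p12.F\<^esub> Y) = h X \<oplus>\<^bsub>P.F\<^esub> h Y) \<and>
    (\<forall>b\<in>carrier (T N12). \<forall>x\<in>carrier M1. \<forall>y\<in>carrier M2. h (p12.el b x y) =
       P.el (a \<cdot> E N12 N3 b tl_one) x (p23.el tl_one y z))" for a z h
  have "\<exists>h. H a z h" if az: "a \<in> carrier (T N)" "z \<in> carrier M3" for a z
    unfolding H_def
  proof (rule p12.fusion_lift[OF P.fusion_pair_axioms], goal_cases)
    case (6 b c d x y)
    \<comment> \<open>Balancing over the first two factors: associativity of the embeddings turns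
      \<open>c \<otimes> d\<close>, embedded twice, into \<open>c\<close> beside an embedded
      \<open>d \<otimes> 1\<close>. These then act on \<open>x\<close> and on the product of
      \<open>M2\<close> and \<open>M3\<close>.\<close>
    have "a \<cdot> E N12 N3 (b \<otimes>\<^bsub>T N12\<^esub> E N1 N2 c d) tl_one = (a \<cdot> E N12 N3 b tl_one) \<cdot> E N1 N23 c (E N2 N3 d tl_one)"
      using 6 az E12_mult[of b "E N1 N2 c d" tl_one tl_one] assoc[of c d tl_one] by (simp add: D.TN.m_assoc)
    then have "P.el (a \<cdot> E N12 N3 (b \<otimes>\<^bsub>T N12\<^esub> E N1 N2 c d) tl_one) x (p23.el tl_one y z) =
        P.el (a \<cdot> E N12 N3 b tl_one) (c \<odot>\<^bsub>M1\<^esub> x) (E N2 N3 d tl_one \<odot>\<^bsub>p23.F\<^esub> p23.el tl_one y z)"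
      using 6 az by (simp add: P.el_rules p23.el_car)
    then show ?case using 6 az by (simp add: smult_el23 el23_E p23.M2_smult)
  qed (use az in \<open>simp_all add: E_add_left[OF Ns(1) N3] E_scale[OF Ns(1) N3] aTL_mult_linear
      P.el_car P.el_rules(1-4) p23.el_car p23.el_rules(2)\<close>)
  then obtain k where k: "\<And>a z. \<lbrakk>a \<in> carrier (T N); z \<in> carrier M3\<rbrakk> \<Longrightarrow> H a z (k a z)" by metis
  have k_car: "k a z X \<in> carrier P.F" if "a \<in> carrier (T N)" "z \<in> carrier M3" "X \<in> carrier p12.F" for a z X
    using k[OF that(1,2)] that(3) by (auto simp: H_def)
  have k_add: "k a z (X \<oplus>\<^bsub>p12.F\<^esub> Y) = k a z X \<oplus>\<^bsub>P.F\<^esub> k a z Y"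
    if "a \<in> carrier (T N)" "z \<in> carrier M3" "X \<in> carrier p12.F" "Y \<in> carrier p12.F" for a z X Y
    using k[OF that(1,2)] that(3,4) by (auto simp: H_def)
  have k_el: "k a z (p12.el b x y) = P.el (a \<cdot> E N12 N3 b tl_one) x (p23.el tl_one y z)"
    if "a \<in> carrier (T N)" "z \<in> carrier M3" "b \<in> carrier (T N12)" "x \<in> carrier M1" "y \<in> carrier M2" for a z b x y
    using k[OF that(1,2)] that(3-) by (auto simp: H_def)
  \<comment> \<open>Rearrangement behind the additivity of \<open>k\<close> in \<open>a\<close> and
    in \<open>z\<close> when its argument is a sum.\<close>
  have swap: "(A \<oplus>\<^bsub>P.F\<^esub> B) \<oplus>\<^bsub>P.F\<^esub> (C \<oplus>\<^bsub>P.F\<^esub> G) = (A \<oplus>\<^bsub>P.F\<^esub> C) \<oplus>\<^bsub>P.F\<^esub> (B \<oplus>\<^bsub>P.F\<^esub> G)"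
    if "A \<in> carrier P.F" "B \<in> carrier P.F" "C \<in> carrier P.F" "G \<in> carrier P.F" for A B C G
    using that by (simp add: P.F.a_ac)
  have "\<exists>h. h \<in> carrier D.F \<rightarrow> carrier P.F \<and>
    (\<forall>X\<in>carrier D.F. \<forall>Y\<in>carrier D.F. h (X \<oplus>\<^bsub>D.F\<^esub> Y) = h X \<oplus>\<^bsub>P.F\<^esub> h Y) \<and>
    (\<forall>a\<in>carrier (T N). \<forall>X\<in>carrier p12.F. \<forall>z\<in>carrier M3. h (D.el a X z) = k a z X)"
  proof (rule D.fusion_lift[OF P.fusion_pair_axioms], goal_cases)
    case (2 a a' X z)
    from 2(3) show ?case
    proof (induction rule: p12.F_induct)
      case (el b x y)
      then show ?case using 2 by (simp add: k_el aTL_mult_linear aTL_closed P.el_rules p23.el_car)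
    next
      case (add X Y)
      then show ?case using 2 by (simp add: k_add k_car aTL_closed swap)
    qed
  next
    case (4 a X z z')
    from 4(2) show ?case
    proof (induction rule: p12.F_induct)
      case (el b x y)
      then show ?case using 4 by (simp add: k_el P.el_rules p23.el_rules p23.el_car)
    next
      case (add X Y)
      then show ?case using 4 by (simp add: k_add k_car swap)
    qed
  next
    case (5 c a X z)
    from 5(2) show ?case
    proof (induction rule: p12.F_induct)
      case (el b x y)
      then show ?case using 5 by (simp add: k_el aTL_mult_linear aTL_closed P.el_rules(4) p23.el_car)
    next
      case (add X Y)
      then show ?case using 5 by (simp add: k_add k_car aTL_closed P.F_smult_add)
    qed
  next
    case (6 a B c X z)
    from 6(4) show ?case
    proof (induction rule: p12.F_induct)
      case (el b x y)
      have Bb: "B \<otimes>\<^bsub>T N12\<^esub> b \<in> carrier (T N12)" using el 6 by simp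
      \<comment> \<open>\<open>c\<close> lives on the third block and moves past \<open>b\<close>,
        which lives on the first two, so that \<open>B\<close> and \<open>b\<close> can be
        multiplied. By associativity \<open>c\<close> then acts inside the product of
        \<open>M2\<close> and \<open>M3\<close>.\<close>
      have "(a \<cdot> E N12 N3 B c) \<cdot> E N12 N3 b tl_one = (a \<cdot> E N12 N3 (B \<otimes>\<^bsub>T N12\<^esub> b) tl_one) \<cdot> E N1 N23 tl_one (E N2 N3 tl_one c)"
        using 6 el Bb E12_mult[of B b c tl_one] E12_mult[of "B \<otimes>\<^bsub>T N12\<^esub> b" tl_one tl_one c] right_third[of c]
        by (simp add: D.TN.m_assoc)
      then have "k (a \<cdot> E N12 N3 B c) z (p12.el b x y) =
          P.el (a \<cdot> E N12 N3 (B \<otimes>\<^bsub>T N12\<^esub> b) tl_one) x (E N2 N3 tl_one c \<odot>\<^bsub>p23.F\<^esub> p23.el tl_one y z)"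
        using 6 el Bb by (simp add: k_el P.el_rules p23.el_car p12.M1_smult)
      also have "\<dots> = k a (c \<odot>\<^bsub>M3\<^esub> z) (B \<odot>\<^bsub>p12.F\<^esub> p12.el b x y)"
        using 6 el Bb by (simp add: smult_el23 el23_E smult_el12 k_el p12.M2_smult p23.M2_smult)
      finally show ?case .
    next
      case (add X Y)
      then show ?case using 6 by (simp add: k_add p12.F_smult_add p23.M2_smult)
    qed
  qed (simp_all add: k_car k_add)
  then obtain \<alpha> where \<alpha>: "\<alpha> \<in> carrier D.F \<rightarrow> carrier P.F"
    "\<And>X Y. X \<in> carrier D.F \<Longrightarrow> Y \<in> carrier D.F \<Longrightarrow> \<alpha> (X \<oplus>\<^bsub>D.F\<^esub> Y) = \<alpha> X \<oplus>\<^bsub>P.F\<^esub> \<alpha> Y"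
    "\<And>a X z. \<lbrakk>a \<in> carrier (T N); X \<in> carrier p12.F; z \<in> carrier M3\<rbrakk> \<Longrightarrow> \<alpha> (D.el a X z) = k a z X"
    by blast
  have hom: "\<alpha> \<in> lmod_hom (T N) D.F P.F"
  proof (rule D.lmod_homI[OF \<alpha>(1) P.module_F \<alpha>(2)])
    fix t a X z assume t: "t \<in> carrier (T N)" "a \<in> carrier (T N)" and X: "X \<in> carrier p12.F" and z: "z \<in> carrier M3"
    from X have "k (t \<cdot> a) z X = t \<odot>\<^bsub>P.F\<^esub> k a z X"
    proof (induction rule: p12.F_induct)
      case (el b x y)
      then show ?case using t z by (simp add: k_el P.el_rules p23.el_car D.TN.m_assoc)
    next
      case (add X Y)
      then show ?case using t z by (simp add: k_add k_car P.F_smult_add)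
    qed
    then show "\<alpha> (D.el (t \<cdot> a) X z) = t \<odot>\<^bsub>P.F\<^esub> \<alpha> (D.el a X z)" using t X z by (simp add: \<alpha>(3))
  qed
  have "\<alpha> (D.el a (p12.el b x y) z) = P.el (a \<cdot> E N12 N3 b tl_one) x (p23.el tl_one y z)"
    if "a \<in> carrier (T N)" "b \<in> carrier (T N12)" "x \<in> carrier M1" "y \<in> carrier M2" "z \<in> carrier M3" for a b x y z
    using that by (simp add: \<alpha>(3) p12.el_car k_el)
  then show ?thesis by (intro bexI[OF _ hom] ballI)
qed

text \<open>The inverse of the associator, by the mirror-image construction: \<open>b\<close> now
  lives on the last two blocks, and \<open>x\<close> takes the place of \<open>z\<close> as the
  entry fixed during the first lift.\<close>

lemma exists_beta:
  "\<exists>\<beta>\<in>lmod_hom (T N) P.F D.F. \<forall>a\<in>carrier (T N). \<forall>b\<in>carrier (T N23). \<forall>x\<in>carrier M1. \<forall>y\<in>carrier M2. \<forall>z\<in>carrier M3.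
     \<beta> (P.el a x (p23.el b y z)) = D.el (a \<cdot> E N1 N23 tl_one b) (p12.el tl_one x y) z"
proof -
  define H where "H a x h \<longleftrightarrow> h \<in> carrier p23.F \<rightarrow> carrier D.F \<and>
    (\<forall>X\<in>carrier p23.F. \<forall>Y\<in>carrier p23.F. h (X \<oplus>\<^bsub>p23.F\<^esub> Y) = h X \<oplus>\<^bsub>D.F\<^esub> h Y) \<and>
    (\<forall>b\<in>carrier (T N23). \<forall>y\<in>carrier M2. \<forall>z\<in>carrier M3. h (p23.el b y z) =
       D.el (a \<cdot> E N1 N23 tl_one b) (p12.el tl_one x y) z)" for a x h
  have "\<exists>h. H a x h" if ax: "a \<in> carrier (T N)" "x \<in> carrier M1" for a x
    unfolding H_def
  proof (rule p23.fusion_lift[OF D.fusion_pair_axioms], goal_cases)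
    case (6 b c d y z)
    have "a \<cdot> E N1 N23 tl_one (b \<otimes>\<^bsub>T N23\<^esub> E N2 N3 c d) = (a \<cdot> E N1 N23 tl_one b) \<cdot> E N12 N3 (E N1 N2 tl_one c) d"
      using 6 ax E23_mult[of tl_one tl_one b "E N2 N3 c d"] assoc[of tl_one c d] by (simp add: D.TN.m_assoc)
    then have "D.el (a \<cdot> E N1 N23 tl_one (b \<otimes>\<^bsub>T N23\<^esub> E N2 N3 c d)) (p12.el tl_one x y) z =
        D.el (a \<cdot> E N1 N23 tl_one b) (E N1 N2 tl_one c \<odot>\<^bsub>p12.F\<^esub> p12.el tl_one x y) (d \<odot>\<^bsub>M3\<^esub> z)"
      using 6 ax by (simp add: D.el_rules p12.el_car)
    then show ?case using 6 ax by (simp add: smult_el12 el12_E p12.M1_smult)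
  qed (use ax in \<open>simp_all add: E_add_right[OF N1 Ns(2)] E_scale[OF N1 Ns(2)] aTL_mult_linear
      D.el_car D.el_rules(1-4) p12.el_car p12.el_rules(3)\<close>)
  then obtain k where k: "\<And>a x. \<lbrakk>a \<in> carrier (T N); x \<in> carrier M1\<rbrakk> \<Longrightarrow> H a x (k a x)" by metis
  have k_car: "k a x X \<in> carrier D.F" if "a \<in> carrier (T N)" "x \<in> carrier M1" "X \<in> carrier p23.F" for a x X
    using k[OF that(1,2)] that(3) by (auto simp: H_def)
  have k_add: "k a x (X \<oplus>\<^bsub>p23.F\<^esub> Y) = k a x X \<oplus>\<^bsub>D.F\<^esub> k a x Y"
    if "a \<in> carrier (T N)" "x \<in> carrier M1" "X \<in> carrier p23.F" "Y \<in> carrier p23.F" for a x X Y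
    using k[OF that(1,2)] that(3,4) by (auto simp: H_def)
  have k_el: "k a x (p23.el b y z) = D.el (a \<cdot> E N1 N23 tl_one b) (p12.el tl_one x y) z"
    if "a \<in> carrier (T N)" "x \<in> carrier M1" "b \<in> carrier (T N23)" "y \<in> carrier M2" "z \<in> carrier M3" for a x b y z
    using k[OF that(1,2)] that(3-) by (auto simp: H_def)
  have swap: "(A \<oplus>\<^bsub>D.F\<^esub> B) \<oplus>\<^bsub>D.F\<^esub> (C \<oplus>\<^bsub>D.F\<^esub> G) = (A \<oplus>\<^bsub>D.F\<^esub> C) \<oplus>\<^bsub>D.F\<^esub> (B \<oplus>\<^bsub>D.F\<^esub> G)"
    if "A \<in> carrier D.F" "B \<in> carrier D.F" "C \<in> carrier D.F" "G \<in> carrier D.F" for A B C G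
    using that by (simp add: D.F.a_ac)
  have "\<exists>h. h \<in> carrier P.F \<rightarrow> carrier D.F \<and>
    (\<forall>X\<in>carrier P.F. \<forall>Y\<in>carrier P.F. h (X \<oplus>\<^bsub>P.F\<^esub> Y) = h X \<oplus>\<^bsub>D.F\<^esub> h Y) \<and>
    (\<forall>a\<in>carrier (T N). \<forall>x\<in>carrier M1. \<forall>X\<in>carrier p23.F. h (P.el a x X) = k a x X)"
  proof (rule P.fusion_lift[OF D.fusion_pair_axioms], goal_cases)
    case (2 a a' x X)
    from 2(4) show ?case
    proof (induction rule: p23.F_induct)
      case (el b y z)
      then show ?case using 2 by (simp add: k_el aTL_mult_linear aTL_closed D.el_rules p12.el_car)
    next
      case (add X Y)
      then show ?case using 2 by (simp add: k_add k_car aTL_closed swap)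
    qed
  next
    case (3 a x x' X)
    from 3(4) show ?case
    proof (induction rule: p23.F_induct)
      case (el b y z)
      then show ?case using 3 by (simp add: k_el D.el_rules p12.el_rules p12.el_car)
    next
      case (add X Y)
      then show ?case using 3 by (simp add: k_add k_car swap)
    qed
  next
    case (5 c a x X)
    from 5(3) show ?case
    proof (induction rule: p23.F_induct)
      case (el b y z)
      then show ?case using 5 by (simp add: k_el aTL_mult_linear aTL_closed D.el_rules(4) p12.el_car)
    next
      case (add X Y)
      then show ?case using 5 by (simp add: k_add k_car aTL_closed D.F_smult_add)
    qed
  next
    case (6 a c B x X)
    from 6(5) show ?case
    proof (induction rule: p23.F_induct)
      case (el b y z)
      have Bb: "B \<otimes>\<^bsub>T N23\<^esub> b \<in> carrier (T N23)" using el 6 by simp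
      have "(a \<cdot> E N1 N23 c B) \<cdot> E N1 N23 tl_one b = (a \<cdot> E N1 N23 tl_one (B \<otimes>\<^bsub>T N23\<^esub> b)) \<cdot> E N12 N3 (E N1 N2 c tl_one) tl_one"
        using 6 el Bb E23_mult[of c tl_one B b] E23_mult[of tl_one c "B \<otimes>\<^bsub>T N23\<^esub> b" tl_one] left_first[of c, symmetric]
        by (simp add: D.TN.m_assoc)
      then have "k (a \<cdot> E N1 N23 c B) x (p23.el b y z) =
          D.el (a \<cdot> E N1 N23 tl_one (B \<otimes>\<^bsub>T N23\<^esub> b)) (E N1 N2 c tl_one \<odot>\<^bsub>p12.F\<^esub> p12.el tl_one x y) z"
        using 6 el Bb by (simp add: k_el D.el_rules p12.el_car p23.M2_smult)
      also have "\<dots> = k a (c \<odot>\<^bsub>M1\<^esub> x) (B \<odot>\<^bsub>p23.F\<^esub> p23.el b y z)"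
        using 6 el Bb by (simp add: smult_el23 el12_E smult_el12 k_el p12.M1_smult p12.M2_smult)
      finally show ?case .
    next
      case (add X Y)
      then show ?case using 6 by (simp add: k_add p23.F_smult_add p12.M1_smult)
    qed
  qed (simp_all add: k_car k_add)
  then obtain \<beta> where \<beta>: "\<beta> \<in> carrier P.F \<rightarrow> carrier D.F"
    "\<And>X Y. X \<in> carrier P.F \<Longrightarrow> Y \<in> carrier P.F \<Longrightarrow> \<beta> (X \<oplus>\<^bsub>P.F\<^esub> Y) = \<beta> X \<oplus>\<^bsub>D.F\<^esub> \<beta> Y"
    "\<And>a x X. \<lbrakk>a \<in> carrier (T N); x \<in> carrier M1; X \<in> carrier p23.F\<rbrakk> \<Longrightarrow> \<beta> (P.el a x X) = k a x X"
    by blast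
  have hom: "\<beta> \<in> lmod_hom (T N) P.F D.F"
  proof (rule P.lmod_homI[OF \<beta>(1) D.module_F \<beta>(2)])
    fix t a x X assume t: "t \<in> carrier (T N)" "a \<in> carrier (T N)" and x: "x \<in> carrier M1" and X: "X \<in> carrier p23.F"
    from X have "k (t \<cdot> a) x X = t \<odot>\<^bsub>D.F\<^esub> k a x X"
    proof (induction rule: p23.F_induct)
      case (el b y z)
      then show ?case using t x by (simp add: k_el D.el_rules p12.el_car D.TN.m_assoc)
    next
      case (add X Y)
      then show ?case using t x by (simp add: k_add k_car D.F_smult_add)
    qed
    then show "\<beta> (P.el (t \<cdot> a) x X) = t \<odot>\<^bsub>D.F\<^esub> \<beta> (P.el a x X)" using t X x by (simp add: \<beta>(3))
  qed
  have "\<beta> (P.el a x (p23.el b y z)) = D.el (a \<cdot> E N1 N23 tl_one b) (p12.el tl_one x y) z"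
    if "a \<in> carrier (T N)" "b \<in> carrier (T N23)" "x \<in> carrier M1" "y \<in> carrier M2" "z \<in> carrier M3" for a b x y z
    using that by (simp add: \<beta>(3) p23.el_car k_el)
  then show ?thesis by (intro bexI[OF _ hom] ballI)
qed

abbreviation "\<alpha> \<equiv> associator m eps N1 N2 N3 M1 M2 M3"

lemma alpha: "\<alpha> \<in> lmod_hom (T N) D.F P.F" "associator_formula m eps N1 N2 N3 M1 M2 M3 \<alpha>"
proof -
  have "\<exists>\<alpha>. \<alpha> \<in> lmod_hom (aTL m (N1 + N2 + N3))
           (fusion m eps (N1 + N2) N3 (fusion m eps N1 N2 M1 M2) M3)
           (fusion m eps N1 (N2 + N3) M1 (fusion m eps N2 N3 M2 M3)) \<and>
     associator_formula m eps N1 N2 N3 M1 M2 M3 \<alpha>"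
    using exists_alpha unfolding associator_formula_def N12 N23 N by blast
  from someI_ex[OF this, folded associator_def]
  show "\<alpha> \<in> lmod_hom (T N) D.F P.F" "associator_formula m eps N1 N2 N3 M1 M2 M3 \<alpha>"
    unfolding N12 N23 N by blast+
qed

lemma alpha_el:
  "\<lbrakk>a \<in> carrier (T N); b \<in> carrier (T N12); x \<in> carrier M1; y \<in> carrier M2; z \<in> carrier M3\<rbrakk> \<Longrightarrow>
    \<alpha> (D.el a (p12.el b x y) z) = P.el (a \<cdot> E N12 N3 b tl_one) x (p23.el tl_one y z)"
  using alpha(2)[unfolded associator_formula_def, rule_format, of a b x y z] unfolding N12 N23 N .

lemma alpha_car: "X \<in> carrier D.F \<Longrightarrow> \<alpha> X \<in> carrier P.F"
  and alpha_add: "\<lbrakk>X \<in> carrier D.F; Y \<in> carrier D.F\<rbrakk> \<Longrightarrow> \<alpha> (X \<oplus>\<^bsub>D.F\<^esub> Y) = \<alpha> X \<oplus>\<^bsub>P.F\<^esub> \<alpha> Y"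
  using alpha(1) by (auto simp: lmod_hom_def)

text \<open>On spanning elements either composite only moves \<open>b\<close> from the inner product
  out into the first entry, and balancing moves it back.\<close>

lemma alpha_iso: "lmod_iso (T N) D.F P.F \<alpha>"
proof -
  obtain \<beta> where \<beta>: "\<beta> \<in> lmod_hom (T N) P.F D.F"
    "\<And>a b x y z. \<lbrakk>a \<in> carrier (T N); b \<in> carrier (T N23); x \<in> carrier M1; y \<in> carrier M2; z \<in> carrier M3\<rbrakk> \<Longrightarrow>
     \<beta> (P.el a x (p23.el b y z)) = D.el (a \<cdot> E N1 N23 tl_one b) (p12.el tl_one x y) z"
    using exists_beta by blast
  have \<beta>_car: "X \<in> carrier P.F \<Longrightarrow> \<beta> X \<in> carrier D.F"
    and \<beta>_add: "\<lbrakk>X \<in> carrier P.F; Y \<in> carrier P.F\<rbrakk> \<Longrightarrow> \<beta> (X \<oplus>\<^bsub>P.F\<^esub> Y) = \<beta> X \<oplus>\<^bsub>D.F\<^esub> \<beta> Y" for X Y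
    using \<beta>(1) by (auto simp: lmod_hom_def)
  have 1: "\<beta> (\<alpha> X) = X" if "X \<in> carrier D.F" for X
    using that
  proof (induction rule: D_induct)
    case (el a b x y z)
    then have "\<beta> (\<alpha> (D.el a (p12.el b x y) z)) = D.el (a \<cdot> E N12 N3 b tl_one) (p12.el tl_one x y) z"
      by (simp add: alpha_el \<beta>(2) E_one[OF N1 Ns(2)] D.TN.m_assoc)
    also have "\<dots> = D.el a (p12.el b x y) z"
      using el by (simp add: D.el_rules(5) p12.el_car smult_el12 D.M2_smult)
    finally show ?case .
  qed (simp add: alpha_add \<beta>_add alpha_car)
  have 2: "\<alpha> (\<beta> X) = X" if "X \<in> carrier P.F" for X
    using that
  proof (induction rule: P_induct)
    case (el a b x y z)
    then have "\<alpha> (\<beta> (P.el a x (p23.el b y z))) = P.el (a \<cdot> E N1 N23 tl_one b) x (p23.el tl_one y z)"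
      by (simp add: alpha_el \<beta>(2) E_one[OF Ns(1) N3] D.TN.m_assoc)
    also have "\<dots> = P.el a x (p23.el b y z)"
      using el by (simp add: P.el_rules(5) p23.el_car smult_el23 P.M1_smult)
    finally show ?case .
  qed (simp add: alpha_add \<beta>_add \<beta>_car)
  have "bij_betw \<alpha> (carrier D.F) (carrier P.F)"
    by (rule bij_betw_byWitness[where f' = \<beta>]) (use 1 2 alpha_car \<beta>_car in auto)
  then show ?thesis using alpha(1) D.module_F P.module_F by (simp add: lmod_iso_def)
qed

end

section \<open>Naturality and the pentagon\<close>

lemma lmod_hom_id: "(\<lambda>x. x) \<in> lmod_hom R M M"
  by (simp add: lmod_hom_def)

lemma lmod_homD:
  assumes "h \<in> lmod_hom R M M'"
  shows "x \<in> carrier M \<Longrightarrow> h x \<in> carrier M'"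
    "\<lbrakk>x \<in> carrier M; y \<in> carrier M\<rbrakk> \<Longrightarrow> h (x \<oplus>\<^bsub>M\<^esub> y) = h x \<oplus>\<^bsub>M'\<^esub> h y"
  using assms by (auto simp: lmod_hom_def)

lemma (in fusion_triple) associator_natural:
  assumes "fusion_triple m s eps N1 N2 N3 N12 N23 N M1' M2' M3'"
    and f: "f1 \<in> lmod_hom (T N1) M1 M1'" "f2 \<in> lmod_hom (T N2) M2 M2'" "f3 \<in> lmod_hom (T N3) M3 M3'"
    and X: "X \<in> carrier D.F"
  shows "associator m eps N1 N2 N3 M1' M2' M3'
      (fusion_map m eps N12 N3 (fusion m eps N1 N2 M1' M2') M3' (fusion_map m eps N1 N2 M1' M2' f1 f2) f3 X) =
    fusion_map m eps N1 N23 M1' (fusion m eps N2 N3 M2' M3') f1 (fusion_map m eps N2 N3 M2' M3' f2 f3) (\<alpha> X)"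
proof -
  interpret Q: fusion_triple m s eps N1 N2 N3 N12 N23 N M1' M2' M3' by fact
  note m12 = p12.fusion_map[OF Q.p12.fusion_pair_axioms f(1,2)]
  note m23 = p23.fusion_map[OF Q.p23.fusion_pair_axioms f(2,3)]
  note mD = D.fusion_map[OF Q.D.fusion_pair_axioms m12(2) f(3)]
  note mP = P.fusion_map[OF Q.P.fusion_pair_axioms f(1) m23(2)]
  show ?thesis
    using X
  proof (induction rule: D_induct)
    case (el a b x y z)
    have car: "f1 x \<in> carrier M1'" "f2 y \<in> carrier M2'" "f3 z \<in> carrier M3'"
      using el lmod_homD(1)[OF f(1)] lmod_homD(1)[OF f(2)] lmod_homD(1)[OF f(3)] by simp_all
    show ?case
      using el car by (simp add: mD(1) m12(1) mP(1) m23(1) p12.el_car p23.el_car alpha_el Q.alpha_el)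
  next
    case (add X Y)
    then show ?case
      by (simp add: lmod_homD[OF mD(2)] lmod_homD[OF mP(2)] alpha_add alpha_car Q.alpha_add)
  qed
qed

text \<open>On \<open>a \<otimes> (b \<otimes> (c \<otimes> x1 \<otimes> x2) \<otimes> x3) \<otimes>
  x4\<close> both composites produce \<open>x1\<close> to \<open>x4\<close> nested to the right,
  with units in the inner algebra entries, so only the outermost algebra entry has to be
  compared.\<close>

lemma (in fusion_data) pentagon:
  fixes M1 :: "'a tlmod" and M2 :: "'b tlmod" and M3 :: "'c tlmod" and M4 :: "'d tlmod"
  assumes N: "N1 \<ge> 1" "N2 \<ge> 1" "N3 \<ge> 1" "N4 \<ge> 1"
    and M: "left_module (T N1) M1" "left_module (T N2) M2" "left_module (T N3) M3" "left_module (T N4) M4"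
  defines "F12 \<equiv> fusion m eps N1 N2 M1 M2" and "F23 \<equiv> fusion m eps N2 N3 M2 M3" and "F34 \<equiv> fusion m eps N3 N4 M3 M4"
  assumes X: "X \<in> carrier (fusion m eps (N1 + N2 + N3) N4 (fusion m eps (N1 + N2) N3 F12 M3) M4)"
  shows "associator m eps N1 N2 (N3 + N4) M1 M2 F34 (associator m eps (N1 + N2) N3 N4 F12 M3 M4 X) =
    fusion_map m eps N1 (N2 + N3 + N4) M1 (fusion m eps N2 (N3 + N4) M2 F34) (\<lambda>x. x) (associator m eps N2 N3 N4 M2 M3 M4)
      (associator m eps N1 (N2 + N3) N4 M1 F23 M4
        (fusion_map m eps (N1 + N2 + N3) N4 (fusion m eps N1 (N2 + N3) M1 F23) M4
          (associator m eps N1 N2 N3 M1 M2 M3) (\<lambda>x. x) X))"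
proof -
  let ?N = "N1 + N2 + N3 + N4"
  interpret t1: fusion_triple m s eps N1 N2 N3 "N1 + N2" "N2 + N3" "N1 + N2 + N3" M1 M2 M3
    by (intro fusion_triple.intro fusion_triple_axioms.intro fusion_data_axioms M N refl)
  interpret tD: fusion_triple m s eps N2 N3 N4 "N2 + N3" "N3 + N4" "N2 + N3 + N4" M2 M3 M4
    by (intro fusion_triple.intro fusion_triple_axioms.intro fusion_data_axioms M N refl)
  interpret tA: fusion_triple m s eps "N1 + N2" N3 N4 "N1 + N2 + N3" "N3 + N4" ?N F12 M3 M4
    unfolding F12_def
    by (intro fusion_triple.intro fusion_triple_axioms.intro fusion_data_axioms M N refl t1.p12.module_F t1.Ns)
  interpret tB: fusion_triple m s eps N1 N2 "N3 + N4" "N1 + N2" "N2 + N3 + N4" ?N M1 M2 F34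
    unfolding F34_def
    by (intro fusion_triple.intro fusion_triple_axioms.intro fusion_data_axioms M N refl tD.p23.module_F tD.Ns add.assoc)
  interpret tC: fusion_triple m s eps N1 "N2 + N3" N4 "N1 + N2 + N3" "N2 + N3 + N4" ?N M1 F23 M4
    unfolding F23_def
    by (intro fusion_triple.intro fusion_triple_axioms.intro fusion_data_axioms M N refl t1.p23.module_F t1.Ns)
      (simp_all add: add.assoc)
  note m1 = tA.D.fusion_map[OF tC.D.fusion_pair_axioms[unfolded F23_def] t1.alpha(1)[folded F12_def] lmod_hom_id, folded F23_def]
  note m2 = tC.P.fusion_map[OF tB.P.fusion_pair_axioms[unfolded F34_def] lmod_hom_id tD.alpha(1)[folded F23_def], folded F34_def]
  let ?L = "\<lambda>X. tB.\<alpha> (tA.\<alpha> X)"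
  let ?R = "\<lambda>X. fusion_map m eps N1 (N2 + N3 + N4) M1 (fusion m eps N2 (N3 + N4) M2 F34) (\<lambda>x. x) tD.\<alpha>
      (tC.\<alpha> (fusion_map m eps (N1 + N2 + N3) N4 (fusion m eps N1 (N2 + N3) M1 F23) M4 t1.\<alpha> (\<lambda>x. x) X))"
  have add_L: "?L (X \<oplus>\<^bsub>tA.D.F\<^esub> Y) = ?L X \<oplus>\<^bsub>tB.P.F\<^esub> ?L Y" if "X \<in> carrier tA.D.F" "Y \<in> carrier tA.D.F" for X Y
    using that tA.alpha_car[folded F34_def] tA.alpha_add[folded F34_def] tB.alpha_add[folded F12_def] by simp
  have add_R: "?R (X \<oplus>\<^bsub>tA.D.F\<^esub> Y) = ?R X \<oplus>\<^bsub>tB.P.F\<^esub> ?R Y" if "X \<in> carrier tA.D.F" "Y \<in> carrier tA.D.F" for X Y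
    using that by (simp add: lmod_homD[OF m1(2)] lmod_homD[OF m2(2)] tC.alpha_add tC.alpha_car)
  have gen: "?L (tA.D.el a (tA.p12.el b (t1.p12.el c x1 x2) x3) x4) = ?R (tA.D.el a (tA.p12.el b (t1.p12.el c x1 x2) x3) x4)"
    if a: "a \<in> carrier (T ?N)" and b: "b \<in> carrier (T (N1 + N2 + N3))" and c: "c \<in> carrier (T (N1 + N2))"
      and x: "x1 \<in> carrier M1" "x2 \<in> carrier M2" "x3 \<in> carrier M3" "x4 \<in> carrier M4" for a b c x1 x2 x3 x4
  proof -
    have Y: "t1.p12.el c x1 x2 \<in> carrier F12" unfolding F12_def by (rule t1.p12.el_car[OF c x(1,2)])
    have Z: "fusion_elem m eps N3 N4 M3 M4 tl_one x3 x4 \<in> carrier F34"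
      unfolding F34_def by (rule tD.p23.el_car[OF _ x(3,4)]) simp
    have W: "t1.p23.el tl_one x2 x3 \<in> carrier F23" unfolding F23_def by (rule t1.p23.el_car[OF _ x(2,3)]) simp
    have V: "t1.D.el b (t1.p12.el c x1 x2) x3 \<in> carrier t1.D.F"
      by (rule t1.D.el_car[OF b Y[unfolded F12_def] x(3)])
    have U: "tC.p23.el tl_one (t1.p23.el tl_one x2 x3) x4 \<in> carrier tC.p23.F"
      by (rule tC.p23.el_car[OF _ W x(4)]) simp
    let ?e = "E (N1 + N2 + N3) N4"
    have bc: "b \<otimes>\<^bsub>T (N1 + N2 + N3)\<^esub> E (N1 + N2) N3 c tl_one \<in> carrier (T (N1 + N2 + N3))"
      using b c by simp
    let ?x12 = "t1.p12.el c x1 x2" and ?x23 = "t1.p23.el tl_one x2 x3" and ?x34 = "fusion_elem m eps N3 N4 M3 M4 tl_one x3 x4"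
    let ?X = "tA.D.el a (tA.p12.el b ?x12 x3) x4" and ?bc = "b \<otimes>\<^bsub>T (N1 + N2 + N3)\<^esub> E (N1 + N2) N3 c tl_one"
    let ?h = "fusion_map m eps N1 (N2 + N3 + N4) M1 (fusion m eps N2 (N3 + N4) M2 F34) (\<lambda>x. x) tD.\<alpha>"
    have "?L ?X =
        tB.\<alpha> (tB.D.el (a \<otimes>\<^bsub>T ?N\<^esub> ?e b tl_one) ?x12 ?x34)"
      using tA.alpha_el[OF a b Y x(3,4)] unfolding F12_def F23_def F34_def by simp
    also have "\<dots> = tB.P.el ((a \<otimes>\<^bsub>T ?N\<^esub> ?e b tl_one) \<otimes>\<^bsub>T ?N\<^esub> E (N1 + N2) (N3 + N4) c tl_one) x1
        (tB.p23.el tl_one x2 ?x34)"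
      using tB.alpha_el[OF _ c x(1,2) Z, of "a \<otimes>\<^bsub>T ?N\<^esub> ?e b tl_one"] a b
      unfolding F12_def F23_def F34_def by simp
    finally have L: "?L ?X =
        tB.P.el ((a \<otimes>\<^bsub>T ?N\<^esub> ?e b tl_one) \<otimes>\<^bsub>T ?N\<^esub> E (N1 + N2) (N3 + N4) c tl_one) x1
        (tB.p23.el tl_one x2 ?x34)" .
    have "fusion_map m eps (N1 + N2 + N3) N4 (fusion m eps N1 (N2 + N3) M1 F23) M4 t1.\<alpha> (\<lambda>x. x)
          ?X =
        tC.D.el a (t1.\<alpha> (t1.D.el b ?x12 x3)) x4"
      using m1(1)[OF a V[folded F12_def] x(4)] unfolding F12_def F23_def F34_def .
    also have "t1.\<alpha> (t1.D.el b ?x12 x3) =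
        tC.p12.el ?bc x1 ?x23"
      using t1.alpha_el[OF b c x(1,2,3)] unfolding F12_def F23_def F34_def .
    finally have "?R ?X =
        ?h
          (tC.P.el (a \<otimes>\<^bsub>T ?N\<^esub> ?e ?bc tl_one) x1
            (tC.p23.el tl_one ?x23 x4))"
      using tC.alpha_el[OF a bc x(1) W x(4)] by simp
    also have "\<dots> = tB.P.el (a \<otimes>\<^bsub>T ?N\<^esub> ?e ?bc tl_one) x1
        (tD.\<alpha> (tC.p23.el tl_one ?x23 x4))"
      by (rule m2(1)[OF _ x(1) U]) (use a bc in simp)
    also have "tD.\<alpha> (tC.p23.el tl_one ?x23 x4) =
        tB.p23.el tl_one x2 ?x34"
      using tD.alpha_el[OF _ _ x(2,3,4), of tl_one tl_one]
      unfolding F12_def F23_def F34_def 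
      by (simp add: E_one[OF tD.Ns(1) N(4)] tl_one_mult_one)
    \<comment> \<open>One path multiplies by the images of \<open>b\<close> and \<open>c\<close> one
      after the other, the other path by the image of \<open>b\<close> times the embedded
      \<open>c\<close>. They agree because the embedding is multiplicative and, by associativity,
      \<open>c\<close> enters the full algebra directly in the same way as through the first three
      blocks.\<close>
    also have "a \<otimes>\<^bsub>T ?N\<^esub> ?e ?bc tl_one =
        (a \<otimes>\<^bsub>T ?N\<^esub> ?e b tl_one) \<otimes>\<^bsub>T ?N\<^esub> E (N1 + N2) (N3 + N4) c tl_one"
      using a b c tA.E12_mult[of b "E (N1 + N2) N3 c tl_one" tl_one tl_one] tA.left_first[OF c]
      by (simp add: tA.D.TN.m_assoc tl_one_mult_one)
    finally show ?thesis unfolding L by (rule sym)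
  qed
  have "?L X = ?R X"
    using X
  proof (induction rule: tA.D_induct)
    case (el a b Y x3 x4)
    \<comment> \<open>\<open>D_induct\<close> resolves two levels; the entry in \<open>F12\<close>
      belongs to a third fusion product and takes an induction of its own.\<close>
    from el(3)[unfolded F12_def] show ?case
    proof (induction rule: t1.p12.F_induct)
      case (el c x1 x2)
      then show ?case using gen \<open>a \<in> carrier (T ?N)\<close> \<open>b \<in> carrier (T (N1 + N2 + N3))\<close>
          \<open>x3 \<in> carrier M3\<close> \<open>x4 \<in> carrier M4\<close> by blast
    next
      case (add Y Y')
      note abx = \<open>a \<in> carrier (T ?N)\<close> \<open>b \<in> carrier (T (N1 + N2 + N3))\<close> \<open>x3 \<in> carrier M3\<close> \<open>x4 \<in> carrier M4\<close>
      have Y: "Y \<in> carrier F12" "Y' \<in> carrier F12" using add by (simp_all add: F12_def)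
      have y: "tA.p12.el b Y x3 \<in> carrier tA.p12.F" "tA.p12.el b Y' x3 \<in> carrier tA.p12.F"
        using abx Y by (intro tA.p12.el_car; simp)+
      have "tA.D.el a (tA.p12.el b (Y \<oplus>\<^bsub>F12\<^esub> Y') x3) x4 =
          tA.D.el a (tA.p12.el b Y x3) x4 \<oplus>\<^bsub>tA.D.F\<^esub> tA.D.el a (tA.p12.el b Y' x3) x4"
        using abx Y y by (simp add: tA.p12.el_rules(2) tA.D.el_rules(2))
      then show ?case
        using add_L add_R tA.D.el_car[OF abx(1) y(1) abx(4)] tA.D.el_car[OF abx(1) y(2) abx(4)] add(3,4)
        by (simp add: F12_def)
    qed
  next
    case (add X Y)
    then show ?case using add_L add_R by simp
  qed
  then show ?thesis .
qed

theorem proposition6p4p1: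
  fixes q s m :: complex
    and eps :: embeddings
    and N1 N2 N3 :: nat
    and M1 :: "'a tlmod" and M2 :: "'b tlmod" and M3 :: "'c tlmod"
  assumes "q \<noteq> 0" and "s ^ 2 = q" and "m = q + inverse q"
    and eps: "\<forall>K\<ge>1. \<forall>L\<ge>1. fusion_embedding m s K L (eps K L)"
    and "N1 \<ge> 1" and "N2 \<ge> 1" and "N3 \<ge> 1"
    and "left_module (aTL m N1) M1"
    and "left_module (aTL m N2) M2"
    and "left_module (aTL m N3) M3"
  shows
    "lmod_iso (aTL m (N1 + N2 + N3))
       (fusion m eps (N1 + N2) N3 (fusion m eps N1 N2 M1 M2) M3)
       (fusion m eps N1 (N2 + N3) M1 (fusion m eps N2 N3 M2 M3))
       (associator m eps N1 N2 N3 M1 M2 M3) \<and>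
     associator_formula m eps N1 N2 N3 M1 M2 M3 (associator m eps N1 N2 N3 M1 M2 M3) \<and>
     (\<forall>(M1' :: 'd tlmod) (M2' :: 'e tlmod) (M3' :: 'f tlmod) f1 f2 f3.
        left_module (aTL m N1) M1' \<and> f1 \<in> lmod_hom (aTL m N1) M1 M1' \<and>
        left_module (aTL m N2) M2' \<and> f2 \<in> lmod_hom (aTL m N2) M2 M2' \<and>
        left_module (aTL m N3) M3' \<and> f3 \<in> lmod_hom (aTL m N3) M3 M3' \<longrightarrow>
        (\<forall>X\<in>carrier (fusion m eps (N1 + N2) N3 (fusion m eps N1 N2 M1 M2) M3).
           associator m eps N1 N2 N3 M1' M2' M3'
             (fusion_map m eps (N1 + N2) N3 (fusion m eps N1 N2 M1' M2') M3'
                (fusion_map m eps N1 N2 M1' M2' f1 f2) f3 X) =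
           fusion_map m eps N1 (N2 + N3) M1' (fusion m eps N2 N3 M2' M3')
             f1 (fusion_map m eps N2 N3 M2' M3' f2 f3)
             (associator m eps N1 N2 N3 M1 M2 M3 X))) \<and>
     (\<forall>N4\<ge>1. \<forall>M4 :: 'g tlmod. left_module (aTL m N4) M4 \<longrightarrow>
        (\<forall>X\<in>carrier (fusion m eps (N1 + N2 + N3) N4
                (fusion m eps (N1 + N2) N3 (fusion m eps N1 N2 M1 M2) M3) M4).
           associator m eps N1 N2 (N3 + N4) M1 M2 (fusion m eps N3 N4 M3 M4)
             (associator m eps (N1 + N2) N3 N4 (fusion m eps N1 N2 M1 M2) M3 M4 X) =
           fusion_map m eps N1 (N2 + N3 + N4) M1
             (fusion m eps N2 (N3 + N4) M2 (fusion m eps N3 N4 M3 M4))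
             (\<lambda>x. x) (associator m eps N2 N3 N4 M2 M3 M4)
             (associator m eps N1 (N2 + N3) N4 M1 (fusion m eps N2 N3 M2 M3) M4
               (fusion_map m eps (N1 + N2 + N3) N4
                  (fusion m eps N1 (N2 + N3) M1 (fusion m eps N2 N3 M2 M3)) M4
                  (associator m eps N1 N2 N3 M1 M2 M3) (\<lambda>x. x) X))))"
proof -
  have R: "\<forall>K\<ge>1. \<forall>L\<ge>1. fusion_embedding m s K L (eps K L)" by (rule eps)
  interpret fusion_data m s eps
    by unfold_locales (use R in blast)
  interpret t: fusion_triple m s eps N1 N2 N3 "N1 + N2" "N2 + N3" "N1 + N2 + N3" M1 M2 M3
    by (intro fusion_triple.intro fusion_triple_axioms.intro fusion_data_axioms assms refl)
  show ?thesis
  proof (intro conjI allI impI ballI, goal_cases)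
    case 1
    show ?case by (rule t.alpha_iso)
  next
    case 2
    show ?case by (rule t.alpha(2))
  next
    case (3 M1' M2' M3' f1 f2 f3 X)
    then have "fusion_triple m s eps N1 N2 N3 (N1 + N2) (N2 + N3) (N1 + N2 + N3) M1' M2' M3'"
      by (intro fusion_triple.intro fusion_triple_axioms.intro fusion_data_axioms assms refl) blast+
    from t.associator_natural[OF this _ _ _ 3(2)] 3(1) show ?case by blast
  next
    case (4 N4 M4 X)
    then show ?case using assms by (intro pentagon)
  qed
qed

end
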